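(* Let $n\ge2$ and $k_1,k_2\in[n-1]$. The function $E:\mathbb X_{k_1}\times\mathbb X_{k_2}\to\mathbb C$ defined by $E(u,v)=\Delta_{[n-k+1,n],[k]}(g(u)g(v))$, where $k=\min(k_1,k_2)$, is a geometric coenergy function.
   Context: Notation. Fix $n\ge2$; $[m]=\{1,\dots,m\}$, $[i,j]=\{m\in\mathbb Z: i\le m\le j\}$. $\Delta_{I,J}(X)$ is the minor of $X$ with rows $I$ and columns $J$. For $k\in[n-1]$, $\mathbb X_k=\mathrm{Gr}(k,n)\times\mathbb C^\times$, with points written $N|t$. A subspace $N\in\mathrm{Gr}(k,n)$ is the column span of a full-rank $n\times k$ matrix, and $P_J(N)$ is the maximal minor of that matrix with row set $J$ (rows in increasing order), defined up to a common nonzero scalar. Index sets of integers are reduced modulo $n$ to subsets of $[n]$, and $P_I:=0$ if the reduced set does not have exactly $k$ elements. The map $g$. $\lambda$ is an indeterminate. $g(N|t)$ is the $n\times n$ matrix with entries $g(N|t)_{ij}=c_{ij}\,P_{[j-k+1,j-1]\cup\{i\}}(N)/P_{[j-k,j-1]}(N)$, where $c_{ij}=1$ if $j\le k$; $c_{ij}=t$ if $j>k$ and $i\ge j$; $c_{ij}=\lambda$ if $j>k$ and $i<j$. The minor defining $E$ does not depend on $\lambda$. The geometric $R$-matrix. For $z\in\mathbb C^\times$ and an $n\times n$ matrix $A$ over $\mathbb C[\lambda,\lambda^{-1}]$, $\pi^k_z(A)=N|z$ where $N$ is the span of the first $k$ columns of $A|_{\lambda=(-1)^{k-1}z}$ (defined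 when these columns are linearly independent). Let $\mathrm{fl}(A)_{ij}=A_{n-j+1,n-i+1}$. Define $S:\mathbb X_k\to\mathbb X_k$ by $S(N|t)=\pi^k_t(\mathrm{fl}(g(N|t)))$, and on products $S(x_1,\dots,x_d)=(S(x_d),\dots,S(x_1))$. Define $\Psi_{k,\ell}:\mathbb X_\ell\times\mathbb X_k\to\mathbb X_k$ by $\Psi_{k,\ell}(M|s,N|t)=\pi^k_t(g(M|s)g(N|t))$. The geometric $R$-matrix is the rational map $R=(\Psi_{k,\ell},\ S\circ\Psi_{\ell,k}\circ S):\mathbb X_\ell\times\mathbb X_k\to\mathbb X_k\times\mathbb X_\ell$. Geometric crystal structure on $\mathbb X_k$, for $i\in\mathbb Z/n\mathbb Z$ represented by $i\in\{0,\dots,n-1\}$: $\varphi_i(N|t)=t^{-\delta_{i,0}}P_{[i-k+1,i-1]\cup\{i+1\}}(N)/P_{[i-k+1,i]}(N)$; $\varepsilon_i(N|t)=t^{-\delta_{i,k}}\dfrac{P_{[i-k+1,i-1]\cup\{i+1\}}(N)P_{[i-k+1,i]}(N)}{P_{[i-k,i-1]}(N)P_{[i-k+2,i+1]}(N)}$; $e_i^c(N|t)=N'|t$ ($c\in\mathbb C^\times$) with $N'=x_i\big(\tfrac{c-1}{\varphi_i(N|t)}\big)\cdot N$ if $i\ne0$ and $N'=x_0\big(\tfrac{(-1)^{k-1}}{t}\tfrac{c-1}{\varphi_0(N|t)}\big)\cdot N$ if $i=0$, where $x_i(a)=Id+aE_{i,i+1}$ for $i\in[n-1]$ and $x_0(a)=Id+aE_{n1}$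 (with $E_{ij}$ the $n\times n$ matrix units). On a product: $e_i^c(x,y)=(e_i^{c_1}(x),e_i^{c_2}(y))$ with $c_1=\frac{c\varepsilon_i(x)+\varphi_i(y)}{\varepsilon_i(x)+\varphi_i(y)}$, $c_2=\frac{\varepsilon_i(x)+\varphi_i(y)}{\varepsilon_i(x)+c^{-1}\varphi_i(y)}$. Definition. A rational function $H:\mathbb X_{k_1}\times\mathbb X_{k_2}\to\mathbb C$ is a geometric coenergy function if $H\circ e_i^c=H$ for $i=1,\dots,n-1$ and all $c$, and, writing $R(u,v)=(v',u')$, $$H(e_0^c(u,v))=H(u,v)\left(\frac{\varepsilon_0(u)+c^{-1}\varphi_0(v)}{\varepsilon_0(u)+\varphi_0(v)}\right)\left(\frac{c\,\varepsilon_0(v')+\varphi_0(u')}{\varepsilon_0(v')+\varphi_0(u')}\right)$$ (as an identity of rational functions). *)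

theory Defs
  imports
    "HOL-Library.Monad_Syntax"
    "HOL-Computational_Algebra.Polynomial"
    "Jordan_Normal_Form.DL_Rank"
    "Jordan_Normal_Form.DL_Submatrix"
begin

text \<open>
  Rational maps are modelled as partial functions (option-valued): a value is undefined exactly
  when one of the denominators or non-degeneracy conditions in its formula fails. Identities of
  rational functions are asserted generically, i.e. on a nonempty Zariski-open set on which both
  sides are defined. Indices of rows, columns and subspaces are 1-based as in mathematics,
  whereas the entries of \<^typ>\<open>complex mat\<close> are 0-based.
\<close>

definition pdiv :: "complex \<Rightarrow> complex \<Rightarrow> complex option" where
  "pdiv a b = (if b = 0 then None else Some (a / b))"

definition minor :: "'a::comm_ring_1 mat \<Rightarrow> nat set \<Rightarrow> nat set \<Rightarrow> 'a" where
  "minor A I J = det (submatrix A {i. Suc i \<in> I} {j. Suc j \<in> J})"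


subsection \<open>Grassmannians and Pluecker coordinates\<close>

type_synonym point = "complex vec set \<times> complex"

definition frame :: "nat \<Rightarrow> nat \<Rightarrow> complex mat \<Rightarrow> complex vec set \<Rightarrow> bool" where
  "frame n k A N \<longleftrightarrow>
     A \<in> carrier_mat n k \<and> vec_space.rank n A = k \<and> vec_space.col_space n A = N"

definition Gr :: "nat \<Rightarrow> nat \<Rightarrow> complex vec set set" where
  "Gr n k = {N. \<exists>A. frame n k A N}"

definition X_space :: "nat \<Rightarrow> nat \<Rightarrow> point set" where
  "X_space n k = Gr n k \<times> (UNIV - {0})"

definition reduce :: "nat \<Rightarrow> int set \<Rightarrow> nat set" where
  "reduce n I = {m \<in> {1..n}. \<exists>i\<in>I. i mod int n = int m mod int n}"

text \<open>
  The common scalar in the Pluecker coordinates of \<open>N\<close> is fixed by choosing one matrix with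
  column span \<open>N\<close>. All formulas below are homogeneous of degree 0 in the coordinates of each
  subspace, so nothing depends on the choice.
\<close>

definition pluecker :: "nat \<Rightarrow> nat \<Rightarrow> int set \<Rightarrow> complex vec set \<Rightarrow> complex" where
  "pluecker n k I N =
     (if card (reduce n I) = k then minor (SOME A. frame n k A N) (reduce n I) {1..k} else 0)"


subsection \<open>The map \<open>g\<close> and the geometric \<open>R\<close>-matrix\<close>

text \<open>The indeterminate \<open>\<lambda>\<close> is \<^term>\<open>[:0, 1:] :: complex poly\<close>. No negative powers of
  \<open>\<lambda>\<close> occur in the matrices considered.\<close>

definition g_coeff :: "nat \<Rightarrow> complex \<Rightarrow> nat \<Rightarrow> nat \<Rightarrow> complex poly" where
  "g_coeff k t i j = (if j \<le> k then 1 else if i \<ge> j then [:t:] else [:0, 1:])"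

definition g_map :: "nat \<Rightarrow> nat \<Rightarrow> point \<Rightarrow> complex poly mat option" where
  "g_map n k = (\<lambda>(N, t).
     if \<forall>j\<in>{1..n}. pluecker n k {int j - int k..int j - 1} N \<noteq> 0 then
       Some (mat n n (\<lambda>(a, b). let i = Suc a; j = Suc b in
         Polynomial.smult (pluecker n k ({int j - int k + 1..int j - 1} \<union> {int i}) N
                / pluecker n k {int j - int k..int j - 1} N)
           (g_coeff k t i j)))
     else None)"

definition proj :: "nat \<Rightarrow> nat \<Rightarrow> complex \<Rightarrow> complex poly mat \<Rightarrow> point option" where
  "proj n k z A =
     (let B = mat n k (\<lambda>(a, b). poly (A $$ (a, b)) ((-1) ^ (k - 1) * z)) in
      if z \<noteq> 0 \<and> vec_space.rank n B = k then Some (vec_space.col_space n B, z) else None)"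

definition flip :: "nat \<Rightarrow> 'a mat \<Rightarrow> 'a mat" where
  "flip n A = mat n n (\<lambda>(a, b). A $$ (n - 1 - b, n - 1 - a))"

definition S_map :: "nat \<Rightarrow> nat \<Rightarrow> point \<Rightarrow> point option" where
  "S_map n k x = do { A \<leftarrow> g_map n k x; proj n k (snd x) (flip n A) }"

definition S_map2 :: "nat \<Rightarrow> nat \<Rightarrow> nat \<Rightarrow> point \<times> point \<Rightarrow> (point \<times> point) option" where
  "S_map2 n k1 k2 = (\<lambda>(x, y). do { y' \<leftarrow> S_map n k2 y; x' \<leftarrow> S_map n k1 x; Some (y', x') })"

text \<open>\<open>\<Psi>\<^bsub>k,l\<^esub> : X\<^sub>l \<times> X\<^sub>k \<rightarrow> X\<^sub>k\<close>\<close>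

definition Psi :: "nat \<Rightarrow> nat \<Rightarrow> nat \<Rightarrow> point \<times> point \<Rightarrow> point option" where
  "Psi n k l = (\<lambda>(x, y). do { A \<leftarrow> g_map n l x; B \<leftarrow> g_map n k y; proj n k (snd y) (A * B) })"

text \<open>\<open>R : X\<^sub>l \<times> X\<^sub>k \<rightarrow> X\<^sub>k \<times> X\<^sub>l\<close>\<close>

definition R_map :: "nat \<Rightarrow> nat \<Rightarrow> nat \<Rightarrow> point \<times> point \<Rightarrow> (point \<times> point) option" where
  "R_map n l k xy = do {
     v' \<leftarrow> Psi n k l xy;
     yx \<leftarrow> S_map2 n l k xy;
     w \<leftarrow> Psi n l k yx;
     u' \<leftarrow> S_map n l w;
     Some (v', u') }"


subsection \<open>Geometric crystal structure\<close>

definition phi_map :: "nat \<Rightarrow> nat \<Rightarrow> nat \<Rightarrow> point \<Rightarrow> complex option" where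
  "phi_map n k i = (\<lambda>(N, t).
     pdiv ((if i = 0 then inverse t else 1) *
           pluecker n k ({int i - int k + 1..int i - 1} \<union> {int i + 1}) N)
          (pluecker n k {int i - int k + 1..int i} N))"

definition eps_map :: "nat \<Rightarrow> nat \<Rightarrow> nat \<Rightarrow> point \<Rightarrow> complex option" where
  "eps_map n k i = (\<lambda>(N, t).
     pdiv ((if i = k then inverse t else 1) *
           (pluecker n k ({int i - int k + 1..int i - 1} \<union> {int i + 1}) N *
            pluecker n k {int i - int k + 1..int i} N))
          (pluecker n k {int i - int k..int i - 1} N *
           pluecker n k {int i - int k + 2..int i + 1} N))"

text \<open>\<open>x_mat n i a\<close> is \<open>Id + a E\<^bsub>i,i+1\<^esub>\<close> for \<open>1 \<le> i \<le> n - 1\<close> and \<open>Id + a E\<^bsub>n,1\<^esub>\<close> for \<open>i = 0\<close>.\<close>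

definition x_mat :: "nat \<Rightarrow> nat \<Rightarrow> complex \<Rightarrow> complex mat" where
  "x_mat n i a = 1\<^sub>m n + mat n n (\<lambda>(r, c).
     if (Suc r, Suc c) = (if i = 0 then (n, 1) else (i, i + 1)) then a else 0)"

definition e_map :: "nat \<Rightarrow> nat \<Rightarrow> nat \<Rightarrow> complex \<Rightarrow> point \<Rightarrow> point option" where
  "e_map n k i c = (\<lambda>(N, t).
     if c = 0 then None else do {
       p \<leftarrow> phi_map n k i (N, t);
       a \<leftarrow> pdiv (c - 1) p;
       b \<leftarrow> (if i = 0 then pdiv ((-1) ^ (k - 1)) t else Some 1);
       Some ((\<lambda>w. x_mat n i (b * a) *\<^sub>v w) ` N, t) })"

definition e_map2 :: "nat \<Rightarrow> nat \<Rightarrow> nat \<Rightarrow> nat \<Rightarrow> complex \<Rightarrow> point \<times> point \<Rightarrow> (point \<times> point) option"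
  where
  "e_map2 n k1 k2 i c = (\<lambda>(x, y). do {
     ex \<leftarrow> eps_map n k1 i x;
     py \<leftarrow> phi_map n k2 i y;
     c1 \<leftarrow> pdiv (c * ex + py) (ex + py);
     c2 \<leftarrow> pdiv (ex + py) (ex + inverse c * py);
     x' \<leftarrow> e_map n k1 i c1 x;
     y' \<leftarrow> e_map n k2 i c2 y;
     Some (x', y') })"


subsection \<open>Rational functions on \<open>X\<^bsub>k1\<^esub> \<times> X\<^bsub>k2\<^esub>\<close>\<close>

text \<open>
  Polynomial functions in the entries of an \<open>n \<times> k1\<close> matrix \<open>A\<close>, an \<open>n \<times> k2\<close> matrix \<open>B\<close>, and the
  two parameters \<open>s\<close>, \<open>t\<close>. The product is the quotient of the pairs of full-rank matrices and nonzero
  parameters by \<open>GL\<^bsub>k1\<^esub> \<times> GL\<^bsub>k2\<^esub>\<close>, so its rational functions are described by their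
  pullbacks to matrices.
\<close>

inductive poly_fun :: "nat \<Rightarrow> nat \<Rightarrow> nat \<Rightarrow>
    (complex mat \<Rightarrow> complex \<Rightarrow> complex mat \<Rightarrow> complex \<Rightarrow> complex) \<Rightarrow> bool" for n k1 k2 where
  const: "poly_fun n k1 k2 (\<lambda>A s B t. a)"
| coord_A: "i < n \<Longrightarrow> j < k1 \<Longrightarrow> poly_fun n k1 k2 (\<lambda>A s B t. A $$ (i, j))"
| coord_s: "poly_fun n k1 k2 (\<lambda>A s B t. s)"
| coord_B: "i < n \<Longrightarrow> j < k2 \<Longrightarrow> poly_fun n k1 k2 (\<lambda>A s B t. B $$ (i, j))"
| coord_t: "poly_fun n k1 k2 (\<lambda>A s B t. t)"
| add: "poly_fun n k1 k2 p \<Longrightarrow> poly_fun n k1 k2 q \<Longrightarrow>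
    poly_fun n k1 k2 (\<lambda>A s B t. p A s B t + q A s B t)"
| mult: "poly_fun n k1 k2 p \<Longrightarrow> poly_fun n k1 k2 q \<Longrightarrow>
    poly_fun n k1 k2 (\<lambda>A s B t. p A s B t * q A s B t)"

definition nonzero_poly_fun :: "nat \<Rightarrow> nat \<Rightarrow> nat \<Rightarrow>
    (complex mat \<Rightarrow> complex \<Rightarrow> complex mat \<Rightarrow> complex \<Rightarrow> complex) \<Rightarrow> bool" where
  "nonzero_poly_fun n k1 k2 q \<longleftrightarrow> poly_fun n k1 k2 q \<and>
     (\<exists>A\<in>carrier_mat n k1. \<exists>B\<in>carrier_mat n k2. \<exists>s t. q A s B t \<noteq> 0)"

definition rational_function :: "nat \<Rightarrow> nat \<Rightarrow> nat \<Rightarrow> (point \<times> point \<Rightarrow> complex option) \<Rightarrow> bool" where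
  "rational_function n k1 k2 H \<longleftrightarrow>
     (\<exists>p q. poly_fun n k1 k2 p \<and> nonzero_poly_fun n k1 k2 q \<and>
       (\<forall>(M, s)\<in>X_space n k1. \<forall>(N, t)\<in>X_space n k2. \<forall>A B. frame n k1 A M \<longrightarrow> frame n k2 B N \<longrightarrow>
          q A s B t \<noteq> 0 \<longrightarrow> H ((M, s), (N, t)) = Some (p A s B t / q A s B t)))"

text \<open>Equality as rational functions: on a nonempty (hence dense) Zariski-open set both
  sides are defined and agree.\<close>

definition rational_eq :: "nat \<Rightarrow> nat \<Rightarrow> nat \<Rightarrow>
    (point \<times> point \<Rightarrow> complex option) \<Rightarrow> (point \<times> point \<Rightarrow> complex option) \<Rightarrow> bool" where
  "rational_eq n k1 k2 F G \<longleftrightarrow>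
     (\<exists>q. nonzero_poly_fun n k1 k2 q \<and>
       (\<forall>(M, s)\<in>X_space n k1. \<forall>(N, t)\<in>X_space n k2. \<forall>A B. frame n k1 A M \<longrightarrow> frame n k2 B N \<longrightarrow>
          q A s B t \<noteq> 0 \<longrightarrow>
          (\<exists>h. F ((M, s), (N, t)) = Some h \<and> G ((M, s), (N, t)) = Some h)))"


subsection \<open>Geometric coenergy functions\<close>

definition geometric_coenergy ::
    "nat \<Rightarrow> nat \<Rightarrow> nat \<Rightarrow> (point \<times> point \<Rightarrow> complex option) \<Rightarrow> bool" where
  "geometric_coenergy n k1 k2 H \<longleftrightarrow>
     rational_function n k1 k2 H \<and>
     (\<forall>i\<in>{1..n - 1}. \<forall>c. c \<noteq> 0 \<longrightarrow>
        rational_eq n k1 k2 (\<lambda>x. do { y \<leftarrow> e_map2 n k1 k2 i c x; H y }) H) \<and>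
     (\<forall>c. c \<noteq> 0 \<longrightarrow>
        rational_eq n k1 k2
          (\<lambda>x. do { y \<leftarrow> e_map2 n k1 k2 0 c x; H y })
          (\<lambda>(u, v). do {
             h \<leftarrow> H (u, v);
             (v', u') \<leftarrow> R_map n k1 k2 (u, v);
             eu \<leftarrow> eps_map n k1 0 u;
             pv \<leftarrow> phi_map n k2 0 v;
             ev \<leftarrow> eps_map n k2 0 v';
             pu \<leftarrow> phi_map n k1 0 u';
             a \<leftarrow> pdiv (eu + inverse c * pv) (eu + pv);
             b \<leftarrow> pdiv (c * ev + pu) (ev + pu);
             Some (h * a * b) }))"

text \<open>The minor defining \<open>E\<close> is a priori a polynomial in \<open>\<lambda>\<close>; \<open>E\<close> takes a value only where that
  polynomial is constant.\<close>

definition E_map :: "nat \<Rightarrow> nat \<Rightarrow> nat \<Rightarrow> point \<times> point \<Rightarrow> complex option" where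
  "E_map n k1 k2 = (\<lambda>(u, v). do {
     A \<leftarrow> g_map n k1 u;
     B \<leftarrow> g_map n k2 v;
     let k = min k1 k2; m = minor (A * B) {n - k + 1..n} {1..k} in
     if degree m = 0 then Some (coeff m 0) else None })"

end

theory Submission
  imports Defs
begin

text \<open>The proof takes place among the matrices \<open>g(u)\<close>. For \<open>u = N|t\<close> in \<open>X\<^sub>k\<close> put
\<open>z\<^sub>k(t) = (-1)\<^bsup>k-1\<^esup> t\<close>. If the coefficient of \<open>\<lambda>\<^bsup>p\<^esup>\<close> in row \<open>i\<close> is placed in row \<open>i + n p\<close>
of an infinite matrix, then column \<open>j\<close> of \<open>g(u)\<close> is supported in the rows from \<open>j\<close> to
\<open>j + n - k\<close>, starts with a nonzero number and ends with \<open>1\<close> (\<open>banded\<close>); and at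
\<open>\<lambda> = z\<^sub>k(t)\<close> the matrix has image \<open>N\<close>. These properties determine \<open>g(u)\<close>, because a vector of
\<open>N\<close> with prescribed coordinates in \<open>k\<close> cyclically consecutive rows is unique (\<open>band_eq_gmat\<close>).
This characterization replaces most computations with Pluecker coordinates.

\<^item> Reflection at the antidiagonal preserves these properties, so \<open>g(S u)\<close> is the reflection of
  \<open>g(u)\<close>, and \<open>S\<close> is an involution.

\<^item> With \<open>A = g(u) g(v)\<close> and \<open>R(u,v) = (v',u')\<close> one has \<open>A = g(v') g(u')\<close>
  (\<open>R_map_factorization\<close>). By definition \<open>A\<close> and \<open>g(v')\<close> have the same image at the spectral value of
  \<open>v\<close>, and this is the only value where \<open>g(v')\<close> loses rank; therefore \<open>g(v')\<close> divides \<open>A\<close> from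
  the left over the polynomials (\<open>band_factorization\<close>). The quotient is banded and loses rank at the spectral value
  of \<open>u\<close>, hence is \<open>g\<close> of some point, and this point is \<open>u'\<close> by the reflection symmetry.

\<^item> \<open>e\<^sub>i\<^sup>c\<close> multiplies \<open>g(u)\<close> on both sides by elementary matrices, with \<open>\<lambda>\<^bsup>-1\<^esup>\<close> in the
  corner if \<open>i = 0\<close>; on a product the two inner factors cancel, so \<open>A\<close> becomes
  \<open>x\<^sub>i(a) A x\<^sub>i(b)\<close> (\<open>g_e_map\<close>, \<open>g_e_map2\<close>).

\<open>E\<close> is the bottom left \<open>k \<times> k\<close> minor of \<open>A\<close>, and does not involve \<open>\<lambda>\<close>. For \<open>i \<noteq> 0\<close> both
elementary matrices are upper unitriangular and leave this minor unchanged. For \<open>i = 0\<close> the minor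
may be evaluated at the value \<open>z\<close> of \<open>\<lambda>\<close> where the factor of type \<open>k = min k\<^sub>1 k\<^sub>2\<close> has rank
\<open>k\<close>. There \<open>A\<close> factors through a space of dimension \<open>k\<close>, as \<open>g(x) Y = X g(y)\<close> with
\<open>(x,y) = (v',v)\<close> if \<open>k = k\<^sub>2\<close> and \<open>(x,y) = (u,u')\<close> if \<open>k = k\<^sub>1\<close>. The minor is a product of one
determinant that sees only the column space and one that sees only the row space, and it is
multiplied by \<open>(1 + a \<phi>\<^sub>0(x)) (1 + b \<epsilon>\<^sub>0(y))\<close> (\<open>bottom_minor_xhat0\<close>). The corner
coefficients of \<open>g(u) g(v) = g(v') g(u')\<close> turn this factor into the one in the definition of a
coenergy function (\<open>coenergy_ratios\<close>).

All identities are between rational functions. Each non-degeneracy condition says that some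
function, polynomial after multiplication by a power of the consecutive minors, is nonzero, and one
point where it is nonzero suffices. The conditions can be witnessed one at a time, often at
the degenerate spectral parameters \<open>s = 0\<close> or \<open>t = 0\<close>, where the matrices become triangular.\<close>

section \<open>Determinants of selected rows and frames of subspaces\<close>

text \<open>Rows are listed by a function rather than by a set, so that they may come in any order; the sign
of a Pluecker coordinate is then visible in the order of its rows.\<close>

definition row_det :: "nat \<Rightarrow> 'a::comm_ring_1 mat \<Rightarrow> (nat \<Rightarrow> nat) \<Rightarrow> 'a" where
  "row_det k F r = det (mat k k (\<lambda>(a, c). F $$ (r a, c)))"

lemma pick_strict_mono_image:
  fixes r :: "nat \<Rightarrow> nat"
  assumes "strict_mono_on {..<k} r" and "a < k"
  shows "pick (r ` {..<k}) a = r a"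
proof -
  have lt: "r b < r a \<longleftrightarrow> b < a" if "b < k" for b
    using assms that by (metis lessThan_iff linorder_less_linear order_less_asym strict_mono_onD)
  have "{x \<in> r ` {..<k}. x < r a} = r ` {..<a}"
    using lt assms(2) by auto
  moreover have "card (r ` {..<a}) = a"
    using assms by (subst card_image) (auto intro!: inj_on_subset[OF strict_mono_on_imp_inj_on[OF assms(1)]])
  ultimately show ?thesis
    using pick_card_in_set[of "r a" "r ` {..<k}"] assms(2) by auto
qed

lemma minor_eq_row_det:
  assumes F: "F \<in> carrier_mat n m" and "k \<le> m"
    and mono: "strict_mono_on {..<k} r" and lt: "\<And>a. a < k \<Longrightarrow> r a < n"
  shows "minor F (Suc ` r ` {..<k}) {1..k} = row_det k F r"
proof -
  have I: "{i. Suc i \<in> Suc ` r ` {..<k}} = r ` {..<k}" by auto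
  have J: "{j. Suc j \<in> {1..k}} = (\<lambda>a. a) ` {..<k}" by auto
  have c1: "card {i. i < dim_row F \<and> i \<in> r ` {..<k}} = k"
  proof -
    have "{i. i < dim_row F \<and> i \<in> r ` {..<k}} = r ` {..<k}" using F lt by auto
    then show ?thesis using strict_mono_on_imp_inj_on[OF mono] by (simp add: card_image)
  qed
  have c2: "card {i. i < dim_col F \<and> i \<in> (\<lambda>a. a) ` {..<k}} = k"
  proof -
    have "{i. i < dim_col F \<and> i \<in> (\<lambda>a. a) ` {..<k}} = {..<k}" using F \<open>k \<le> m\<close> by auto
    then show ?thesis by simp
  qed
  have "submatrix F (r ` {..<k}) ((\<lambda>a. a) ` {..<k}) = mat k k (\<lambda>(a, c). F $$ (r a, c))"
    unfolding submatrix_def c1 c2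
    by (rule eq_matI)
      (use pick_strict_mono_image[OF mono] pick_strict_mono_image[of k "\<lambda>a. a"] in
        \<open>auto simp: strict_mono_on_def\<close>)
  then show ?thesis unfolding minor_def I J row_det_def by simp
qed

lemma row_det_mult:
  assumes F: "F \<in> carrier_mat n k" and X: "X \<in> carrier_mat k m" and "k \<le> m"
    and lt: "\<And>a. a < k \<Longrightarrow> r a < n"
  shows "row_det k (F * X) r = row_det k F r * row_det k X (\<lambda>a. a)"
proof -
  have "mat k k (\<lambda>(a, c). (F * X) $$ (r a, c)) =
      mat k k (\<lambda>(a, c). F $$ (r a, c)) * mat k k (\<lambda>(a, c). X $$ (a, c))"
    by (rule eq_matI) (use assms in \<open>auto simp: scalar_prod_def\<close>)
  then show ?thesis unfolding row_det_def by (simp add: det_mult[of _ k])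
qed

text \<open>Two enumerations of the same rows differ by a permutation, which changes the determinant only by
a sign.\<close>

lemma row_det_reorder:
  fixes F :: "'a::idom mat"
  assumes "inj_on r {..<k}" "inj_on r' {..<k}" "r ` {..<k} = r' ` {..<k}" "row_det k F r \<noteq> 0"
  shows "row_det k F r' \<noteq> 0"
proof -
  define p where "p a = (if a < k then inv_into {..<k} r (r' a) else a)" for a
  have rp: "r (p a) = r' a" and pk: "p a < k" if "a < k" for a
  proof -
    have "r' a \<in> r ` {..<k}" using that assms(3) by auto
    then show "r (p a) = r' a" "p a < k"
      using that f_inv_into_f[of "r' a" r "{..<k}"] inv_into_into[of "r' a" r "{..<k}"]
      by (auto simp: p_def)
  qed
  have "p permutes {0..<k}"
  proof (rule bij_imp_permutes)
    have "inj_on p {0..<k}"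
      using rp assms(2) by (auto simp: inj_on_def) (metis lessThan_iff)
    moreover from this have "p ` {0..<k} = {0..<k}"
      by (intro card_subset_eq) (auto simp: card_image pk)
    ultimately show "bij_betw p {0..<k} {0..<k}" by (simp add: bij_betw_def)
  qed (auto simp: p_def)
  moreover have "mat k k (\<lambda>(a, c). F $$ (r' a, c)) =
      mat k k (\<lambda>(a, c). mat k k (\<lambda>(a, c). F $$ (r a, c)) $$ (p a, c))"
    by (rule eq_matI) (auto simp: rp pk)
  ultimately show ?thesis
    using det_permute_rows[of "mat k k (\<lambda>(a, c). F $$ (r a, c))" k p] assms(4)
    by (simp add: row_det_def sign_def)
qed

lemma injective_of_row_det:
  fixes F :: "'a::field mat"
  assumes F: "F \<in> carrier_mat n k" and d: "row_det k F r \<noteq> 0"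
    and lt: "\<And>a. a < k \<Longrightarrow> r a < n"
    and x: "x \<in> carrier_vec k" and zero: "\<And>a. a < k \<Longrightarrow> (F *\<^sub>v x) $ r a = 0"
  shows "x = 0\<^sub>v k"
proof (rule ccontr)
  assume nz: "x \<noteq> 0\<^sub>v k"
  have "mat k k (\<lambda>(a, c). F $$ (r a, c)) *\<^sub>v x = 0\<^sub>v k"
    by (rule eq_vecI) (use F lt x zero in \<open>auto simp: scalar_prod_def\<close>)
  with nz x d show False unfolding row_det_def
    using det_0_iff_vec_prod_zero_field[of "mat k k (\<lambda>(a, c). F $$ (r a, c))" k] by auto
qed

lemma cancel_left_of_row_det:
  fixes F :: "'a::field mat"
  assumes F: "F \<in> carrier_mat n k" and d: "row_det k F r \<noteq> 0" and lt: "\<And>a. a < k \<Longrightarrow> r a < n"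
    and X: "X \<in> carrier_mat k m" and Y: "Y \<in> carrier_mat k m" and eq: "F * X = F * Y"
  shows "X = Y"
proof (rule eq_matI)
  fix a c assume ac: "a < dim_row Y" "c < dim_col Y"
  have c: "c < m" using ac Y by auto
  have "F *\<^sub>v (col X c - col Y c) = col (F * X) c - col (F * Y) c"
    using F X Y c by (subst mult_minus_distrib_mat_vec[of _ n k]) (auto simp: col_mult2[of _ n k _ m])
  also have "\<dots> = 0\<^sub>v n" unfolding eq using F Y c by auto
  finally have *: "F *\<^sub>v (col X c - col Y c) = 0\<^sub>v n" .
  have "col X c - col Y c = 0\<^sub>v k"
    by (rule injective_of_row_det[OF F d lt]) (use * lt X Y c in auto)
  then have "(col X c - col Y c) $ a = 0" using ac Y by simp
  then show "X $$ (a, c) = Y $$ (a, c)" using X Y ac by auto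
qed (use X Y in auto)

lemma factor_through:
  fixes F :: "'a::comm_ring_1 mat"
  assumes F: "F \<in> carrier_mat n k" and G: "G \<in> carrier_mat n m"
    and ex: "\<And>c. c < m \<Longrightarrow> \<exists>x\<in>carrier_vec k. col G c = F *\<^sub>v x"
  shows "\<exists>X\<in>carrier_mat k m. G = F * X"
proof -
  obtain x where x: "\<And>c. c < m \<Longrightarrow> x c \<in> carrier_vec k" "\<And>c. c < m \<Longrightarrow> col G c = F *\<^sub>v x c"
    using ex by metis
  have "G = F * mat k m (\<lambda>(a, c). x c $ a)"
  proof (rule eq_matI)
    fix i j assume "i < dim_row (F * mat k m (\<lambda>(a, c). x c $ a))"
      "j < dim_col (F * mat k m (\<lambda>(a, c). x c $ a))"
    then have ij: "i < n" "j < m" using F by auto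
    have "col (mat k m (\<lambda>(a, c). x c $ a)) j = x j" using ij x(1)[of j] by (intro eq_vecI) auto
    moreover have "G $$ (i, j) = col G j $ i" using G ij by simp
    ultimately show "G $$ (i, j) = (F * mat k m (\<lambda>(a, c). x c $ a)) $$ (i, j)"
      using F ij x[of j] by simp
  qed (use F G in auto)
  then show ?thesis by (intro bexI[of _ "mat k m (\<lambda>(a, c). x c $ a)"]) auto
qed

lemma mat_mult_unit_vec:
  fixes A :: "'a::comm_ring_1 mat"
  assumes "A \<in> carrier_mat n k" and "j < k"
  shows "A *\<^sub>v unit_vec k j = col A j"
  by (rule eq_vecI) (use assms in auto)

lemma frame_of_row_det:
  assumes F: "F \<in> carrier_mat n k" and d: "row_det k F r \<noteq> 0" and lt: "\<And>a. a < k \<Longrightarrow> r a < n"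
  shows "frame n k F (vec_space.col_space n F)"
proof -
  interpret vec_space "TYPE(complex)" n .
  have inj: "x = 0\<^sub>v k" if "x \<in> carrier_vec k" "F *\<^sub>v x = 0\<^sub>v n" for x
    by (rule injective_of_row_det[OF F d lt that(1)]) (use that lt in auto)
  have dist: "distinct (cols F)"
  proof (rule ccontr)
    assume "\<not> distinct (cols F)"
    then obtain i j where ij: "i < k" "j < k" "i \<noteq> j" "cols F ! i = cols F ! j"
      using F by (auto simp: distinct_conv_nth)
    then have eq: "col F i = col F j" using F by auto
    have "F *\<^sub>v (unit_vec k i - unit_vec k j) = 0\<^sub>v n"
      using F ij eq by (subst mult_minus_distrib_mat_vec[of _ n k]) (auto simp: mat_mult_unit_vec[of _ n k])
    then have "unit_vec k i - unit_vec k j = (0\<^sub>v k :: complex vec)" by (intro inj) auto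
    then have "(unit_vec k i - unit_vec k j :: complex vec) $ i = 0" using ij by simp
    then show False using ij by auto
  qed
  have "lin_indpt (set (cols F))"
    using lin_depE[OF F _ dist] inj by metis
  then have "rank F = k" using lin_indpt_full_rank[OF F dist] by simp
  then show ?thesis using F by (simp add: frame_def)
qed

text \<open>Two frames of a subspace express each other, by square matrices that are inverse to each other.
Ratios of Pluecker coordinates therefore do not depend on the frame that is chosen.\<close>

lemma frame_change:
  assumes F: "frame n k F N" and F': "frame n k F' N"
    and d: "row_det k F r \<noteq> 0" and lt: "\<And>a. a < k \<Longrightarrow> r a < n"
  shows "\<exists>X\<in>carrier_mat k k. F' = F * X \<and> det X \<noteq> 0"
proof -
  interpret vec_space "TYPE(complex)" n .
  have c: "F \<in> carrier_mat n k" "F' \<in> carrier_mat n k" and N: "col_space F = N" "col_space F' = N"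
    using F F' by (auto simp: frame_def)
  have inN: "col G j \<in> col_space G" if "G \<in> carrier_mat n k" "j < k" for G j
    unfolding col_space_eq[OF that(1)]
    using that mat_mult_unit_vec[OF that, symmetric] by (auto intro!: bexI[of _ "unit_vec k j"])
  have fac: "\<exists>X\<in>carrier_mat k k. G' = G * X"
    if G: "G \<in> carrier_mat n k" "G' \<in> carrier_mat n k" "col_space G = col_space G'" for G G'
  proof (rule factor_through[OF G(1,2)])
    fix c assume "c < k"
    then have "col G' c \<in> col_space G" using inN[OF G(2)] G(3) by simp
    then obtain x where "x \<in> carrier_vec k" "G *\<^sub>v x = col G' c"
      unfolding col_space_eq[OF G(1)] using G(1) by auto
    then show "\<exists>x\<in>carrier_vec k. col G' c = G *\<^sub>v x" by metis
  qed
  obtain X where X: "X \<in> carrier_mat k k" "F' = F * X" using fac[OF c] N by blast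
  obtain Y where Y: "Y \<in> carrier_mat k k" "F = F' * Y" using fac[OF c(2,1)] N by blast
  have "F * (X * Y) = F * X * Y" using assoc_mult_mat[OF c(1) X(1) Y(1)] by simp
  also have "\<dots> = F" unfolding X(2)[symmetric] by (rule Y(2)[symmetric])
  also have "\<dots> = F * 1\<^sub>m k" using c(1) by simp
  finally have eq: "F * (X * Y) = F * 1\<^sub>m k" .
  have "X * Y = 1\<^sub>m k"
    by (rule cancel_left_of_row_det[OF c(1) d lt mult_carrier_mat[OF X(1) Y(1)] one_carrier_mat eq])
  then have "det X * det Y = 1" using det_mult[OF X(1) Y(1)] by simp
  then have "det X \<noteq> 0" by auto
  then show ?thesis using X by blast
qed

section \<open>Polynomial matrices with a cyclic band\<close>

definition ev :: "complex poly mat \<Rightarrow> complex \<Rightarrow> complex mat" where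
  "ev M z = map_mat (\<lambda>p. poly p z) M"

lemma ev_carrier [simp]: "ev M z \<in> carrier_mat n m \<longleftrightarrow> M \<in> carrier_mat n m"
  by (simp add: ev_def)

lemma ev_index [simp]: "i < dim_row M \<Longrightarrow> j < dim_col M \<Longrightarrow> ev M z $$ (i, j) = poly (M $$ (i, j)) z"
  by (simp add: ev_def)

lemma ev_dim [simp]: "dim_row (ev M z) = dim_row M" "dim_col (ev M z) = dim_col M"
  by (simp_all add: ev_def)

lemma ev_mult:
  assumes "L \<in> carrier_mat n m" "M \<in> carrier_mat m l"
  shows "ev (L * M) z = ev L z * ev M z"
  by (rule eq_matI) (use assms in \<open>auto simp: scalar_prod_def poly_sum\<close>)

lemma ev_eqI:
  assumes L: "L \<in> carrier_mat n m" and M: "M \<in> carrier_mat n m"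
    and eq: "\<And>x. x \<noteq> 0 \<Longrightarrow> ev L x = ev M x"
  shows "L = M"
proof (rule eq_matI)
  fix i j assume "i < dim_row M" "j < dim_col M"
  then have ij: "i < n" "j < m" using M by auto
  have "poly (L $$ (i, j) - M $$ (i, j)) x = 0" if "x \<noteq> 0" for x
    using arg_cong[OF eq[OF that], of "\<lambda>A. A $$ (i, j)"] L M ij by simp
  then have "UNIV - {0} \<subseteq> {x. poly (L $$ (i, j) - M $$ (i, j)) x = 0}" by auto
  moreover have "infinite (UNIV - {0} :: complex set)" by (simp add: infinite_UNIV_char_0)
  ultimately have "infinite {x. poly (L $$ (i, j) - M $$ (i, j)) x = 0}"
    using finite_subset by blast
  then show "L $$ (i, j) = M $$ (i, j)"
    using poly_roots_finite[of "L $$ (i, j) - M $$ (i, j)"] by auto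
qed (use L M in auto)

lemma flip_carrier [simp]: "flip n A \<in> carrier_mat n n"
  by (simp add: flip_def)

lemma flip_index [simp]:
  "i < n \<Longrightarrow> j < n \<Longrightarrow> flip n A $$ (i, j) = A $$ (n - 1 - j, n - 1 - i)"
  by (simp add: flip_def)

lemma flip_flip:
  assumes "A \<in> carrier_mat n n"
  shows "flip n (flip n A) = A"
  by (rule eq_matI) (use assms in \<open>auto simp: flip_def\<close>)

lemma flip_ev:
  assumes "M \<in> carrier_mat n n"
  shows "ev (flip n M) z = flip n (ev M z)"
  by (rule eq_matI) (use assms in \<open>auto simp: flip_def\<close>)

lemma flip_mult_factors:
  fixes A :: "'a::comm_ring_1 mat"
  assumes A: "A \<in> carrier_mat n k" and B: "B \<in> carrier_mat k n"
  shows "flip n (A * B) =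
    mat n k (\<lambda>(a, c). B $$ (c, n - 1 - a)) * mat k n (\<lambda>(c, b). A $$ (n - 1 - b, c))"
  by (rule eq_matI) (use assms in \<open>auto simp: flip_def scalar_prod_def mult.commute intro!: sum.cong\<close>)

lemma flip_mult:
  fixes A :: "'a::comm_ring_1 mat"
  assumes A: "A \<in> carrier_mat n n" and B: "B \<in> carrier_mat n n"
  shows "flip n (A * B) = flip n B * flip n A"
proof (rule eq_matI)
  fix i j assume "i < dim_row (flip n B * flip n A)" "j < dim_col (flip n B * flip n A)"
  then have ij: "i < n" "j < n" by (auto simp: flip_def)
  have "flip n (A * B) $$ (i, j) = (\<Sum>c\<in>{0..<n}. B $$ (c, n - 1 - i) * A $$ (n - 1 - j, c))"
    using ij A B by (auto simp: scalar_prod_def mult.commute intro!: sum.cong)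
  also have "\<dots> = (\<Sum>c\<in>{0..<n}. B $$ (n - 1 - c, n - 1 - i) * A $$ (n - 1 - j, n - 1 - c))"
    by (rule sum.reindex_bij_witness[of _ "\<lambda>c. n - 1 - c" "\<lambda>c. n - 1 - c"]) auto
  also have "\<dots> = (flip n B * flip n A) $$ (i, j)"
    using ij by (auto simp: scalar_prod_def flip_def intro!: sum.cong)
  finally show "flip n (A * B) $$ (i, j) = (flip n B * flip n A) $$ (i, j)" .
qed (auto simp: flip_def)

text \<open>The pair \<open>(i, p)\<close> stands for row \<open>i + n p\<close> of an infinite matrix that is periodic along the
diagonal. In these terms \<open>M\<close> is lower triangular with \<open>d + 1\<close> diagonals, the top one invertible
and the lowest one constantly \<open>1\<close>.\<close>

definition banded :: "nat \<Rightarrow> nat \<Rightarrow> complex poly mat \<Rightarrow> bool" where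
  "banded n d M \<longleftrightarrow> M \<in> carrier_mat n n \<and>
     (\<forall>i<n. \<forall>j<n. \<forall>p. coeff (M $$ (i, j)) p \<noteq> 0 \<longrightarrow> j \<le> i + n * p \<and> i + n * p \<le> j + d) \<and>
     (\<forall>i<n. \<forall>j<n. \<forall>p. i + n * p = j + d \<longrightarrow> coeff (M $$ (i, j)) p = 1) \<and>
     (\<forall>j<n. coeff (M $$ (j, j)) 0 \<noteq> 0)"

lemma bandedD:
  assumes "banded n d M"
  shows "M \<in> carrier_mat n n"
    and "\<And>i j p. i < n \<Longrightarrow> j < n \<Longrightarrow> coeff (M $$ (i, j)) p \<noteq> 0 \<Longrightarrow> j \<le> i + n * p \<and> i + n * p \<le> j + d"
    and "\<And>i j p. i < n \<Longrightarrow> j < n \<Longrightarrow> i + n * p = j + d \<Longrightarrow> coeff (M $$ (i, j)) p = 1"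
    and "\<And>j. j < n \<Longrightarrow> coeff (M $$ (j, j)) 0 \<noteq> 0"
  using assms unfolding banded_def by blast+

text \<open>The matrix product, one power of \<open>\<lambda>\<close> at a time: the composition of infinite periodic matrices.\<close>

lemma coeff_mat_mult:
  fixes L M :: "complex poly mat"
  assumes "L \<in> carrier_mat n n" "M \<in> carrier_mat n n" "i < n" "j < n"
  shows "coeff ((L * M) $$ (i, j)) p =
    (\<Sum>(m, q)\<in>{..<n} \<times> {..p}. coeff (L $$ (i, m)) q * coeff (M $$ (m, j)) (p - q))"
proof -
  have "(L * M) $$ (i, j) = (\<Sum>m<n. L $$ (i, m) * M $$ (m, j))"
    using assms by (auto simp: scalar_prod_def lessThan_atLeast0 intro!: sum.cong)
  then show ?thesis
    by (simp add: coeff_sum coeff_mult sum.cartesian_product[symmetric])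
qed

lemma sum_eq_single:
  fixes f :: "'b \<Rightarrow> 'a::comm_monoid_add"
  assumes "finite A" "a \<in> A" "\<And>x. x \<in> A \<Longrightarrow> f x \<noteq> 0 \<Longrightarrow> x = a"
  shows "sum f A = f a"
proof -
  have "sum f A = sum f {a}"
    by (rule sum.mono_neutral_right) (use assms in auto)
  then show ?thesis by simp
qed

text \<open>The lowest row reached by column \<open>j\<close> of \<open>L M\<close> can be reached in one way only: from the lowest
row of \<open>M\<close> along the last diagonal of \<open>L\<close>, whose entries are \<open>1\<close>.\<close>

lemma banded_mult_top_coeff:
  assumes L: "banded n d L" and M: "M \<in> carrier_mat n n" and j: "j < n"
    and le: "\<And>m p. m < n \<Longrightarrow> coeff (M $$ (m, j)) p \<noteq> 0 \<Longrightarrow> m + n * p \<le> W"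
    and m: "m < n" and W: "m + n * p = W" and i: "i < n" and I: "i + n * P = W + d"
  shows "coeff ((L * M) $$ (i, j)) P = coeff (M $$ (m, j)) p"
proof -
  have "p \<le> P"
  proof (rule ccontr)
    assume "\<not> p \<le> P"
    then have "n * (P + 1) \<le> n * p" by (intro mult_le_mono2) simp
    then show False using W I i by (simp add: algebra_simps)
  qed
  define q where "q = P - p"
  have P: "P = q + p" using \<open>p \<le> P\<close> by (simp add: q_def)
  have "coeff ((L * M) $$ (i, j)) P = coeff (L $$ (i, m)) q * coeff (M $$ (m, j)) (P - q)"
    unfolding coeff_mat_mult[OF bandedD(1)[OF L] M i j]
  proof (subst sum_eq_single[where a = "(m, q)"])
    fix x assume x: "x \<in> {..<n} \<times> {..P}"
      and nz: "(case x of (m, q) \<Rightarrow> coeff (L $$ (i, m)) q * coeff (M $$ (m, j)) (P - q)) \<noteq> 0"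
    obtain m' q' where [simp]: "x = (m', q')" by force
    have m': "m' < n" and q': "P = q' + (P - q')" using x by auto
    define r where "r = P - q'"
    have PP: "n * P = n * q' + n * r" using q' by (metis r_def distrib_left)
    have "i + n * q' \<le> m' + d" using bandedD(2)[OF L i m', of q'] nz by auto
    moreover have "m' + n * r \<le> W" using le[OF m', of r] nz by (auto simp: r_def)
    ultimately have eq: "m' + n * r = m + n * p" using I PP W by linarith
    have "(m' + n * r) mod n = (m + n * p) mod n" "(m' + n * r) div n = (m + n * p) div n"
      unfolding eq by simp_all
    then have "m' = m" "r = p" using m m' by (simp_all)
    then show "x = (m, q)" using P q' by (auto simp: r_def)
  qed (use m P in auto)
  moreover have "coeff (L $$ (i, m)) q = 1"
    by (rule bandedD(3)[OF L i m]) (use I W P in \<open>simp add: algebra_simps\<close>)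
  ultimately show ?thesis by (simp add: P)
qed

text \<open>Likewise the highest row is reached only along the main diagonal of \<open>L\<close>.\<close>

lemma banded_mult_bottom_coeff:
  assumes L: "banded n d L" and M: "M \<in> carrier_mat n n" and j: "j < n"
    and ge: "\<And>m p. m < n \<Longrightarrow> coeff (M $$ (m, j)) p \<noteq> 0 \<Longrightarrow> i + n * P \<le> m + n * p"
    and i: "i < n"
  shows "coeff ((L * M) $$ (i, j)) P = coeff (L $$ (i, i)) 0 * coeff (M $$ (i, j)) P"
proof -
  have "coeff ((L * M) $$ (i, j)) P = coeff (L $$ (i, i)) 0 * coeff (M $$ (i, j)) (P - 0)"
    unfolding coeff_mat_mult[OF bandedD(1)[OF L] M i j]
  proof (subst sum_eq_single[where a = "(i, 0)"])
    fix x assume x: "x \<in> {..<n} \<times> {..P}"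
      and nz: "(case x of (m, q) \<Rightarrow> coeff (L $$ (i, m)) q * coeff (M $$ (m, j)) (P - q)) \<noteq> 0"
    obtain m' q' where [simp]: "x = (m', q')" by force
    have m': "m' < n" and q': "P = q' + (P - q')" using x by auto
    define r where "r = P - q'"
    have PP: "n * P = n * q' + n * r" using q' by (metis r_def distrib_left)
    have "m' \<le> i + n * q'" using bandedD(2)[OF L i m', of q'] nz by auto
    moreover have "i + n * P \<le> m' + n * r" using ge[OF m', of r] nz by (auto simp: r_def)
    ultimately have eq: "m' + n * r = i + n * P" using PP by linarith
    have "(m' + n * r) mod n = (i + n * P) mod n" "(m' + n * r) div n = (i + n * P) div n"
      unfolding eq by simp_all
    then have "m' = i" "r = P" using i m' by (simp_all)
    then show "x = (i, 0)" using q' by (auto simp: r_def)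
  qed (use i in auto)
  then show ?thesis by simp
qed

lemma banded_mult:
  assumes L: "banded n d1 L" and M: "banded n d2 M"
  shows "banded n (d1 + d2) (L * M)"
proof -
  note Lc = bandedD(1)[OF L] and Mc = bandedD(1)[OF M]
  have supp: "j \<le> i + n * p \<and> i + n * p \<le> j + (d1 + d2)"
    if i: "i < n" and j: "j < n" and nz: "coeff ((L * M) $$ (i, j)) p \<noteq> 0" for i j p
  proof -
    obtain x where x: "x \<in> {..<n} \<times> {..p}"
      "(case x of (m, q) \<Rightarrow> coeff (L $$ (i, m)) q * coeff (M $$ (m, j)) (p - q)) \<noteq> 0"
      using nz unfolding coeff_mat_mult[OF Lc Mc i j] by (meson sum.not_neutral_contains_not_neutral)
    obtain m q where [simp]: "x = (m, q)" by force
    have "p = q + (p - q)" using x(1) by simp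
    then have "n * p = n * q + n * (p - q)" by (metis distrib_left)
    then show ?thesis
      using x bandedD(2)[OF L i, of m q] bandedD(2)[OF M _ j, of m "p - q"] by auto
  qed
  moreover have "coeff ((L * M) $$ (i, j)) p = 1"
    if i: "i < n" and j: "j < n" and e: "i + n * p = j + (d1 + d2)" for i j p
  proof -
    have n: "0 < n" using i by simp
    have dm: "(j + d2) mod n + n * ((j + d2) div n) = j + d2" by simp
    have "coeff ((L * M) $$ (i, j)) p = coeff (M $$ ((j + d2) mod n, j)) ((j + d2) div n)"
      by (rule banded_mult_top_coeff[OF L Mc j _ _ dm i])
        (use bandedD(2)[OF M _ j] n e in auto)
    also have "\<dots> = 1" by (rule bandedD(3)[OF M _ j dm]) (use n in auto)
    finally show ?thesis .
  qed
  moreover have "coeff ((L * M) $$ (j, j)) 0 \<noteq> 0" if j: "j < n" for j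
    by (subst banded_mult_bottom_coeff[OF L Mc j _ j])
      (use bandedD(2)[OF M _ j] bandedD(4)[OF L j] bandedD(4)[OF M j] in auto)
  ultimately show ?thesis unfolding banded_def using Lc Mc by auto
qed

text \<open>The band of the quotient is bounded from above by looking at its topmost nonzero entry and from
below by looking at its lowest one: neither can be cancelled in \<open>L M\<close>, by the two lemmas on
extreme coefficients.\<close>

lemma banded_left_cancel:
  assumes L: "banded n d1 L" and M: "M \<in> carrier_mat n n" and LM: "banded n (d1 + d2) (L * M)"
  shows "banded n d2 M"
proof -
  have low: "j \<le> m + n * p" if m: "m < n" and j: "j < n" and nz: "coeff (M $$ (m, j)) p \<noteq> 0" for m j p
    using m nz
  proof (induction "m + n * p" arbitrary: m p rule: less_induct)
    case less
    show ?case
    proof (rule ccontr)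
      assume neg: "\<not> j \<le> m + n * p"
      have "coeff ((L * M) $$ (m, j)) p = coeff (L $$ (m, m)) 0 * coeff (M $$ (m, j)) p"
      proof (rule banded_mult_bottom_coeff[OF L M j _ less.prems(1)])
        fix m' p' assume a: "m' < n" "coeff (M $$ (m', j)) p' \<noteq> 0"
        show "m + n * p \<le> m' + n * p'"
        proof (rule ccontr)
          assume b: "\<not> m + n * p \<le> m' + n * p'"
          then have "j \<le> m' + n * p'" using less.hyps[OF _ a] by simp
          then show False using neg b by simp
        qed
      qed
      then have "coeff ((L * M) $$ (m, j)) p \<noteq> 0"
        using less.prems bandedD(4)[OF L] by simp
      then show False using bandedD(2)[OF LM less.prems(1) j] neg by auto
    qed
  qed
  have high: "m + n * p \<le> j + d2"
    if m: "m < n" and j: "j < n" and nz: "coeff (M $$ (m, j)) p \<noteq> 0" for m j p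
  proof -
    \<comment> \<open>the support of column \<open>j\<close> in the infinite matrix; \<open>W\<close> is its lowest row\<close>
    define S where "S = {(m, p). m < n \<and> coeff (M $$ (m, j)) p \<noteq> 0}"
    have "S \<subseteq> {..<n} \<times> {..Max ((\<lambda>m. degree (M $$ (m, j))) ` {..<n})}"
      unfolding S_def using le_degree by (fastforce intro: order_trans[OF _ Max_ge])
    then have finS: "finite S" by (rule finite_subset) simp
    define W where "W = Max ((\<lambda>(m, p). m + n * p) ` S)"
    have le: "m + n * p \<le> W" if "m < n" "coeff (M $$ (m, j)) p \<noteq> 0" for m p
      unfolding W_def by (rule Max_ge) (use finS that in \<open>auto simp: S_def\<close>)
    have "W \<in> (\<lambda>(m, p). m + n * p) ` S"
      unfolding W_def by (rule Max_in) (use finS m nz in \<open>auto simp: S_def\<close>)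
    then obtain m0 p0 where m0: "m0 < n" "coeff (M $$ (m0, j)) p0 \<noteq> 0" "m0 + n * p0 = W"
      by (auto simp: S_def)
    have n: "(W + d1) mod n < n" using m by simp
    have dm: "(W + d1) mod n + n * ((W + d1) div n) = W + d1" by simp
    have "coeff ((L * M) $$ ((W + d1) mod n, j)) ((W + d1) div n) = coeff (M $$ (m0, j)) p0"
      by (rule banded_mult_top_coeff[OF L M j le m0(1,3) n dm])
    then have "W + d1 \<le> j + (d1 + d2)"
      using bandedD(2)[OF LM n j, of "(W + d1) div n"] m0(2) dm by auto
    then show ?thesis using le[OF m nz] by linarith
  qed
  have top: "coeff (M $$ (m, j)) p = 1" if m: "m < n" and j: "j < n" and e: "m + n * p = j + d2" for m j p
  proof -
    have n: "(j + d2 + d1) mod n < n" using m by simp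
    have dm: "(j + d2 + d1) mod n + n * ((j + d2 + d1) div n) = j + d2 + d1" by simp
    have "coeff ((L * M) $$ ((j + d2 + d1) mod n, j)) ((j + d2 + d1) div n) = coeff (M $$ (m, j)) p"
      by (rule banded_mult_top_coeff[OF L M j high m e n dm]) (use j in auto)
    then show ?thesis using bandedD(3)[OF LM n j, of "(j + d2 + d1) div n"] dm by (simp add: add_ac)
  qed
  have "coeff (M $$ (j, j)) 0 \<noteq> 0" if j: "j < n" for j
  proof -
    have "coeff ((L * M) $$ (j, j)) 0 = coeff (L $$ (j, j)) 0 * coeff (M $$ (j, j)) 0"
      by (rule banded_mult_bottom_coeff[OF L M j _ j]) (use low j in auto)
    then show ?thesis using bandedD(4)[OF LM j] by auto
  qed
  then show ?thesis unfolding banded_def using M low high top by auto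
qed

text \<open>The only power of \<open>\<lambda>\<close> that can occur in entry \<open>(i, j)\<close> of a matrix whose band is narrower than
\<open>n\<close>.\<close>

definition wrap :: "nat \<Rightarrow> nat \<Rightarrow> nat" where
  "wrap i j = (if j \<le> i then 0 else 1)"

definition loop_coeff :: "complex poly mat \<Rightarrow> nat \<Rightarrow> nat \<Rightarrow> complex" where
  "loop_coeff M i j = coeff (M $$ (i, j)) (wrap i j)"

lemma banded_entry:
  assumes M: "banded n d M" and "d < n" and i: "i < n" and j: "j < n"
  shows "M $$ (i, j) = monom (loop_coeff M i j) (wrap i j)"
proof (rule poly_eqI)
  fix p
  have "p = wrap i j" if "coeff (M $$ (i, j)) p \<noteq> 0"
  proof -
    have b: "j \<le> i + n * p" "i + n * p \<le> j + d" using bandedD(2)[OF M i j that] by auto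
    have "p < 2"
    proof (rule ccontr)
      assume "\<not> p < 2"
      then have "n * 2 \<le> n * p" by (intro mult_le_mono2) simp
      then show False using b assms by linarith
    qed
    then have "p = 0 \<or> p = 1" by auto
    then show ?thesis using b assms by (auto simp: wrap_def)
  qed
  then show "coeff (M $$ (i, j)) p = coeff (monom (loop_coeff M i j) (wrap i j)) p"
    by (auto simp: loop_coeff_def)
qed

lemma banded_ev:
  assumes M: "banded n d M" and "d < n" and i: "i < n" and j: "j < n"
  shows "ev M z $$ (i, j) = loop_coeff M i j * z ^ wrap i j"
  using banded_entry[OF assms] bandedD(1)[OF M] i j by (simp add: poly_monom)

lemma loop_coeff_band:
  assumes M: "banded n d M" and i: "i < n" and j: "j < n"
  shows "loop_coeff M i j \<noteq> 0 \<Longrightarrow> i + n * wrap i j \<le> j + d"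
    and "i + n * wrap i j = j + d \<Longrightarrow> loop_coeff M i j = 1"
    and "i = j \<Longrightarrow> loop_coeff M i j \<noteq> 0"
  using bandedD(2)[OF M i j] bandedD(3)[OF M i j] bandedD(4)[OF M j]
  by (auto simp: loop_coeff_def wrap_def)

lemma bandedI:
  assumes M: "M \<in> carrier_mat n n" and d: "d < n"
    and e: "\<And>i j. i < n \<Longrightarrow> j < n \<Longrightarrow> M $$ (i, j) = monom (c i j) (wrap i j)"
    and "\<And>i j. i < n \<Longrightarrow> j < n \<Longrightarrow> c i j \<noteq> 0 \<Longrightarrow> i + n * wrap i j \<le> j + d"
    and "\<And>i j. i < n \<Longrightarrow> j < n \<Longrightarrow> i + n * wrap i j = j + d \<Longrightarrow> c i j = 1"
    and "\<And>j. j < n \<Longrightarrow> c j j \<noteq> 0"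
  shows "banded n d M"
  unfolding banded_def
proof (intro conjI allI impI)
  fix i j p assume i: "i < n" and j: "j < n"
  {
    assume "coeff (M $$ (i, j)) p \<noteq> 0"
    then have "p = wrap i j" "c i j \<noteq> 0" using e[OF i j] by (auto split: if_splits)
    then show "j \<le> i + n * p" "i + n * p \<le> j + d"
      using assms(4)[OF i j] j by (auto simp: wrap_def)
  next
    assume a: "i + n * p = j + d"
    have "p < 2"
    proof (rule ccontr)
      assume "\<not> p < 2"
      then have "n * 2 \<le> n * p" by (intro mult_le_mono2) simp
      then show False using a d j by linarith
    qed
    then have "p = 0 \<or> p = 1" by auto
    then have "p = wrap i j" using a d i j by (auto simp: wrap_def)
    then show "coeff (M $$ (i, j)) p = 1" using assms(5)[OF i j] a e[OF i j] by simp
  }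
next
  fix j assume "j < n"
  then show "coeff (M $$ (j, j)) 0 \<noteq> 0" using e[of j j] assms(6)[of j] by (simp add: wrap_def)
qed (rule M)

lemma banded_flip:
  assumes M: "banded n d M"
  shows "banded n d (flip n M)"
  unfolding banded_def
proof (intro conjI allI impI)
  fix i j p assume i: "i < n" and j: "j < n"
  have i': "n - 1 - i < n" and j': "n - 1 - j < n" using i j by auto
  {
    assume "coeff (flip n M $$ (i, j)) p \<noteq> 0"
    then show "j \<le> i + n * p" "i + n * p \<le> j + d"
      using bandedD(2)[OF M j' i', of p] i j by auto
  next
    assume a: "i + n * p = j + d"
    have "n - 1 - j + n * p = n - 1 - i + d" using a i j by linarith
    then show "coeff (flip n M $$ (i, j)) p = 1" using bandedD(3)[OF M j' i'] i j by simp
  }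
next
  fix j assume j: "j < n"
  then have "n - 1 - j < n" by simp
  then show "coeff (flip n M $$ (j, j)) 0 \<noteq> 0" using bandedD(4)[OF M, of "n - 1 - j"] j by simp
qed simp

section \<open>Dividing by a banded matrix\<close>

lemma inverse_of_det:
  fixes A :: "'a::field mat"
  assumes A: "A \<in> carrier_mat n n" and "det A \<noteq> 0"
  obtains B where "B \<in> carrier_mat n n" "A * B = 1\<^sub>m n" "B * A = 1\<^sub>m n"
  using det_non_zero_imp_unit[OF A assms(2), where b = "()"]
  by (auto simp: Units_def ring_mat_def)

definition first_cols :: "nat \<Rightarrow> 'a mat \<Rightarrow> 'a mat" where
  "first_cols k G = mat (dim_row G) k (\<lambda>(i, j). G $$ (i, j))"

lemma first_cols_carrier [simp]: "G \<in> carrier_mat n m \<Longrightarrow> first_cols k G \<in> carrier_mat n k"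
  by (simp add: first_cols_def)

lemma first_cols_index [simp]:
  "i < dim_row G \<Longrightarrow> j < k \<Longrightarrow> first_cols k G $$ (i, j) = G $$ (i, j)"
  by (simp add: first_cols_def)

lemma first_cols_dim [simp]: "dim_row (first_cols k G) = dim_row G" "dim_col (first_cols k G) = k"
  by (simp_all add: first_cols_def)

lemma first_cols_mult:
  assumes "F \<in> carrier_mat n l" "X \<in> carrier_mat l m" "k \<le> m"
  shows "first_cols k (F * X) = F * first_cols k X"
  by (rule eq_matI) (use assms in \<open>auto simp: scalar_prod_def intro!: sum.cong\<close>)

lemma row_det_first_cols:
  "(\<And>a. a < k \<Longrightarrow> r a < dim_row G) \<Longrightarrow> row_det k (first_cols k G) r = row_det k G r"
  unfolding row_det_def by (rule arg_cong[of _ _ det], rule eq_matI) auto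

lemma row_det_id:
  assumes "X \<in> carrier_mat k m" shows "row_det k X (\<lambda>a. a) = det (first_cols k X)"
  unfolding row_det_def by (rule arg_cong[of _ _ det], rule eq_matI) (use assms in auto)

text \<open>A matrix of rank \<open>k\<close> whose first \<open>k\<close> columns are independent is the product of these columns
and a matrix that starts with the identity.\<close>

lemma column_reduced_factor:
  fixes F :: "'a::field mat"
  assumes F: "F \<in> carrier_mat n k" and X: "X \<in> carrier_mat k m" and km: "k \<le> m"
    and d: "row_det k X (\<lambda>a. a) \<noteq> 0"
  shows "\<exists>Xi\<in>carrier_mat k k. \<exists>C\<in>carrier_mat k m. F = first_cols k (F * X) * Xi \<and>
    F * X = first_cols k (F * X) * C \<and> first_cols k C = 1\<^sub>m k"
proof -
  have Xk: "first_cols k X \<in> carrier_mat k k" using X by simp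
  obtain Xi where Xi: "Xi \<in> carrier_mat k k" "first_cols k X * Xi = 1\<^sub>m k" "Xi * first_cols k X = 1\<^sub>m k"
    using inverse_of_det[OF Xk] d row_det_id[OF X] by metis
  have fc: "first_cols k (F * X) = F * first_cols k X" by (rule first_cols_mult[OF F X km])
  have 1: "F = first_cols k (F * X) * Xi"
    unfolding fc assoc_mult_mat[OF F Xk Xi(1)] Xi(2) using F by simp
  have "first_cols k (F * X) * (Xi * X) = first_cols k (F * X) * Xi * X"
    by (rule assoc_mult_mat[symmetric, of _ n k]) (use F X Xi in auto)
  then have 2: "F * X = first_cols k (F * X) * (Xi * X)" using 1 by simp
  have 3: "first_cols k (Xi * X) = 1\<^sub>m k" using first_cols_mult[OF Xi(1) X km] Xi(3) by simp
  show ?thesis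
    by (intro bexI[of _ Xi] bexI[of _ "Xi * X"] conjI 1 2 3) (use Xi X in auto)
qed

text \<open>The lowest diagonal of the band runs along the diagonal of the bottom left block.\<close>

lemma banded_bottom:
  assumes M: "banded n (n - k) M" and k: "0 < k" "k < n" and "a < k" "c < k"
  shows "c < a \<Longrightarrow> ev M z $$ (n - k + a, c) = 0" and "c = a \<Longrightarrow> ev M z $$ (n - k + a, c) = 1"
proof -
  have i: "n - k + a < n" "c < n" "n - k < n" using assms by auto
  note lc = loop_coeff_band[OF M i(1,2)]
  {
    assume ca: "c < a"
    have "loop_coeff M (n - k + a) c = 0"
      by (rule ccontr) (use lc(1) ca k in \<open>auto simp: wrap_def split: if_splits\<close>)
    then show "ev M z $$ (n - k + a, c) = 0" using banded_ev[OF M i(3,1,2)] by simp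
  next
    assume ca: "c = a"
    have w: "wrap (n - k + a) c = 0" using ca by (simp add: wrap_def)
    have "loop_coeff M (n - k + a) c = 1" by (rule lc(2)) (use ca w in simp)
    then show "ev M z $$ (n - k + a, c) = 1" using banded_ev[OF M i(3,1,2)] w by simp
  }
qed

lemma banded_bottom_minor:
  assumes M: "banded n (n - k) M" and k: "0 < k" "k < n"
  shows "row_det k (ev M z) (\<lambda>a. n - k + a) = 1"
proof -
  let ?A = "mat k k (\<lambda>(a, c). ev M z $$ (n - k + a, c))"
  have "det ?A = prod_list (diag_mat ?A)"
    by (rule det_upper_triangular[of _ k]) (use banded_bottom(1)[OF M k] in auto)
  also have "diag_mat ?A = replicate k 1"
    by (rule nth_equalityI) (use banded_bottom(2)[OF M k] in \<open>auto simp: diag_mat_def\<close>)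
  finally show ?thesis by (simp add: row_det_def)
qed

text \<open>The bottom left minor of a banded matrix is \<open>1\<close>, and it is the product of a minor of each factor.\<close>

lemma banded_factor_minors:
  assumes M: "banded n (n - k) M" and k: "0 < k" "k < n"
    and F: "F \<in> carrier_mat n k" and X: "X \<in> carrier_mat k n" and eq: "ev M z = F * X"
  shows "row_det k F (\<lambda>a. n - k + a) \<noteq> 0" and "row_det k X (\<lambda>a. a) \<noteq> 0"
proof -
  have "row_det k F (\<lambda>a. n - k + a) * row_det k X (\<lambda>a. a) = 1"
    using banded_bottom_minor[OF M k, of z] row_det_mult[OF F X, of "\<lambda>a. n - k + a"] k eq by simp
  then show "row_det k F (\<lambda>a. n - k + a) \<noteq> 0" "row_det k X (\<lambda>a. a) \<noteq> 0" by auto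
qed

text \<open>The first \<open>k\<close> columns end before their band wraps around, so \<open>\<lambda>\<close> does not enter them.\<close>

lemma banded_first_col_entry:
  assumes M: "banded n (n - k) M" and k: "0 < k" "k < n" and i: "i < n" and j: "j < k"
  shows "ev M z $$ (i, j) = (if j \<le> i then loop_coeff M i j else 0)"
proof -
  have jn: "j < n" "n - k < n" using j k by auto
  have "loop_coeff M i j = 0" if "\<not> j \<le> i"
    by (rule ccontr) (use loop_coeff_band(1)[OF M i jn(1)] that k j in \<open>auto simp: wrap_def\<close>)
  then show ?thesis using banded_ev[OF M jn(2) i jn(1)] by (auto simp: wrap_def)
qed

text \<open>At \<open>\<lambda> = 0\<close> only the lower triangular part survives.\<close>

lemma banded_det_ev0:
  assumes M: "banded n d M" and d: "d < n"
  shows "det (ev M 0) \<noteq> 0"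
proof -
  have Mc: "ev M 0 \<in> carrier_mat n n" using bandedD(1)[OF M] by simp
  note e = banded_ev[OF M d, of _ _ 0]
  have "det (ev M 0) = prod_list (diag_mat (ev M 0))"
    by (rule det_lower_triangular[OF _ Mc]) (auto simp: e wrap_def)
  moreover have "ev M 0 $$ (j, j) \<noteq> 0" if "j < n" for j
    using e[OF that that] loop_coeff_band(3)[OF M that that refl] by (simp add: wrap_def)
  ultimately show ?thesis using Mc by (auto simp: diag_mat_def prod_list_zero_iff)
qed

text \<open>At the spectral value \<open>z\<close> the columns of \<open>L\<close> beyond the first \<open>k\<close> are combinations of these,
with coefficients \<open>C\<close>; and away from \<open>z\<close> they change by \<open>\<lambda> - z\<close> times a constant matrix.
Hence \<open>L(\<lambda>) = W K(\<lambda>)\<close> with \<open>W\<close> constant and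
\<open>K(\<lambda>) = [[1, C], [0, (\<lambda> - z) 1]]\<close>. The only obstruction to dividing by \<open>L\<close> is thus
divisibility of \<open>n - k\<close> rows by \<open>\<lambda> - z\<close>, and that is what equality of the images at \<open>z\<close>
provides. The first claim records that \<open>L\<close> is invertible away from \<open>z\<close>.\<close>

lemma band_factorization:
  assumes L: "banded n (n - k) L" and k: "0 < k" "k < n"
    and F: "F \<in> carrier_mat n k" and X: "X \<in> carrier_mat k n" and Lz: "ev L z = F * X"
    and A: "A \<in> carrier_mat n n" and Y: "Y \<in> carrier_mat k n" and Az: "ev A z = F * Y"
  shows "\<exists>W\<in>carrier_mat n n. \<exists>K. (\<forall>x. ev L x = W * K x) \<and> det W \<noteq> 0 \<and>
      (\<forall>x. K x \<in> carrier_mat n n \<and> (x \<noteq> z \<longrightarrow> det (K x) \<noteq> 0))"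
    and "\<exists>B\<in>carrier_mat n n. A = L * B"
proof -
  have nk: "n - k < n" and kn: "k \<le> n" using k by auto
  obtain Xi C where Xi: "Xi \<in> carrier_mat k k" and C: "C \<in> carrier_mat k n"
    and FV: "F = first_cols k (F * X) * Xi" and VC: "F * X = first_cols k (F * X) * C"
    and C1: "first_cols k C = 1\<^sub>m k"
    using column_reduced_factor[OF F X kn banded_factor_minors(2)[OF L k F X Lz]] by blast
  \<comment> \<open>\<open>W\<close> collects the first \<open>k\<close> columns of \<open>L\<close>, which are constant, and the coefficients of \<open>\<lambda>\<close> in the others.\<close>
  define W where "W = mat n n (\<lambda>(i, j).
    if j < k then ev L z $$ (i, j) else if j \<le> i then 0 else loop_coeff L i j)"
  define K where "K x = mat n n (\<lambda>(c, j).
    if j < k then (if c = j then 1 else 0) else if c < k then C $$ (c, j)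
    else if c = j then x - z else 0)" for x
  have Wc: "W \<in> carrier_mat n n" and Kc: "K x \<in> carrier_mat n n" for x
    by (simp_all add: W_def K_def)
  have Vc: "first_cols k (F * X) \<in> carrier_mat n k"
    by (rule first_cols_carrier[OF mult_carrier_mat[OF F X]])
  have LWK: "ev L x = W * K x" for x
  proof (rule eq_matI)
    fix i j assume "i < dim_row (W * K x)" "j < dim_col (W * K x)"
    then have i: "i < n" and j: "j < n" by (auto simp: W_def K_def)
    have sum: "(W * K x) $$ (i, j) = (\<Sum>c\<in>{0..<n}. W $$ (i, c) * K x $$ (c, j))"
      using i j Wc Kc[of x] by (simp add: scalar_prod_def)
    show "ev L x $$ (i, j) = (W * K x) $$ (i, j)"
    proof (cases "j < k")
      case True
      have "(W * K x) $$ (i, j) = W $$ (i, j) * K x $$ (j, j)"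
        unfolding sum by (rule sum_eq_single) (use True j in \<open>auto simp: K_def split: if_splits\<close>)
      also have "\<dots> = ev L z $$ (i, j)" using True i j by (simp add: K_def W_def)
      finally show ?thesis unfolding banded_first_col_entry[OF L k i True] by simp
    next
      case False
      have split: "{0..<n} = {0..<k} \<union> {k..<n}" using k by auto
      have "(W * K x) $$ (i, j) = (\<Sum>c\<in>{0..<k}. W $$ (i, c) * K x $$ (c, j)) +
          (\<Sum>c\<in>{k..<n}. W $$ (i, c) * K x $$ (c, j))"
        unfolding sum split by (rule sum.union_disjoint) auto
      also have "(\<Sum>c\<in>{0..<k}. W $$ (i, c) * K x $$ (c, j)) =
          (first_cols k (F * X) * C) $$ (i, j)"
        using False i j k C F X
        by (auto simp: scalar_prod_def W_def K_def Lz intro!: sum.cong)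
      also have "\<dots> = ev L z $$ (i, j)" using VC Lz by simp
      also have "(\<Sum>c\<in>{k..<n}. W $$ (i, c) * K x $$ (c, j)) = W $$ (i, j) * K x $$ (j, j)"
        by (rule sum_eq_single) (use False j in \<open>auto simp: K_def split: if_splits\<close>)
      also have "\<dots> = W $$ (i, j) * (x - z)" using False j by (simp add: K_def)
      finally show ?thesis
        unfolding banded_ev[OF L nk i j] using False i j
        by (auto simp: W_def wrap_def algebra_simps)
    qed
  qed (use bandedD(1)[OF L] in \<open>auto simp: W_def K_def\<close>)
  have detW: "det W \<noteq> 0"
    using banded_det_ev0[OF L nk] det_mult[OF Wc Kc[of 0]] LWK[of 0] by auto
  have detK: "det (K x) \<noteq> 0" if "x \<noteq> z" for x
  proof -
    have "det (K x) = prod_list (diag_mat (K x))"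
      by (rule det_upper_triangular[OF _ Kc]) (auto simp: K_def)
    also have "\<dots> \<noteq> 0" using that by (auto simp: diag_mat_def K_def prod_list_zero_iff)
    finally show ?thesis .
  qed
  show "\<exists>W\<in>carrier_mat n n. \<exists>K. (\<forall>x. ev L x = W * K x) \<and> det W \<noteq> 0 \<and>
      (\<forall>x. K x \<in> carrier_mat n n \<and> (x \<noteq> z \<longrightarrow> det (K x) \<noteq> 0))"
    using Wc Kc LWK detW detK by blast
  obtain Wi where Wi: "Wi \<in> carrier_mat n n" "W * Wi = 1\<^sub>m n" "Wi * W = 1\<^sub>m n"
    using inverse_of_det[OF Wc detW] by blast
  define A' where "A' = mat n n (\<lambda>(i, j). \<Sum>m\<in>{0..<n}. Polynomial.smult (Wi $$ (i, m)) (A $$ (m, j)))"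
  have A'c: "A' \<in> carrier_mat n n" by (simp add: A'_def)
  have evA': "ev A' x = Wi * ev A x" for x
    by (rule eq_matI) (use Wi A in \<open>auto simp: A'_def scalar_prod_def poly_sum\<close>)
  \<comment> \<open>The rows from \<open>k\<close> on of \<open>W\<^sup>-\<^sup>1 A\<close> vanish at \<open>z\<close>, where \<open>A\<close> and the first columns of \<open>W\<close> have the same image.\<close>
  have vanish: "poly (A' $$ (i, j)) z = 0" if i: "k \<le> i" "i < n" and j: "j < n" for i j
  proof -
    have V: "first_cols k (F * X) = first_cols k W"
      by (rule eq_matI) (use Lz F X Wc k in \<open>auto simp: W_def\<close>)
    have XiY: "Xi * Y \<in> carrier_mat k n" using Xi Y by simp
    have "ev A z = first_cols k (F * X) * Xi * Y" using FV Az by simp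
    also have "\<dots> = first_cols k W * (Xi * Y)"
      unfolding V by (rule assoc_mult_mat[of _ n k]) (use Wc Xi Y in auto)
    finally have "ev A' z = Wi * (first_cols k W * (Xi * Y))" using evA' by simp
    also have "\<dots> = Wi * first_cols k W * (Xi * Y)"
      by (rule assoc_mult_mat[symmetric, of _ n n _ k]) (use Wc Wi Xi Y in auto)
    also have "Wi * first_cols k W = first_cols k (1\<^sub>m n)"
      using first_cols_mult[OF Wi(1) Wc kn] Wi(3) by simp
    finally have "ev A' z $$ (i, j) = (first_cols k (1\<^sub>m n) * (Xi * Y)) $$ (i, j)" by simp
    also have "\<dots> = (\<Sum>c\<in>{0..<k}. first_cols k (1\<^sub>m n) $$ (i, c) * (Xi * Y) $$ (c, j))"
      using Xi Y i j by (simp add: scalar_prod_def)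
    also have "\<dots> = 0" by (rule sum.neutral) (use i k in auto)
    finally show ?thesis using A'c i j by simp
  qed
  define A'' where "A'' i j = A' $$ (i, j) div [:- z, 1:]" for i j
  have A'': "poly (A' $$ (i, j)) x = (x - z) * poly (A'' i j) x"
    if "k \<le> i" "i < n" "j < n" for i j x
  proof -
    have "[:- z, 1:] dvd A' $$ (i, j)" using vanish[OF that] by (simp add: poly_eq_0_iff_dvd)
    then have "A' $$ (i, j) = [:- z, 1:] * A'' i j" unfolding A''_def by (rule dvd_mult_div_cancel[symmetric])
    then have "poly (A' $$ (i, j)) x = poly ([:- z, 1:] * A'' i j) x" by simp
    then show ?thesis by (simp add: algebra_simps)
  qed
  define B where "B = mat n n (\<lambda>(i, j). if i < k
    then A' $$ (i, j) - (\<Sum>c\<in>{k..<n}. Polynomial.smult (C $$ (i, c)) (A'' c j)) else A'' i j)"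
  have Bc: "B \<in> carrier_mat n n" by (simp add: B_def)
  have KB: "K x * ev B x = ev A' x" for x
  proof (rule eq_matI)
    fix i j assume "i < dim_row (ev A' x)" "j < dim_col (ev A' x)"
    then have i: "i < n" and j: "j < n" using A'c by auto
    have split: "{0..<n} = {0..<k} \<union> {k..<n}" using k by auto
    have "(K x * ev B x) $$ (i, j) = (\<Sum>c\<in>{0..<n}. K x $$ (i, c) * ev B x $$ (c, j))"
      using i j Bc Kc[of x] by (simp add: scalar_prod_def)
    also have "\<dots> = (\<Sum>c\<in>{0..<k}. K x $$ (i, c) * ev B x $$ (c, j)) +
        (\<Sum>c\<in>{k..<n}. K x $$ (i, c) * ev B x $$ (c, j))"
      unfolding split by (rule sum.union_disjoint) auto
    also have "\<dots> = ev A' x $$ (i, j)"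
    proof (cases "i < k")
      case True
      have "(\<Sum>c\<in>{0..<k}. K x $$ (i, c) * ev B x $$ (c, j)) = K x $$ (i, i) * ev B x $$ (i, j)"
        by (rule sum_eq_single) (use True i k in \<open>auto simp: K_def split: if_splits\<close>)
      also have "\<dots> = poly (A' $$ (i, j)) x - (\<Sum>c\<in>{k..<n}. C $$ (i, c) * poly (A'' c j) x)"
        using True i j Bc by (simp add: K_def B_def poly_sum)
      also have "(\<Sum>c\<in>{k..<n}. C $$ (i, c) * poly (A'' c j) x) =
          (\<Sum>c\<in>{k..<n}. K x $$ (i, c) * ev B x $$ (c, j))"
        using True i j Bc by (auto simp: K_def B_def intro!: sum.cong)
      finally show ?thesis using i j A'c by simp
    next
      case False
      have "(\<Sum>c\<in>{0..<k}. K x $$ (i, c) * ev B x $$ (c, j)) = 0"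
        by (rule sum.neutral) (use False i k in \<open>auto simp: K_def\<close>)
      moreover have "(\<Sum>c\<in>{k..<n}. K x $$ (i, c) * ev B x $$ (c, j)) = K x $$ (i, i) * ev B x $$ (i, j)"
        by (rule sum_eq_single) (use False i k in \<open>auto simp: K_def split: if_splits\<close>)
      ultimately show ?thesis
        using False i j Bc A'c A''[of i j x] by (simp add: K_def B_def)
    qed
    finally show "(K x * ev B x) $$ (i, j) = ev A' x $$ (i, j)" .
  qed (use Kc[of x] Bc A'c in auto)
  have "A = L * B"
  proof (rule ev_eqI[OF A])
    show "L * B \<in> carrier_mat n n" using bandedD(1)[OF L] Bc by simp
    fix x
    have evB: "ev B x \<in> carrier_mat n n" and evA: "ev A x \<in> carrier_mat n n" using Bc A by auto
    have "ev (L * B) x = W * K x * ev B x"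
      using ev_mult[OF bandedD(1)[OF L] Bc] LWK by simp
    also have "\<dots> = W * (Wi * ev A x)"
      unfolding assoc_mult_mat[OF Wc Kc evB] KB evA' ..
    also have "\<dots> = ev A x"
      unfolding assoc_mult_mat[OF Wc Wi(1) evA, symmetric] Wi(2) using evA by simp
    finally show "ev A x = ev (L * B) x" by simp
  qed
  then show "\<exists>B\<in>carrier_mat n n. A = L * B" using Bc by blast
qed

section \<open>The matrix g as the normal form of a subspace\<close>

text \<open>The Pluecker coordinate computed from a given frame instead of an arbitrarily chosen one.\<close>

definition plk :: "nat \<Rightarrow> nat \<Rightarrow> complex mat \<Rightarrow> int set \<Rightarrow> complex" where
  "plk n k F I = (if card (reduce n I) = k then minor F (reduce n I) {1..k} else 0)"

text \<open>Rows and columns are counted from \<open>0\<close> here, so that column \<open>j\<close> carries the interval that belongs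
to column \<open>j + 1\<close> in the definition of \<open>g\<close>.\<close>

abbreviation window :: "nat \<Rightarrow> nat \<Rightarrow> int set" where
  "window k j \<equiv> {int (Suc j) - int k..int (Suc j) - 1}"

abbreviation shifted_window :: "nat \<Rightarrow> nat \<Rightarrow> nat \<Rightarrow> int set" where
  "shifted_window k i j \<equiv> {int (Suc j) - int k + 1..int (Suc j) - 1} \<union> {int (Suc i)}"

definition ratio :: "nat \<Rightarrow> nat \<Rightarrow> complex mat \<Rightarrow> nat \<Rightarrow> nat \<Rightarrow> complex" where
  "ratio n k F i j = plk n k F (shifted_window k i j)
     / plk n k F (window k j)"

text \<open>The matrix \<open>g(N|t)\<close>, computed from a frame \<open>F\<close> of \<open>N\<close>.\<close>

definition gmat :: "nat \<Rightarrow> nat \<Rightarrow> complex mat \<Rightarrow> complex \<Rightarrow> complex poly mat" where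
  "gmat n k F t = mat n n (\<lambda>(i, j). Polynomial.smult (ratio n k F i j) (g_coeff k t (Suc i) (Suc j)))"

text \<open>The domain of \<open>g\<close>, in terms of a frame.\<close>

definition consec :: "nat \<Rightarrow> nat \<Rightarrow> complex mat \<Rightarrow> bool" where
  "consec n k F \<longleftrightarrow> (\<forall>j<n. plk n k F (window k j) \<noteq> 0)"

text \<open>All index sets in question lie in \<open>{1-n..n}\<close>, where reduction modulo \<open>n\<close> means adding \<open>n\<close> to
the nonpositive elements.\<close>

lemma mem_reduce:
  assumes "I \<subseteq> {1 - int n..int n}"
  shows "m \<in> reduce n I \<longleftrightarrow> m \<in> {1..n} \<and> (int m \<in> I \<or> int m - int n \<in> I)"
proof -
  have "x mod int n = int m mod int n \<longleftrightarrow> x = int m \<or> x = int m - int n"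
    if "x \<in> I" "m \<in> {1..n}" for x
  proof
    assume "x mod int n = int m mod int n"
    then have "int n dvd int m - x" by (metis mod_eq_dvd_iff)
    then obtain q where q: "int m - x = int n * q" by auto
    have "- int n < int m - x" "int m - x < 2 * int n" using that assms by auto
    then have lt: "int n * (- 1) < int n * q" "int n * q < int n * 2" using q by linarith+
    have "0 < int n" using that(2) by auto
    from lt[unfolded mult_less_cancel_left_pos[OF this]] have "-1 < q" "q < 2" .
    then have "q = 0 \<or> q = 1" by auto
    then show "x = int m \<or> x = int m - int n" using q by auto
  next
    assume "x = int m \<or> x = int m - int n"
    then show "x mod int n = int m mod int n" by auto
  qed
  then show ?thesis unfolding reduce_def by (auto; blast)
qed

lemma reduce_cong:
  assumes "I \<subseteq> {1 - int n..int n}" "I' \<subseteq> {1 - int n..int n}"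
    and "\<And>m. m \<in> {1..n} \<Longrightarrow> int m \<in> I \<or> int m - int n \<in> I \<longleftrightarrow> int m \<in> I' \<or> int m - int n \<in> I'"
  shows "reduce n I = reduce n I'"
  using mem_reduce[OF assms(1)] mem_reduce[OF assms(2)] assms(3) by blast

lemma plk_cong: "reduce n I = reduce n I' \<Longrightarrow> plk n k F I = plk n k F I'"
  by (simp add: plk_def)

text \<open>The rows outside of the band of column \<open>j\<close>, in increasing order; cyclically they lie between the
last entry of the band and the first one.\<close>

definition inner_row :: "nat \<Rightarrow> nat \<Rightarrow> nat \<Rightarrow> nat \<Rightarrow> nat" where
  "inner_row n k j a = (if k \<le> j then j - k + 1 + a else if a < j then a else a + n - k + 1)"

text \<open>The place of row \<open>i\<close> in the sorted list of the inner rows and \<open>i\<close>. It depends on \<open>i\<close> only if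
\<open>j \<ge> k\<close>, and then only on whether \<open>i\<close> lies above or below the inner rows. This jump is the source of
the sign in the spectral value.\<close>

definition insert_pos :: "nat \<Rightarrow> nat \<Rightarrow> nat \<Rightarrow> nat" where
  "insert_pos k i j = (if j < k then j else if i < j then 0 else k - 1)"

definition insert_row :: "nat \<Rightarrow> nat \<Rightarrow> nat \<Rightarrow> nat \<Rightarrow> nat \<Rightarrow> nat \<Rightarrow> nat" where
  "insert_row n k j p i a = (if a < p then inner_row n k j a else if a = p then i else inner_row n k j (a - 1))"

text \<open>The row of the last entry of the band in column \<open>j\<close>.\<close>

definition end_row :: "nat \<Rightarrow> nat \<Rightarrow> nat \<Rightarrow> nat" where
  "end_row n k j = (if j < k then j + n - k else j - k)"

text \<open>The condition on the right says that row \<open>m\<close>, continued periodically, misses the band of column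
\<open>j\<close>.\<close>

lemma inner_row_image:
  assumes "0 < k" "k < n" "j < n"
  shows "inner_row n k j ` {..<k - 1} = {m. m < n \<and> \<not> m + n * wrap m j \<le> j + (n - k)}"
proof (intro equalityI subsetI)
  fix m assume "m \<in> inner_row n k j ` {..<k - 1}"
  then show "m \<in> {m. m < n \<and> \<not> m + n * wrap m j \<le> j + (n - k)}"
    using assms by (auto simp: inner_row_def wrap_def split: if_splits)
next
  fix m assume "m \<in> {m. m < n \<and> \<not> m + n * wrap m j \<le> j + (n - k)}"
  then have m: "m < n" "\<not> m + n * wrap m j \<le> j + (n - k)" by auto
  show "m \<in> inner_row n k j ` {..<k - 1}"
  proof (cases "k \<le> j")
    case True
    show ?thesis
      by (rule image_eqI[of _ _ "m + k - j - 1"])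
        (use True m assms in \<open>auto simp: inner_row_def wrap_def split: if_splits\<close>)
  next
    case False
    show ?thesis
      by (rule image_eqI[of _ _ "if m < j then m else m + k - n - 1"])
        (use False m assms in \<open>auto simp: inner_row_def wrap_def split: if_splits\<close>)
  qed
qed

lemma inner_row_less: "0 < k \<Longrightarrow> k < n \<Longrightarrow> j < n \<Longrightarrow> a < k - 1 \<Longrightarrow> inner_row n k j a < n"
  by (auto simp: inner_row_def)

lemma insert_row_image:
  assumes "p < k"
  shows "insert_row n k j p i ` {..<k} = insert i (inner_row n k j ` {..<k - 1})"
proof (intro equalityI subsetI)
  fix m assume "m \<in> insert_row n k j p i ` {..<k}"
  then show "m \<in> insert i (inner_row n k j ` {..<k - 1})"
    using assms by (auto simp: insert_row_def split: if_splits)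
next
  fix m assume "m \<in> insert i (inner_row n k j ` {..<k - 1})"
  then consider "m = i" | b where "b < k - 1" "m = inner_row n k j b" by auto
  then show "m \<in> insert_row n k j p i ` {..<k}"
  proof cases
    case 1
    then show ?thesis by (intro image_eqI[of _ _ p]) (use assms in \<open>auto simp: insert_row_def\<close>)
  next
    case 2
    then show ?thesis
      by (intro image_eqI[of _ _ "if b < p then b else b + 1"]) (use assms in \<open>auto simp: insert_row_def\<close>)
  qed
qed

lemma insert_row_less:
  assumes "0 < k" "k < n" "j < n" "i < n" "p < k" "a < k"
  shows "insert_row n k j p i a < n"
  using assms inner_row_less[of k n j a] inner_row_less[of k n j "a - 1"] by (auto simp: insert_row_def)

lemma insert_pos_less: "0 < k \<Longrightarrow> insert_pos k i j < k"
  by (auto simp: insert_pos_def)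

lemma insert_row_strict_mono:
  assumes k: "0 < k" "k < n" and j: "j < n" and i: "i < n"
    and out: "i + n * wrap i j \<le> j + (n - k)"
  shows "strict_mono_on {..<k} (insert_row n k j (insert_pos k i j) i)"
proof (rule strict_mono_onI)
  fix a b assume "a \<in> {..<k}" "b \<in> {..<k}" and ab: "a < b"
  then have bk: "b < k" by simp
  consider "j < k" "j \<le> i" "i \<le> j + (n - k)" | "k \<le> j" "j \<le> i" | "k \<le> j" "i + k \<le> j"
    using k out by (cases "j \<le> i"; cases "j < k") (auto simp: wrap_def)
  then show "insert_row n k j (insert_pos k i j) i a < insert_row n k j (insert_pos k i j) i b"
  proof cases
    case 1
    have p: "insert_pos k i j = j" using 1 by (simp add: insert_pos_def)
    show ?thesis unfolding p insert_row_def inner_row_def using 1 ab bk k by auto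
  next
    case 2
    have p: "insert_pos k i j = k - 1" using 2 by (simp add: insert_pos_def)
    show ?thesis unfolding p insert_row_def inner_row_def using 2 ab bk k by auto
  next
    case 3
    have p: "insert_pos k i j = 0" using 3 k by (simp add: insert_pos_def)
    show ?thesis unfolding p insert_row_def inner_row_def using 3 ab bk k by auto
  qed
qed

lemma reduce_interval_insert:
  assumes k: "0 < k" "k < n" and j: "j < n" and i: "i < n"
  shows "reduce n (shifted_window k i j)
    = Suc ` insert i (inner_row n k j ` {..<k - 1})"
proof -
  have sub: "shifted_window k i j \<subseteq> {1 - int n..int n}"
    using assms by auto
  have "m \<in> reduce n (shifted_window k i j) \<longleftrightarrow>
      m \<in> Suc ` insert i (inner_row n k j ` {..<k - 1})" for m
  proof (cases m)
    case 0
    then show ?thesis unfolding mem_reduce[OF sub] by auto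
  next
    case (Suc l)
    then have "m \<in> Suc ` insert i (inner_row n k j ` {..<k - 1}) \<longleftrightarrow>
        l = i \<or> l < n \<and> \<not> l + n * wrap l j \<le> j + (n - k)"
      using inner_row_image[OF k j] by auto
    moreover have "m \<in> reduce n (shifted_window k i j) \<longleftrightarrow>
        l < n \<and> (l = i \<or> j < l + k \<and> l < j \<or> j + n < l + k)"
      unfolding mem_reduce[OF sub] Suc using assms by force
    moreover have "l < n \<Longrightarrow> \<not> l + n * wrap l j \<le> j + (n - k) \<longleftrightarrow> j < l + k \<and> l < j \<or> j + n < l + k"
      using k j by (cases "j \<le> l") (auto simp: wrap_def)
    ultimately show ?thesis using i by blast
  qed
  then show ?thesis by blast
qed

lemma plk_insert:
  assumes k: "0 < k" "k < n" and j: "j < n" and i: "i < n" and F: "F \<in> carrier_mat n k"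
  shows "plk n k F (shifted_window k i j) =
    (if i + n * wrap i j \<le> j + (n - k) then row_det k F (insert_row n k j (insert_pos k i j) i) else 0)"
proof (cases "i + n * wrap i j \<le> j + (n - k)")
  case True
  let ?r = "insert_row n k j (insert_pos k i j) i"
  note mono = insert_row_strict_mono[OF k j i True]
  have im: "Suc ` insert i (inner_row n k j ` {..<k - 1}) = Suc ` ?r ` {..<k}"
    using insert_row_image[OF insert_pos_less[OF k(1)]] by simp
  have "card (Suc ` ?r ` {..<k}) = k"
    using strict_mono_on_imp_inj_on[OF mono] by (simp add: card_image)
  then show ?thesis
    unfolding plk_def reduce_interval_insert[OF k j i] im
    using minor_eq_row_det[OF F order_refl mono insert_row_less[OF k j i insert_pos_less[OF k(1)]]] True by simp
next
  case False
  have "insert i (inner_row n k j ` {..<k - 1}) = inner_row n k j ` {..<k - 1}"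
    using False i inner_row_image[OF k j] by auto
  moreover have "card (inner_row n k j ` {..<k - 1}) < k"
    using card_image_le[of "{..<k - 1}" "inner_row n k j"] k by simp
  ultimately show ?thesis
    unfolding plk_def reduce_interval_insert[OF k j i] using False by (simp add: card_image)
qed

lemma plk_consec:
  assumes k: "0 < k" "k < n" and j: "j < n"
  shows "plk n k F (window k j) =
    plk n k F (shifted_window k (end_row n k j) j)"
proof (intro plk_cong reduce_cong)
  show "(window k j) \<subseteq> {1 - int n..int n}"
    "shifted_window k (end_row n k j) j \<subseteq> {1 - int n..int n}"
    using assms by (auto simp: end_row_def)
  fix m assume "m \<in> {1..n}"
  then show "int m \<in> (window k j) \<or>
      int m - int n \<in> (window k j) \<longleftrightarrow>
      int m \<in> shifted_window k (end_row n k j) j \<or>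
      int m - int n \<in> shifted_window k (end_row n k j) j"
    using assms by (auto simp: end_row_def)
qed

lemma end_row_less: "0 < k \<Longrightarrow> k < n \<Longrightarrow> j < n \<Longrightarrow> end_row n k j < n"
  by (auto simp: end_row_def)

lemma end_row_top: "0 < k \<Longrightarrow> k < n \<Longrightarrow> j < n \<Longrightarrow> i < n \<Longrightarrow>
    i + n * wrap i j = j + (n - k) \<longleftrightarrow> i = end_row n k j"
  by (auto simp: end_row_def wrap_def)

lemma plk_consec_row_det:
  assumes k: "0 < k" "k < n" and j: "j < n" and F: "F \<in> carrier_mat n k"
  shows "plk n k F (window k j) =
    row_det k F (insert_row n k j (insert_pos k (end_row n k j) j) (end_row n k j))"
proof -
  have "end_row n k j + n * wrap (end_row n k j) j = j + (n - k)"
    using end_row_top[OF k j end_row_less[OF k j]] by blast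
  then show ?thesis
    unfolding plk_consec[OF k j] plk_insert[OF k j end_row_less[OF k j] F] by simp
qed

text \<open>The diagonal entries of \<open>g\<close> are quotients of consecutive Pluecker coordinates: adjoining row \<open>j\<close>
to the inner rows of column \<open>j\<close> gives the interval of the next column, cyclically.\<close>

lemma plk_diag:
  assumes k: "0 < k" "k < n" and j: "j < n"
  shows "plk n k F (shifted_window k j j) =
    plk n k F (window k (if Suc j < n then Suc j else 0))"
proof (intro plk_cong reduce_cong)
  show "shifted_window k j j \<subseteq> {1 - int n..int n}"
    "(window k (if Suc j < n then Suc j else 0))
      \<subseteq> {1 - int n..int n}"
    using assms by auto
  fix m assume "m \<in> {1..n}"
  then show "int m \<in> shifted_window k j j \<or>
      int m - int n \<in> shifted_window k j j \<longleftrightarrow>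
      int m \<in> (window k (if Suc j < n then Suc j else 0)) \<or>
      int m - int n \<in> (window k (if Suc j < n then Suc j else 0))"
    using assms by auto
qed

lemma plk_mult:
  assumes F: "F \<in> carrier_mat n k" and X: "X \<in> carrier_mat k k" and k: "0 < k" "k < n"
    and j: "j < n" and i: "i < n"
  shows "plk n k (F * X) (shifted_window k i j) =
      plk n k F (shifted_window k i j) * det X"
    and "plk n k (F * X) (window k j) =
      plk n k F (window k j) * det X"
proof -
  have FX: "F * X \<in> carrier_mat n k" using F X by simp
  have X1: "row_det k X (\<lambda>a. a) = det X"
    unfolding row_det_def by (rule arg_cong[of _ _ det]) (use X in \<open>auto intro!: eq_matI\<close>)
  have insert_row: "plk n k (F * X) (shifted_window k i j) =
      plk n k F (shifted_window k i j) * det X" if i: "i < n" for i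
    unfolding plk_insert[OF k j i FX] plk_insert[OF k j i F]
    using row_det_mult[OF F X order_refl insert_row_less[OF k j i insert_pos_less[OF k(1)]]] X1 by simp
  show "plk n k (F * X) (shifted_window k i j) =
      plk n k F (shifted_window k i j) * det X" by (rule insert_row[OF i])
  show "plk n k (F * X) (window k j) =
      plk n k F (window k j) * det X"
    unfolding plk_consec[OF k j] by (rule insert_row[OF end_row_less[OF k j]])
qed

lemma ratio_mult:
  assumes "F \<in> carrier_mat n k" "X \<in> carrier_mat k k" "0 < k" "k < n" "j < n" "i < n" "det X \<noteq> 0"
  shows "ratio n k (F * X) i j = ratio n k F i j"
  unfolding ratio_def plk_mult[OF assms(1-6)] using assms(7) by simp

lemma g_map_frame:
  assumes F: "frame n k F N" and c: "consec n k F" and k: "0 < k" "k < n"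
  shows "g_map n k (N, t) = Some (gmat n k F t)"
proof -
  define F' where "F' = (SOME A. frame n k A N)"
  have fr: "frame n k F' N" unfolding F'_def by (rule someI[of _ F]) (rule F)
  have Fc: "F \<in> carrier_mat n k" using F by (simp add: frame_def)
  have n: "0 < n" using k by simp
  have "row_det k F (insert_row n k 0 (insert_pos k (end_row n k 0) 0) (end_row n k 0)) \<noteq> 0"
    using c plk_consec_row_det[OF k n Fc] n by (auto simp: consec_def)
  from frame_change[OF F fr this insert_row_less[OF k n end_row_less[OF k n] insert_pos_less[OF k(1)]]]
  obtain X where X: "X \<in> carrier_mat k k" "F' = F * X" "det X \<noteq> 0" by auto
  have pl: "pluecker n k I N = plk n k F' I" for I
    by (simp add: pluecker_def plk_def F'_def)
  have nz: "pluecker n k {int j - int k..int j - 1} N \<noteq> 0" if "j \<in> {1..n}" for j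
  proof -
    have j: "j - 1 < n" "Suc (j - 1) = j" using that by auto
    show ?thesis using plk_mult(2)[OF Fc X(1) k j(1) n] c j X(2,3)
      unfolding pl by (auto simp: consec_def)
  qed
  have "mat n n (\<lambda>(a, b). let i = Suc a; j = Suc b in
         Polynomial.smult (pluecker n k ({int j - int k + 1..int j - 1} \<union> {int i}) N
                / pluecker n k {int j - int k..int j - 1} N)
           (g_coeff k t i j)) = gmat n k F t"
  proof (rule eq_matI)
    fix i j assume "i < dim_row (gmat n k F t)" "j < dim_col (gmat n k F t)"
    then have ij: "i < n" "j < n" by (auto simp: gmat_def)
    have "ratio n k F' i j = ratio n k F i j"
      unfolding X(2) by (rule ratio_mult[OF Fc X(1) k ij(2,1) X(3)])
    then show "mat n n (\<lambda>(a, b). let i = Suc a; j = Suc b in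
         Polynomial.smult (pluecker n k ({int j - int k + 1..int j - 1} \<union> {int i}) N
                / pluecker n k {int j - int k..int j - 1} N)
           (g_coeff k t i j)) $$ (i, j) = gmat n k F t $$ (i, j)"
      unfolding pl using ij by (simp add: gmat_def Let_def ratio_def)
  qed (auto simp: gmat_def)
  then show ?thesis using nz by (simp add: g_map_def)
qed

lemma gmat_carrier [simp]: "gmat n k F t \<in> carrier_mat n n"
  by (simp add: gmat_def)

definition g_entry :: "nat \<Rightarrow> nat \<Rightarrow> complex mat \<Rightarrow> complex \<Rightarrow> nat \<Rightarrow> nat \<Rightarrow> complex" where
  "g_entry n k F t i j = ratio n k F i j * (if k \<le> j \<and> j \<le> i then t else 1)"

lemma ratio_band:
  assumes k: "0 < k" "k < n" and j: "j < n" and i: "i < n" and F: "F \<in> carrier_mat n k"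
  shows "ratio n k F i j \<noteq> 0 \<Longrightarrow> i + n * wrap i j \<le> j + (n - k)"
  unfolding ratio_def plk_insert[OF k j i F] by (auto split: if_splits)

lemma gmat_entry:
  assumes k: "0 < k" "k < n" and j: "j < n" and i: "i < n" and F: "F \<in> carrier_mat n k"
  shows "gmat n k F t $$ (i, j) = monom (g_entry n k F t i j) (wrap i j)"
proof (cases "ratio n k F i j = 0")
  case True
  then show ?thesis using i j by (simp add: gmat_def g_entry_def)
next
  case False
  then have "j < k \<Longrightarrow> wrap i j = 0" using ratio_band[OF k j i F] k j by (cases "j \<le> i") (auto simp: wrap_def)
  then show ?thesis using i j
    by (auto simp: gmat_def g_entry_def g_coeff_def wrap_def monom_0 monom_Suc)
qed

lemma gmat_banded:
  assumes k: "0 < k" "k < n" and F: "F \<in> carrier_mat n k" and c: "consec n k F" and t: "t \<noteq> 0"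
  shows "banded n (n - k) (gmat n k F t)"
proof (rule bandedI[where c = "g_entry n k F t"])
  show "gmat n k F t $$ (i, j) = monom (g_entry n k F t i j) (wrap i j)" if "i < n" "j < n" for i j
    by (rule gmat_entry[OF k that(2,1) F])
  show "i + n * wrap i j \<le> j + (n - k)" if "i < n" "j < n" "g_entry n k F t i j \<noteq> 0" for i j
    using ratio_band[OF k that(2,1) F] that(3) by (auto simp: g_entry_def)
  show "g_entry n k F t i j = 1" if ij: "i < n" "j < n" and e: "i + n * wrap i j = j + (n - k)" for i j
  proof -
    have i: "i = end_row n k j" using end_row_top[OF k ij(2,1)] e by simp
    have "ratio n k F i j = 1"
      using c ij unfolding ratio_def i plk_consec[OF k ij(2), symmetric] by (simp add: consec_def)
    moreover have "\<not> (k \<le> j \<and> j \<le> i)" using e ij k by (auto simp: wrap_def)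
    ultimately show ?thesis by (auto simp: g_entry_def)
  qed
  show "g_entry n k F t j j \<noteq> 0" if "j < n" for j
    using c that t k unfolding g_entry_def ratio_def plk_diag[OF k that]
    by (auto simp: consec_def split: if_splits)
qed (use k in auto)

text \<open>Laplace expansion along the inserted row. The vector \<open>y\<close> does not depend on the row \<open>i\<close> nor on the
place \<open>p\<close> where it is inserted, so the minors with one varying row are, up to sign, the coordinates of
a vector in the column space of \<open>F\<close>.\<close>

lemma row_det_insert_row:
  assumes F: "F \<in> carrier_mat n k" and "0 < k"
  obtains y where "y \<in> carrier_vec k"
    and "\<And>p i. p < k \<Longrightarrow> i < n \<Longrightarrow>
      row_det k F (insert_row n' k j p i) = (- 1) ^ p * (F *\<^sub>v y) $ i"
proof
  define y where "y = vec k (\<lambda>c. (- 1) ^ c *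
    det (mat (k - 1) (k - 1) (\<lambda>(a, c'). F $$ (inner_row n' k j a, if c' < c then c' else Suc c'))))"
  show "y \<in> carrier_vec k" by (simp add: y_def)
  fix p i assume p: "p < k" and i: "i < n"
  let ?A = "mat k k (\<lambda>(a, c). F $$ (insert_row n' k j p i a, c))"
  have cof: "cofactor ?A p c = (- 1) ^ p * y $ c" if c: "c < k" for c
  proof -
    have "mat_delete ?A p c =
        mat (k - 1) (k - 1) (\<lambda>(a, c'). F $$ (inner_row n' k j a, if c' < c then c' else Suc c'))"
      by (rule eq_matI) (use p c in \<open>auto simp: mat_delete_def insert_row_def\<close>)
    then show ?thesis using c by (simp add: cofactor_def y_def power_add)
  qed
  have "row_det k F (insert_row n' k j p i) = (\<Sum>c<k. ?A $$ (p, c) * cofactor ?A p c)"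
    unfolding row_det_def by (rule laplace_expansion_row) (use p in auto)
  also have "\<dots> = (\<Sum>c<k. (- 1) ^ p * (F $$ (i, c) * y $ c))"
    by (rule sum.cong) (use p cof in \<open>auto simp: insert_row_def\<close>)
  also have "\<dots> = (- 1) ^ p * (F *\<^sub>v y) $ i"
    using F i by (simp add: sum_distrib_left scalar_prod_def y_def lessThan_atLeast0)
  finally show "row_det k F (insert_row n' k j p i) = (- 1) ^ p * (F *\<^sub>v y) $ i" .
qed

text \<open>Column \<open>j\<close> of \<open>g\<close> consists of minors with one varying row, so \<open>row_det_insert_row\<close> places it
in the column space, up to signs. For \<open>j \<ge> k\<close> the place of the inserted row jumps from \<open>0\<close> to
\<open>k - 1\<close> when it passes the inner rows. The resulting sign \<open>(-1)\<^bsup>k-1\<^esup>\<close> is compensated by the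
coefficients \<open>\<lambda>\<close> above and \<open>t\<close> below exactly if \<open>\<lambda> = (-1)\<^bsup>k-1\<^esup> t\<close>.\<close>

lemma gmat_factor:
  assumes k: "0 < k" "k < n" and F: "F \<in> carrier_mat n k"
  shows "\<exists>X\<in>carrier_mat k n. ev (gmat n k F t) ((- 1) ^ (k - 1) * t) = F * X"
proof (rule factor_through[OF F])
  let ?z = "(- 1) ^ (k - 1) * t"
  show "ev (gmat n k F t) ?z \<in> carrier_mat n n" by simp
  fix j assume j: "j < n"
  obtain y where y: "y \<in> carrier_vec k" and
    ye: "\<And>p i. p < k \<Longrightarrow> i < n \<Longrightarrow> row_det k F (insert_row n k j p i) = (- 1) ^ p * (F *\<^sub>v y) $ i"
    using row_det_insert_row[OF F k(1)] by metis
  define P where "P = plk n k F (window k j)"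
  \<comment> \<open>the sign of the expansion for \<open>j < k\<close>; for \<open>j \<ge> k\<close> both positions of the inserted row give \<open>\<lambda>\<close>\<close>
  define s where "s = (if j < k then (- 1) ^ j else ?z) / P"
  have inn: "(F *\<^sub>v y) $ i = 0" if i: "i < n" and "\<not> i + n * wrap i j \<le> j + (n - k)" for i
  proof -
    have "i \<in> inner_row n k j ` {..<k - 1}" using that inner_row_image[OF k j] by auto
    then obtain b where b: "b < k - 1" "i = inner_row n k j b" by auto
    have "row_det k F (insert_row n k j 0 i) = 0"
      unfolding row_det_def
      by (rule det_identical_rows[of _ k 0 "Suc b"]) (use b in \<open>auto simp: insert_row_def intro!: eq_vecI\<close>)
    then show ?thesis using ye[of 0 i] k i by simp
  qed
  have "col (ev (gmat n k F t) ?z) j = F *\<^sub>v (s \<cdot>\<^sub>v y)"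
  proof (rule eq_vecI)
    fix i assume "i < dim_vec (F *\<^sub>v (s \<cdot>\<^sub>v y))"
    then have i: "i < n" using F by simp
    have lhs: "col (ev (gmat n k F t) ?z) j $ i = g_entry n k F t i j * ?z ^ wrap i j"
      using i j gmat_entry[OF k j i F] carrier_matD[OF gmat_carrier[of n k F t]]
      by (simp add: poly_monom)
    have rhs: "(F *\<^sub>v (s \<cdot>\<^sub>v y)) $ i = s * (F *\<^sub>v y) $ i"
      using F y i by (simp add: scalar_prod_def sum_distrib_left mult_ac)
    show "col (ev (gmat n k F t) ?z) j $ i = (F *\<^sub>v (s \<cdot>\<^sub>v y)) $ i"
    proof (cases "i + n * wrap i j \<le> j + (n - k)")
      case False
      then have "g_entry n k F t i j = 0" using ratio_band[OF k j i F] by (auto simp: g_entry_def)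
      then show ?thesis unfolding lhs rhs inn[OF i False] by simp
    next
      case True
      have r: "ratio n k F i j = (- 1) ^ insert_pos k i j * (F *\<^sub>v y) $ i / P"
        unfolding ratio_def plk_insert[OF k j i F] P_def
        using True ye[OF insert_pos_less[OF k(1)] i] by simp
      show ?thesis
      proof (cases "j < k")
        case jk: True
        then have "wrap i j = 0" using True k j by (cases "j \<le> i") (auto simp: wrap_def)
        then show ?thesis unfolding lhs rhs using r jk by (simp add: g_entry_def insert_pos_def s_def)
      next
        case False
        then show ?thesis unfolding lhs rhs using r
          by (auto simp: g_entry_def insert_pos_def s_def wrap_def)
      qed
    qed
  qed (use F in \<open>auto simp: gmat_def\<close>)
  then show "\<exists>x\<in>carrier_vec k. col (ev (gmat n k F t) ?z) j = F *\<^sub>v x"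
    using y by (intro bexI[of _ "s \<cdot>\<^sub>v y"]) auto
qed

text \<open>For \<open>k\<close> cyclically consecutive indices, the square submatrix with these rows and these columns
is lower triangular in the cyclic order with nonzero diagonal, because the band leaves out
\<open>k - 1\<close> rows. As it factors through \<open>F\<close>, the corresponding minor of \<open>F\<close> is nonzero.\<close>

lemma consec_of_band_factor:
  assumes M: "banded n (n - k) M" and k: "0 < k" "k < n"
    and F: "F \<in> carrier_mat n k" and X: "X \<in> carrier_mat k n" and eq: "ev M z = F * X"
  shows "consec n k F"
  unfolding consec_def
proof (intro allI impI)
  fix j assume j: "j < n"
  have nk: "n - k < n" using k by simp
  \<comment> \<open>the same rows in cyclic order, starting at the end of the band\<close>
  define r where "r a = (if end_row n k j + a < n then end_row n k j + a else end_row n k j + a - n)" for a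
  have rn: "r a < n" if "a < k" for a using that end_row_less[OF k j] k by (auto simp: r_def)
  have inj: "inj_on r {..<k}" using k by (auto simp: inj_on_def r_def split: if_splits)
  let ?T = "mat k k (\<lambda>(a, c). ev M z $$ (r a, r c))"
  have "det ?T = prod_list (diag_mat ?T)"
  proof (rule det_lower_triangular[of k])
    fix a c assume ac: "a < c" "c < k"
    then have n: "r a < n" "r c < n" using rn by auto
    have "loop_coeff M (r a) (r c) = 0"
      by (rule ccontr)
        (use loop_coeff_band(1)[OF M n] ac k in \<open>auto simp: r_def wrap_def split: if_splits\<close>)
    then show "?T $$ (a, c) = 0" using ac banded_ev[OF M nk n] by simp
  qed simp
  moreover have "ev M z $$ (r a, r a) \<noteq> 0" if "a < k" for a
    using banded_ev[OF M nk rn[OF that] rn[OF that]] loop_coeff_band(3)[OF M rn[OF that] rn[OF that]]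
    by (simp add: wrap_def)
  ultimately have "det ?T \<noteq> 0"
    by (auto simp: diag_mat_def prod_list_zero_iff)
  moreover have "?T = mat k k (\<lambda>(a, c). F $$ (r a, c)) * mat k k (\<lambda>(a, c). X $$ (a, r c))"
    unfolding eq by (rule eq_matI) (use F X rn in \<open>auto simp: scalar_prod_def\<close>)
  ultimately have "row_det k F r \<noteq> 0"
    unfolding row_det_def using det_mult[of _ k] by (metis mat_carrier mult_zero_left)
  moreover have out: "end_row n k j + n * wrap (end_row n k j) j \<le> j + (n - k)"
    using end_row_top[OF k j end_row_less[OF k j]] by simp
  moreover have "r ` {..<k} = insert_row n k j (insert_pos k (end_row n k j) j) (end_row n k j) ` {..<k}"
    unfolding insert_row_image[OF insert_pos_less[OF k(1)]] inner_row_image[OF k j]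
  proof (intro equalityI subsetI)
    fix m assume "m \<in> r ` {..<k}"
    then show "m \<in> insert (end_row n k j) {m. m < n \<and> \<not> m + n * wrap m j \<le> j + (n - k)}"
      using k j by (auto simp: r_def end_row_def wrap_def split: if_splits)
  next
    fix m assume m: "m \<in> insert (end_row n k j) {m. m < n \<and> \<not> m + n * wrap m j \<le> j + (n - k)}"
    show "m \<in> r ` {..<k}"
      by (rule image_eqI[of _ _ "if end_row n k j \<le> m then m - end_row n k j else m + n - end_row n k j"])
        (use m k j in \<open>auto simp: r_def end_row_def wrap_def split: if_splits\<close>)
  qed
  ultimately show "plk n k F (window k j) \<noteq> 0"
    unfolding plk_consec_row_det[OF k j F]
    using row_det_reorder[OF inj strict_mono_on_imp_inj_on[OF insert_row_strict_mono[OF k j end_row_less[OF k j] out]]]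
    by blast
qed

text \<open>Both matrices have columns in the \<open>k\<close>-dimensional space spanned by \<open>F\<close>. Their \<open>j\<close>-th columns
vanish in the \<open>k - 1\<close> inner rows and agree at the end of the band, where both are \<open>1\<close> up to a
power of \<open>\<lambda>\<close>; these \<open>k\<close> coordinates are consecutive and determine a vector of the space. So
the matrices agree at the spectral value, and a banded matrix can be recovered from its value at
any nonzero \<open>\<lambda>\<close>.\<close>

lemma band_eq_gmat:
  assumes M: "banded n (n - k) M" and k: "0 < k" "k < n"
    and F: "F \<in> carrier_mat n k" and X: "X \<in> carrier_mat k n"
    and eq: "ev M ((- 1) ^ (k - 1) * t) = F * X" and t: "t \<noteq> 0"
  shows "M = gmat n k F t"
proof -
  let ?z = "(- 1) ^ (k - 1) * t"
  have nk: "n - k < n" using k by simp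
  note c = consec_of_band_factor[OF M k F X eq]
  note G = gmat_banded[OF k F c t]
  obtain X' where X': "X' \<in> carrier_mat k n" and eq': "ev (gmat n k F t) ?z = F * X'"
    using gmat_factor[OF k F] by blast
  have same: "loop_coeff M i j = loop_coeff (gmat n k F t) i j" if i: "i < n" and j: "j < n" for i j
  proof -
    have col: "(F *\<^sub>v col Y j) $ m = ev L ?z $$ (m, j)"
      if "Y \<in> carrier_mat k n" "ev L ?z = F * Y" "m < n" for m Y L
      using that F j by (simp add: scalar_prod_def)
    let ?r = "insert_row n k j (insert_pos k (end_row n k j) j) (end_row n k j)"
    have "col X j - col X' j = 0\<^sub>v k"
    proof (rule injective_of_row_det[OF F])
      show "row_det k F ?r \<noteq> 0" 
        using c j unfolding consec_def plk_consec_row_det[OF k j F, symmetric] by blast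
      show rn: "?r a < n" if "a < k" for a
        by (rule insert_row_less[OF k j end_row_less[OF k j] insert_pos_less[OF k(1)] that])
      fix a assume a: "a < k"
      have "?r a \<in> insert (end_row n k j) (inner_row n k j ` {..<k - 1})"
        using insert_row_image[OF insert_pos_less[OF k(1)], where i = "end_row n k j" and j = j and n = n] a
        by blast
      then have "?r a = end_row n k j \<or> \<not> ?r a + n * wrap (?r a) j \<le> j + (n - k)"
        using inner_row_image[OF k j] by auto
      then have "loop_coeff M (?r a) j = loop_coeff (gmat n k F t) (?r a) j"
        using loop_coeff_band(1,2)[OF M rn[OF a] j] loop_coeff_band(1,2)[OF G rn[OF a] j]
          end_row_top[OF k j rn[OF a]] by metis
      then have "ev M ?z $$ (?r a, j) = ev (gmat n k F t) ?z $$ (?r a, j)"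
        unfolding banded_ev[OF M nk rn[OF a] j] banded_ev[OF G nk rn[OF a] j] by simp
      then have "(F *\<^sub>v col X j) $ ?r a = (F *\<^sub>v col X' j) $ ?r a"
        using col[OF X eq rn[OF a]] col[OF X' eq' rn[OF a]] by simp
      then show "(F *\<^sub>v (col X j - col X' j)) $ ?r a = 0"
        using F X X' rn[OF a] j by (subst mult_minus_distrib_mat_vec[of _ n k]) auto
    qed (use X X' j in auto)
    then have "(col X j - col X' j) $ b = 0" if "b < k" for b using that by simp
    then have "col X j = col X' j" using X X' j by (intro eq_vecI) auto
    then have "ev M ?z $$ (i, j) = ev (gmat n k F t) ?z $$ (i, j)"
      using col[OF X eq i] col[OF X' eq' i] by simp
    then show ?thesis
      unfolding banded_ev[OF M nk i j] banded_ev[OF G nk i j] using t by simp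
  qed
  show ?thesis
    by (rule eq_matI)
      (use banded_entry[OF M nk] banded_entry[OF G nk] same bandedD(1)[OF M] in \<open>auto simp: gmat_def\<close>)
qed

lemma col_space_mult:
  assumes F: "F \<in> carrier_mat n k" and X: "X \<in> carrier_mat k k" and d: "det X \<noteq> 0"
  shows "vec_space.col_space n (F * X) = vec_space.col_space n (F :: complex mat)"
proof -
  interpret vec_space "TYPE(complex)" n .
  have FX: "F * X \<in> carrier_mat n k" using F X by simp
  obtain Y where Y: "Y \<in> carrier_mat k k" "X * Y = 1\<^sub>m k" using inverse_of_det[OF X d] by blast
  have "\<exists>w\<in>carrier_vec k. F *\<^sub>v w = F * X *\<^sub>v v" if v: "v \<in> carrier_vec k" for v
    by (rule bexI[of _ "X *\<^sub>v v"]) (use assoc_mult_mat_vec[OF F X v] X v in auto)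
  moreover have "\<exists>w\<in>carrier_vec k. F * X *\<^sub>v w = F *\<^sub>v v" if v: "v \<in> carrier_vec k" for v
  proof (rule bexI[of _ "Y *\<^sub>v v"])
    have Yv: "Y *\<^sub>v v \<in> carrier_vec k" using Y v by simp
    have "F * X *\<^sub>v (Y *\<^sub>v v) = F *\<^sub>v (X * Y *\<^sub>v v)"
      unfolding assoc_mult_mat_vec[OF F X Yv] assoc_mult_mat_vec[OF X Y(1) v] ..
    then show "F * X *\<^sub>v (Y *\<^sub>v v) = F *\<^sub>v v" using Y(2) v by simp
    show "Y *\<^sub>v v \<in> carrier_vec k" by (rule Yv)
  qed
  ultimately show ?thesis
    unfolding col_space_eq[OF F] col_space_eq[OF FX] using F X by auto
qed

text \<open>If the matrix factors through \<open>F\<close> and its first \<open>k\<close> columns are independent, these columns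
span the same space as \<open>F\<close>.\<close>

lemma proj_factor:
  assumes A: "A \<in> carrier_mat n n" and k: "k \<le> n" and F: "F \<in> carrier_mat n k"
    and Y: "Y \<in> carrier_mat k n" and eq: "ev A ((- 1) ^ (k - 1) * t) = F * Y"
    and d: "row_det k F r \<noteq> 0" and lt: "\<And>a. a < k \<Longrightarrow> r a < n" and dY: "row_det k Y (\<lambda>a. a) \<noteq> 0" and t: "t \<noteq> 0"
  shows "proj n k t A = Some (vec_space.col_space n F, t)"
proof -
  have Yk: "first_cols k Y \<in> carrier_mat k k" using Y by simp
  have dYk: "det (first_cols k Y) \<noteq> 0" using dY row_det_id[OF Y] by simp
  have "mat n k (\<lambda>(a, b). poly (A $$ (a, b)) ((- 1) ^ (k - 1) * t)) =
      first_cols k (ev A ((- 1) ^ (k - 1) * t))"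
    by (rule eq_matI) (use A k in auto)
  also have "\<dots> = F * first_cols k Y" unfolding eq by (rule first_cols_mult[OF F Y k])
  finally have B: "mat n k (\<lambda>(a, b). poly (A $$ (a, b)) ((- 1) ^ (k - 1) * t)) = F * first_cols k Y" .
  have FY: "F * first_cols k Y \<in> carrier_mat n k" using F Yk by simp
  have id: "row_det k (first_cols k Y) (\<lambda>a. a) = row_det k Y (\<lambda>a. a)"
    by (rule row_det_first_cols) (use Y in auto)
  have "row_det k (F * first_cols k Y) r \<noteq> 0"
    using row_det_mult[OF F Yk order_refl lt] d dY id by simp
  from frame_of_row_det[OF FY this lt]
  have "vec_space.rank n (F * first_cols k Y) = k" by (simp add: frame_def)
  then show ?thesis
    unfolding proj_def Let_def B using t col_space_mult[OF F Yk dYk] by simp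
qed

section \<open>The symmetry S, the R-matrix and the crystal functions\<close>

text \<open>The intrinsic description of the matrices \<open>g(N|t)\<close>: a band and a rank condition at the spectral
value. It is stable under reflection and under the multiplications that occur below.\<close>

definition g_like :: "nat \<Rightarrow> nat \<Rightarrow> complex \<Rightarrow> complex poly mat \<Rightarrow> bool" where
  "g_like n k t M \<longleftrightarrow> banded n (n - k) M \<and>
     (\<exists>F\<in>carrier_mat n k. \<exists>X\<in>carrier_mat k n. ev M ((- 1) ^ (k - 1) * t) = F * X)"

text \<open>The relation \<open>M = g(x)\<close>, for \<open>x\<close> in the domain of \<open>g\<close>.\<close>

definition g_value :: "nat \<Rightarrow> nat \<Rightarrow> point \<Rightarrow> complex poly mat \<Rightarrow> bool" where
  "g_value n k x M \<longleftrightarrow> snd x \<noteq> 0 \<and>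
     (\<exists>F. frame n k F (fst x) \<and> consec n k F \<and> M = gmat n k F (snd x))"

lemma consec_row_det:
  assumes c: "consec n k F" and k: "0 < k" "k < n" and F: "F \<in> carrier_mat n k"
  obtains r where "row_det k F r \<noteq> 0" "\<And>a. a < k \<Longrightarrow> r a < n"
proof -
  have n: "0 < n" using k by simp
  have "row_det k F (insert_row n k 0 (insert_pos k (end_row n k 0) 0) (end_row n k 0)) \<noteq> 0"
    using c n unfolding consec_def plk_consec_row_det[OF k n F, symmetric] by blast
  then show ?thesis using insert_row_less[OF k n end_row_less[OF k n] insert_pos_less[OF k(1)]] that by blast
qed

lemma g_value_of_g_like:
  assumes M: "g_like n k t M" and k: "0 < k" "k < n" and t: "t \<noteq> 0"
  shows "\<exists>N. proj n k t M = Some (N, t) \<and> g_value n k (N, t) M"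
proof -
  from M obtain F X where L: "banded n (n - k) M" and F: "F \<in> carrier_mat n k"
    and X: "X \<in> carrier_mat k n" and eq: "ev M ((- 1) ^ (k - 1) * t) = F * X"
    unfolding g_like_def by blast
  have c: "consec n k F" by (rule consec_of_band_factor[OF L k F X eq])
  have G: "M = gmat n k F t" by (rule band_eq_gmat[OF L k F X eq t])
  obtain r where r: "row_det k F r \<noteq> 0" "\<And>a. a < k \<Longrightarrow> r a < n" using consec_row_det[OF c k F] by metis
  have kn: "k \<le> n" using k by simp
  have "proj n k t M = Some (vec_space.col_space n F, t)"
    by (rule proj_factor[OF bandedD(1)[OF L] kn F X eq r banded_factor_minors(2)[OF L k F X eq] t])
  moreover have "g_value n k (vec_space.col_space n F, t) M"
    using frame_of_row_det[OF F r] c G t by (auto simp: g_value_def)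
  ultimately show ?thesis by blast
qed

lemma g_valueE:
  assumes "g_value n k x M"
  obtains N t F where "x = (N, t)" "t \<noteq> 0" "frame n k F N" "F \<in> carrier_mat n k" "consec n k F"
    "M = gmat n k F t"
  using assms unfolding g_value_def by (cases x) (auto simp: frame_def)

lemma g_value_g_map:
  assumes "g_value n k x M" and k: "0 < k" "k < n"
  shows "g_map n k x = Some M"
  using assms(1) by (rule g_valueE) (simp add: g_map_frame k)

lemma g_value_g_like:
  assumes "g_value n k x M" and k: "0 < k" "k < n"
  shows "g_like n k (snd x) M"
  using assms(1)
proof (rule g_valueE)
  fix N t F assume "x = (N, t)" "t \<noteq> 0" "frame n k F N" "F \<in> carrier_mat n k" "consec n k F"
    "M = gmat n k F t"
  then show ?thesis using gmat_banded[OF k, of F t] gmat_factor[OF k, of F t] by (auto simp: g_like_def)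
qed

lemma g_value_proj:
  assumes "g_value n k x M" and k: "0 < k" "k < n"
  shows "proj n k (snd x) M = Some x"
  using assms(1)
proof (rule g_valueE)
  fix N t F assume x: "x = (N, t)" and t: "t \<noteq> 0" and fr: "frame n k F N"
    and F: "F \<in> carrier_mat n k" and c: "consec n k F" and M: "M = gmat n k F t"
  obtain X where X: "X \<in> carrier_mat k n" and eq: "ev M ((- 1) ^ (k - 1) * t) = F * X"
    using gmat_factor[OF k F] M by blast
  have L: "banded n (n - k) M" unfolding M by (rule gmat_banded[OF k F c t])
  obtain r where r: "row_det k F r \<noteq> 0" "\<And>a. a < k \<Longrightarrow> r a < n" using consec_row_det[OF c k F] by metis
  have kn: "k \<le> n" using k by simp
  have "proj n k t M = Some (vec_space.col_space n F, t)"
    by (rule proj_factor[OF bandedD(1)[OF L] kn F X eq r banded_factor_minors(2)[OF L k F X eq] t])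
  then show ?thesis using x fr by (simp add: frame_def)
qed

lemma g_like_flip:
  assumes M: "g_like n k t M"
  shows "g_like n k t (flip n M)"
proof -
  from M obtain F X where L: "banded n (n - k) M" and F: "F \<in> carrier_mat n k"
    and X: "X \<in> carrier_mat k n" and eq: "ev M ((- 1) ^ (k - 1) * t) = F * X"
    unfolding g_like_def by blast
  have "ev (flip n M) ((- 1) ^ (k - 1) * t) = mat n k (\<lambda>(a, c). X $$ (c, n - 1 - a)) *
      mat k n (\<lambda>(c, b). F $$ (n - 1 - b, c))"
    unfolding flip_ev[OF bandedD(1)[OF L]] eq by (rule flip_mult_factors[OF F X])
  then show ?thesis unfolding g_like_def using banded_flip[OF L]
    by (intro conjI bexI[of _ "mat n k (\<lambda>(a, c). X $$ (c, n - 1 - a))"]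
        bexI[of _ "mat k n (\<lambda>(c, b). F $$ (n - 1 - b, c))"]) auto
qed

text \<open>The reflection of \<open>g(x)\<close> is again of the form \<open>g(y)\<close>, and \<open>S\<close> reads off this \<open>y\<close>.\<close>

lemma S_map_g_value:
  assumes x: "g_value n k x M" and k: "0 < k" "k < n"
  shows "\<exists>y. S_map n k x = Some y \<and> g_value n k y (flip n M) \<and> snd y = snd x"
proof -
  have t: "snd x \<noteq> 0" using x by (simp add: g_value_def)
  obtain N where N: "proj n k (snd x) (flip n M) = Some (N, snd x)" "g_value n k (N, snd x) (flip n M)"
    using g_value_of_g_like[OF g_like_flip[OF g_value_g_like[OF x k]] k t] by blast
  have "S_map n k x = Some (N, snd x)"
    using g_value_g_map[OF x k] N(1) by (simp add: S_map_def)
  then show ?thesis using N(2) by auto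
qed

lemma det_rev_rows:
  fixes f :: "nat \<Rightarrow> nat \<Rightarrow> 'a::idom"
  assumes "det (mat k k (\<lambda>(a, c). f a c)) \<noteq> 0"
  shows "det (mat k k (\<lambda>(a, c). f (k - 1 - a) c)) \<noteq> 0"
proof -
  let ?F = "mat k k (\<lambda>(a, c). f a c)"
  have "row_det k ?F (\<lambda>a. a) \<noteq> 0"
  proof -
    have "mat k k (\<lambda>(a, c). ?F $$ (a, c)) = ?F" by (rule eq_matI) auto
    then show ?thesis using assms unfolding row_det_def by simp
  qed
  moreover have "(\<lambda>a. a) ` {..<k} = (\<lambda>a. k - 1 - a) ` {..<k}"
  proof (intro equalityI subsetI)
    fix m assume "m \<in> (\<lambda>a. a) ` {..<k}"
    then show "m \<in> (\<lambda>a. k - 1 - a) ` {..<k}" by (intro image_eqI[of _ _ "k - 1 - m"]) auto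
  qed auto
  ultimately have "row_det k ?F (\<lambda>a. k - 1 - a) \<noteq> 0"
    by (intro row_det_reorder[of "\<lambda>a. a" k "\<lambda>a. k - 1 - a" ?F]) (auto simp: inj_on_def)
  moreover have "mat k k (\<lambda>(a, c). ?F $$ (k - 1 - a, c)) = mat k k (\<lambda>(a, c). f (k - 1 - a) c)"
    by (rule eq_matI) auto
  ultimately show ?thesis unfolding row_det_def by simp
qed

text \<open>The reflection maps the bottom left block to itself, up to transposition and reversal of both rows
and columns.\<close>

lemma flip_bottom_minor:
  fixes A :: "complex mat"
  assumes A: "A \<in> carrier_mat n n" and k: "k \<le> n" and d: "row_det k A (\<lambda>a. n - k + a) \<noteq> 0"
  shows "row_det k (flip n A) (\<lambda>a. n - k + a) \<noteq> 0"
proof -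
  have 1: "det (mat k k (\<lambda>(a, c). A $$ (n - k + (k - 1 - a), c))) \<noteq> 0"
    using det_rev_rows[of k "\<lambda>a c. A $$ (n - k + a, c)"] d by (simp add: row_det_def)
  have "det (mat k k (\<lambda>(a, c). A $$ (n - k + (k - 1 - c), a))) \<noteq> 0"
  proof -
    have "mat k k (\<lambda>(a, c). A $$ (n - k + (k - 1 - c), a)) =
        transpose_mat (mat k k (\<lambda>(a, c). A $$ (n - k + (k - 1 - a), c)))"
      by (rule eq_matI) auto
    then show ?thesis using 1 det_transpose[of "mat k k (\<lambda>(a, c). A $$ (n - k + (k - 1 - a), c))" k] by simp
  qed
  then have 2: "det (mat k k (\<lambda>(a, c). A $$ (n - k + (k - 1 - c), k - 1 - a))) \<noteq> 0"
    by (rule det_rev_rows)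
  have "mat k k (\<lambda>(a, c). flip n A $$ (n - k + a, c)) =
      mat k k (\<lambda>(a, c). A $$ (n - k + (k - 1 - c), k - 1 - a))"
    by (rule eq_matI) (use k in \<open>auto simp: flip_def intro!: arg_cong[of _ _ "\<lambda>x. A $$ x"]\<close>)
  then show ?thesis using 2 by (simp add: row_det_def)
qed

text \<open>The point \<open>u'\<close> is computed as \<open>S(\<Psi>(S v, S u))\<close>. Since \<open>g\<close> intertwines \<open>S\<close> with the
reflection, \<open>\<Psi>(S v, S u)\<close> is read off from the reflection of \<open>A B = A' B'\<close>, which is the reflection
of \<open>B'\<close> times that of \<open>A'\<close>; at the spectral value of \<open>u\<close> its image is that of the reflection of
\<open>B'\<close>. The last two hypotheses make the two projections in the definition of \<open>R\<close>
defined and put \<open>v'\<close> into the domain of \<open>g\<close>.\<close>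

lemma R_map_factorization:
  assumes u: "g_value n k1 u A" and v: "g_value n k2 v B"
    and k1: "0 < k1" "k1 < n" and k2: "0 < k2" "k2 < n"
    and F2: "frame n k2 F2 (fst v)" "B = gmat n k2 F2 (snd v)"
    and z: "(- 1) ^ (k1 - 1) * snd u \<noteq> (- 1) ^ (k2 - 1) * snd v"
    and T: "consec n k2 (ev A ((- 1) ^ (k2 - 1) * snd v) * F2)"
    and bot: "row_det k1 (ev (A * B) ((- 1) ^ (k1 - 1) * snd u)) (\<lambda>a. n - k1 + a) \<noteq> 0"
  shows "\<exists>v' u' A' B'. R_map n k1 k2 (u, v) = Some (v', u') \<and> snd v' = snd v \<and> snd u' = snd u \<and>
    g_value n k2 v' A' \<and> g_value n k1 u' B' \<and> A * B = A' * B'"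
proof -
  obtain s t where st: "snd u = s" "snd v = t" by auto
  have s: "s \<noteq> 0" and t: "t \<noteq> 0" using u v st by (auto simp: g_value_def)
  let ?zs = "(- 1) ^ (k1 - 1) * s" and ?zt = "(- 1) ^ (k2 - 1) * t"
  have kn: "k1 \<le> n" "k2 \<le> n" using k1 k2 by auto
  obtain F1 X1 where A: "banded n (n - k1) A" and F1: "F1 \<in> carrier_mat n k1"
    and X1: "X1 \<in> carrier_mat k1 n" and eqA: "ev A ?zs = F1 * X1"
    using g_value_g_like[OF u k1] st unfolding g_like_def by blast
  have Bl: "banded n (n - k2) B" using g_value_g_like[OF v k2] by (simp add: g_like_def)
  have F2c: "F2 \<in> carrier_mat n k2" using F2(1) by (simp add: frame_def)
  obtain X2 where X2: "X2 \<in> carrier_mat k2 n" and eqB: "ev B ?zt = F2 * X2"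
    using gmat_factor[OF k2 F2c] F2(2) st by blast
  note Ac = bandedD(1)[OF A] and Bc = bandedD(1)[OF Bl]
  have eA: "ev A x \<in> carrier_mat n n" and eB: "ev B x \<in> carrier_mat n n" for x using Ac Bc by auto
  define T where "T = ev A ?zt * F2"
  have Tc: "T \<in> carrier_mat n k2" unfolding T_def using eA F2c by (rule mult_carrier_mat)
  have consT: "consec n k2 T" using T st by (simp add: T_def)
  have ABc: "A * B \<in> carrier_mat n n" using Ac Bc by simp
  have eqAB: "ev (A * B) ?zt = T * X2"
    unfolding ev_mult[OF Ac Bc] eqB T_def by (rule assoc_mult_mat[symmetric, OF eA F2c X2])
  obtain r where r: "row_det k2 T r \<noteq> 0" "\<And>a. a < k2 \<Longrightarrow> r a < n" using consec_row_det[OF consT k2 Tc] by metis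
  \<comment> \<open>\<open>B\<close> has the image of \<open>F2\<close> at its spectral value, so \<open>T\<close> is a frame of the image of \<open>A B\<close> there.\<close>
  define v' where "v' = (vec_space.col_space n T, t)"
  have Psi1: "Psi n k2 k1 (u, v) = Some v'"
    using proj_factor[OF ABc kn(2) Tc X2 eqAB r banded_factor_minors(2)[OF Bl k2 F2c X2 eqB] t]
      g_value_g_map[OF u k1] g_value_g_map[OF v k2] st
    by (simp add: Psi_def v'_def)
  define A' where "A' = gmat n k2 T t"
  have v': "g_value n k2 v' A'"
    using frame_of_row_det[OF Tc r] consT t by (auto simp: g_value_def v'_def A'_def)
  have A'l: "banded n (n - k2) A'" using g_value_g_like[OF v' k2] by (simp add: g_like_def)
  note A'c = bandedD(1)[OF A'l]
  obtain X' where X': "X' \<in> carrier_mat k2 n" and eqA': "ev A' ?zt = T * X'"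
    using gmat_factor[OF k2 Tc] A'_def by blast
  obtain B' where B'c: "B' \<in> carrier_mat n n" and AB: "A * B = A' * B'"
    using band_factorization(2)[OF A'l k2 Tc X' eqA' ABc X2 eqAB] by blast
  have "banded n ((n - k2) + (n - k1)) (A' * B')"
    using banded_mult[OF A Bl] AB by (simp add: add.commute)
  then have B'l: "banded n (n - k1) B'" by (rule banded_left_cancel[OF A'l B'c])
  obtain W K where W: "W \<in> carrier_mat n n" "det W \<noteq> 0" "\<And>x. ev A' x = W * K x"
    and K: "\<And>x. K x \<in> carrier_mat n n" "\<And>x. x \<noteq> ?zt \<Longrightarrow> det (K x) \<noteq> 0"
    using band_factorization(1)[OF A'l k2 Tc X' eqA' ABc X2 eqAB] by metis
  \<comment> \<open>\<open>A'\<close> loses rank only at the spectral value of \<open>v\<close>, so the loss of rank at that of \<open>u\<close> is due to \<open>B'\<close>.\<close>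
  have "det (ev A' ?zs) \<noteq> 0"
    unfolding W(3) using det_mult[OF W(1) K(1)] W(2) K(2) z st by simp
  then obtain Li where Li: "Li \<in> carrier_mat n n" "Li * ev A' ?zs = 1\<^sub>m n"
    using inverse_of_det[of "ev A' ?zs" n] A'c by (metis ev_carrier)
  have eB': "ev B' ?zs \<in> carrier_mat n n" and eA': "ev A' ?zs \<in> carrier_mat n n" using B'c A'c by auto
  define Y where "Y = X1 * ev B ?zs"
  have Yc: "Y \<in> carrier_mat k1 n" unfolding Y_def using X1 eB by (rule mult_carrier_mat)
  have eqs: "ev (A * B) ?zs = F1 * Y"
    unfolding ev_mult[OF Ac Bc] eqA Y_def by (rule assoc_mult_mat[OF F1 X1 eB])
  have "ev B' ?zs = Li * ev A' ?zs * ev B' ?zs" using Li eB' by simp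
  also have "\<dots> = Li * ev (A * B) ?zs"
    unfolding AB ev_mult[OF A'c B'c] by (rule assoc_mult_mat[OF Li(1) eA' eB'])
  also have "\<dots> = Li * F1 * Y"
    unfolding eqs by (rule assoc_mult_mat[symmetric, OF Li(1) F1 Yc])
  finally have eqB': "ev B' ?zs = Li * F1 * Y" .
  have goodB': "g_like n k1 s B'"
    unfolding g_like_def using B'l eqB' Yc mult_carrier_mat[OF Li(1) F1] by blast
  obtain N'' where u': "proj n k1 s B' = Some (N'', s)" "g_value n k1 (N'', s) B'"
    using g_value_of_g_like[OF goodB' k1 s] by blast
  obtain y where y: "S_map n k1 (N'', s) = Some y" "g_value n k1 y (flip n B')" "snd y = s"
    using S_map_g_value[OF u'(2) k1] by auto
  obtain y' where y': "S_map n k1 y = Some y'" "g_value n k1 y' (flip n (flip n B'))" "snd y' = s"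
    using S_map_g_value[OF y(2) k1] y(3) by auto
  \<comment> \<open>\<open>S\<close> is an involution\<close>
  have "y' = (N'', s)"
    using g_value_proj[OF y'(2) k1] y'(3) u'(1) flip_flip[OF B'c] by simp
  obtain Su where Su: "S_map n k1 u = Some Su" "g_value n k1 Su (flip n A)" "snd Su = s"
    using S_map_g_value[OF u k1] st by auto
  obtain Sv where Sv: "S_map n k2 v = Some Sv" "g_value n k2 Sv (flip n B)" "snd Sv = t"
    using S_map_g_value[OF v k2] st by auto
  have flAB: "flip n B * flip n A = flip n B' * flip n A'"
    using flip_mult[OF Ac Bc] flip_mult[OF A'c B'c] AB by simp
  obtain Fy where Fy: "frame n k1 Fy (fst y)" "Fy \<in> carrier_mat n k1" "consec n k1 Fy"
    and gy: "flip n B' = gmat n k1 Fy s"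
    using g_valueE[OF y(2)] y(3) by (metis fst_conv snd_conv)
  obtain Xy where Xy: "Xy \<in> carrier_mat k1 n" and eqy: "ev (flip n B') ?zs = Fy * Xy"
    using gmat_factor[OF k1 Fy(2)] gy by metis
  define Z where "Z = Xy * ev (flip n A') ?zs"
  have eflA': "ev (flip n A') ?zs \<in> carrier_mat n n" by simp
  have Zc: "Z \<in> carrier_mat k1 n" unfolding Z_def using Xy eflA' by (rule mult_carrier_mat)
  have flc: "flip n B * flip n A \<in> carrier_mat n n" by (rule mult_carrier_mat[OF flip_carrier flip_carrier])
  have eqZ: "ev (flip n B * flip n A) ?zs = Fy * Z"
    unfolding flAB ev_mult[OF flip_carrier flip_carrier] eqy Z_def by (rule assoc_mult_mat[OF Fy(2) Xy eflA'])
  have "row_det k1 (flip n (ev (A * B) ?zs)) (\<lambda>a. n - k1 + a) \<noteq> 0"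
    by (rule flip_bottom_minor) (use bot st ABc kn in auto)
  also have "flip n (ev (A * B) ?zs) = Fy * Z"
    unfolding flip_ev[OF ABc, symmetric] flip_mult[OF Ac Bc] by (rule eqZ)
  finally have nz: "row_det k1 Fy (\<lambda>a. n - k1 + a) \<noteq> 0" "row_det k1 Z (\<lambda>a. a) \<noteq> 0"
    using row_det_mult[OF Fy(2) Zc kn(1), of "\<lambda>a. n - k1 + a"] k1 by auto
  have "proj n k1 s (flip n B * flip n A) = Some (vec_space.col_space n Fy, s)"
    by (rule proj_factor[OF flc kn(1) Fy(2) Zc eqZ nz(1) _ nz(2) s]) (use k1 in auto)
  also have "(vec_space.col_space n Fy, s) = y" using Fy(1) y(3) by (cases y) (auto simp: frame_def)
  finally have Psi2: "Psi n k1 k2 (Sv, Su) = Some y"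
    using g_value_g_map[OF Su(2) k1] g_value_g_map[OF Sv(2) k2] Su(3) by (simp add: Psi_def)
  have "R_map n k1 k2 (u, v) = Some (v', (N'', s))"
    unfolding R_map_def S_map2_def using Psi1 Psi2 Su(1) Sv(1) y'(1) \<open>y' = (N'', s)\<close> by simp
  then show ?thesis using v' u'(2) AB st by (intro exI conjI) (auto simp: v'_def)
qed

text \<open>The cyclic predecessor: in indices counted from \<open>0\<close>, the operator \<open>e\<^sub>i\<close> acts in rows \<open>prev n i\<close>
and \<open>i\<close>.\<close>

definition prev :: "nat \<Rightarrow> nat \<Rightarrow> nat" where
  "prev n i = (if i = 0 then n - 1 else i - 1)"

lemma loop_coeff_gmat:
  assumes "0 < k" "k < n" "j < n" "i < n" "F \<in> carrier_mat n k"
  shows "loop_coeff (gmat n k F t) i j = g_entry n k F t i j"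
  unfolding loop_coeff_def gmat_entry[OF assms] by simp

text \<open>The intervals in the definitions of \<open>\<phi>\<^sub>i\<close> and \<open>\<epsilon>\<^sub>i\<close> are those of the entries of \<open>g\<close> in the
columns \<open>prev n i\<close> and \<open>i\<close>; for \<open>i = 0\<close> they have to be translated by \<open>n\<close>.\<close>

lemma crystal_index_sets:
  assumes k: "0 < k" "k < n" and i: "i < n"
  shows "reduce n ({int i - int k + 1..int i - 1} \<union> {int i + 1}) =
      reduce n (shifted_window k i (prev n i))"
    and "reduce n {int i - int k + 1..int i} =
      reduce n (shifted_window k (prev n i) (prev n i))"
    and "reduce n {int i - int k + 1..int i} = reduce n (window k i)"
    and "reduce n {int i - int k..int i - 1} =
      reduce n (window k (prev n i))"
    and "reduce n {int i - int k + 2..int i + 1} =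
      reduce n (shifted_window k i i)"
proof -
  have eqs: "{int i - int k + 1..int i} = (window k i)"
    "{int i - int k + 2..int i + 1} = shifted_window k i i"
    using k by auto
  show "reduce n {int i - int k + 1..int i} = reduce n (window k i)"
    "reduce n {int i - int k + 2..int i + 1} =
      reduce n (shifted_window k i i)"
    unfolding eqs by (rule refl)+
  have "reduce n ({int i - int k + 1..int i - 1} \<union> {int i + 1}) =
      reduce n (shifted_window k i (prev n i)) \<and>
    reduce n {int i - int k + 1..int i} =
      reduce n (shifted_window k (prev n i) (prev n i)) \<and>
    reduce n {int i - int k..int i - 1} =
      reduce n (window k (prev n i))"
  proof (cases "i = 0")
    case True
    then show ?thesis using k by (intro conjI reduce_cong) (auto simp: prev_def)
  next
    case False
    then have "int (Suc (prev n i)) = int i" by (simp add: prev_def)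
    moreover have "{int i - int k + 1..int i} = {int i - int k + 1..int i - 1} \<union> {int i}" using k by auto
    ultimately show ?thesis by (simp add: add.commute)
  qed
  then show "reduce n ({int i - int k + 1..int i - 1} \<union> {int i + 1}) =
      reduce n (shifted_window k i (prev n i))"
    "reduce n {int i - int k + 1..int i} =
      reduce n (shifted_window k (prev n i) (prev n i))"
    "reduce n {int i - int k..int i - 1} =
      reduce n (window k (prev n i))" by blast+
qed

text \<open>The crystal functions are ratios of neighbouring coefficients of \<open>g\<close>. The powers of \<open>t\<close> in their
definitions are those by which the coefficients of \<open>g\<close> differ from the ratios of Pluecker
coordinates.\<close>

lemma phi_eps_g_value:
  assumes x: "g_value n k x M" and k: "0 < k" "k < n" and i: "i < n"
  shows "phi_map n k i x = Some (loop_coeff M i (prev n i) / loop_coeff M (prev n i) (prev n i))"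
    and "eps_map n k i x = Some (loop_coeff M i (prev n i) / loop_coeff M i i)"
proof -
  obtain N t F where xN: "x = (N, t)" and t: "t \<noteq> 0" and F: "frame n k F N"
    and Fc: "F \<in> carrier_mat n k" and c: "consec n k F" and M: "M = gmat n k F t"
    using x by (rule g_valueE)
  have p: "prev n i < n" using i by (auto simp: prev_def)
  define F' where "F' = (SOME A. frame n k A N)"
  have fr: "frame n k F' N" unfolding F'_def by (rule someI[of _ F]) (rule F)
  obtain r where r: "row_det k F r \<noteq> 0" "\<And>a. a < k \<Longrightarrow> r a < n" using consec_row_det[OF c k Fc] by metis
  obtain X where X: "X \<in> carrier_mat k k" "F' = F * X" "det X \<noteq> 0"
    using frame_change[OF F fr r] by auto
  have pl: "pluecker n k I N = plk n k F' I" for I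
    by (simp add: pluecker_def plk_def F'_def)
  define C where "C j = plk n k F' (window k j)" for j
  define Q where "Q m j = plk n k F' (shifted_window k m j)" for m j
  note sets = crystal_index_sets[OF k i, THEN plk_cong]
  have C: "C j \<noteq> 0" if "j < n" for j
    using plk_mult(2)[OF Fc X(1) k that, of 0] k c that X(2,3) by (auto simp: C_def consec_def)
  have Q: "Q m j = ratio n k F m j * C j" if "j < n" "m < n" for m j
  proof -
    have "ratio n k F m j = ratio n k F' m j" using ratio_mult[OF Fc X(1) k that X(3)] X(2) by simp
    also have "\<dots> = Q m j / C j" by (simp only: ratio_def Q_def C_def)
    finally show ?thesis using C[OF that(1)] by simp
  qed
  have nz: "ratio n k F m m \<noteq> 0" if "m < n" for m
    using c that k unfolding ratio_def plk_diag[OF k that] by (auto simp: consec_def)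
  have pp: "plk n k F' {int i - int k + 1..int i} = ratio n k F (prev n i) (prev n i) * C (prev n i)"
    unfolding sets(2) using Q[OF p p] by (simp add: Q_def)
  have pi: "plk n k F' ({int i - int k + 1..int i - 1} \<union> {int i + 1}) =
      ratio n k F i (prev n i) * C (prev n i)"
    unfolding sets(1) using Q[OF p i] by (simp add: Q_def)
  have ppi: "plk n k F' {int i - int k + 1..int i} = C i" unfolding sets(3) by (simp add: C_def)
  have cp: "plk n k F' {int i - int k..int i - 1} = C (prev n i)" unfolding sets(4) by (simp add: C_def)
  have ii: "plk n k F' {int i - int k + 2..int i + 1} = ratio n k F i i * C i"
    unfolding sets(5) using Q[OF i i] by (simp add: Q_def)
  note lc = loop_coeff_gmat[OF k _ _ Fc, of _ _ t, folded M]
  have in0: "i = 0 \<Longrightarrow> n - 1 \<noteq> 0" using k by auto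
  show "phi_map n k i x = Some (loop_coeff M i (prev n i) / loop_coeff M (prev n i) (prev n i))"
    unfolding phi_map_def xN prod.case pl pp pi lc[OF p i] lc[OF p p] g_entry_def pdiv_def
    using C[OF p] nz[OF p] t k in0 by (auto simp: prev_def field_simps)
  show "eps_map n k i x = Some (loop_coeff M i (prev n i) / loop_coeff M i i)"
    unfolding eps_map_def xN prod.case pl pi ppi cp ii lc[OF p i] lc[OF i i] g_entry_def pdiv_def
    using C[OF p] C[OF i] nz[OF i] t k in0 by (auto simp: prev_def field_simps)
qed

section \<open>Crystal operators and the bottom left minor\<close>

lemma prev_less: "i < n \<Longrightarrow> prev n i < n"
  by (auto simp: prev_def)

lemma prev_neq: "1 < n \<Longrightarrow> i < n \<Longrightarrow> prev n i \<noteq> i"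
  by (auto simp: prev_def)

lemma x_mat_carrier [simp]: "x_mat n i a \<in> carrier_mat n n"
  by (simp add: x_mat_def)

lemma x_mat_index:
  assumes "i < n" "r < n" "c < n"
  shows "x_mat n i a $$ (r, c) = (if r = c then 1 else 0) + (if r = prev n i \<and> c = i then a else 0)"
  using assms by (auto simp: x_mat_def prev_def)

lemma x_mat_mult_left:
  assumes "i < n" "r < n" "c < m" "G \<in> carrier_mat n m"
  shows "(x_mat n i a * G) $$ (r, c) = G $$ (r, c) + (if r = prev n i then a * G $$ (i, c) else 0)"
proof -
  have "(x_mat n i a * G) $$ (r, c) = (\<Sum>j\<in>{0..<n}. x_mat n i a $$ (r, j) * G $$ (j, c))"
    using assms carrier_matD[OF x_mat_carrier[of n i a]] by (simp add: scalar_prod_def)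
  also have "\<dots> = (\<Sum>j\<in>{0..<n}. (if r = j then G $$ (j, c) else 0) +
      (if j = i then if r = prev n i then a * G $$ (j, c) else 0 else 0))"
    by (rule sum.cong) (use assms in \<open>auto simp: x_mat_index algebra_simps\<close>)
  also have "\<dots> = G $$ (r, c) + (if r = prev n i then a * G $$ (i, c) else 0)"
    using assms by (simp add: sum.distrib sum.delta sum.delta')
  finally show ?thesis .
qed

lemma x_mat_mult_right:
  assumes "i < n" "r < m" "c < n" "G \<in> carrier_mat m n"
  shows "(G * x_mat n i a) $$ (r, c) = G $$ (r, c) + (if c = i then a * G $$ (r, prev n i) else 0)"
proof -
  have "(G * x_mat n i a) $$ (r, c) = (\<Sum>j\<in>{0..<n}. G $$ (r, j) * x_mat n i a $$ (j, c))"
    using assms carrier_matD[OF x_mat_carrier[of n i a]] by (simp add: scalar_prod_def)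
  also have "\<dots> = (\<Sum>j\<in>{0..<n}. (if j = c then G $$ (r, j) else 0) +
      (if j = prev n i then if c = i then a * G $$ (r, j) else 0 else 0))"
    by (rule sum.cong) (use assms in \<open>auto simp: x_mat_index algebra_simps\<close>)
  also have "\<dots> = G $$ (r, c) + (if c = i then a * G $$ (r, prev n i) else 0)"
    using assms prev_less[of i n] by (simp add: sum.distrib sum.delta sum.delta')
  finally show ?thesis .
qed

lemma x_mat_inverse:
  assumes "1 < n" "i < n" "a + b = 0"
  shows "x_mat n i a * x_mat n i b = 1\<^sub>m n"
proof (rule eq_matI)
  fix r c assume "r < dim_row (1\<^sub>m n)" "c < dim_col (1\<^sub>m n)"
  then have rc: "r < n" "c < n" by auto
  have "a = - b" using assms(3) by (simp add: eq_neg_iff_add_eq_0)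
  then show "(x_mat n i a * x_mat n i b) $$ (r, c) = 1\<^sub>m n $$ (r, c)"
    unfolding x_mat_mult_left[OF assms(2) rc x_mat_carrier]
    using rc assms prev_neq[of n i] by (simp add: x_mat_index)
qed (simp_all add: x_mat_def)

text \<open>The elementary matrix of the loop group attached to \<open>i\<close>; the affine one carries \<open>\<lambda>\<^bsup>-1\<^esup>\<close>.\<close>

definition xhat :: "nat \<Rightarrow> nat \<Rightarrow> complex \<Rightarrow> complex \<Rightarrow> complex mat" where
  "xhat n i a l = x_mat n i (if i = 0 then a / l else a)"

lemma xhat_carrier [simp]: "xhat n i a l \<in> carrier_mat n n"
  by (simp add: xhat_def)

text \<open>Adding row \<open>i\<close> to row \<open>prev n i\<close> moves entries up by one diagonal of the infinite matrix.\<close>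

lemma shift_row:
  assumes "1 < n" "i < n" "c < n" "c \<noteq> i"
  shows "i + n * wrap i c = prev n i + n * wrap (prev n i) c + 1"
  using assms by (auto simp: prev_def wrap_def)

text \<open>Adding column \<open>prev n i\<close> to column \<open>i\<close> also moves entries up by one diagonal.\<close>

lemma shift_col:
  assumes "1 < n" "i < n" "r < n" "r \<noteq> prev n i"
  shows "r + n * wrap r (prev n i) + i = r + n * wrap r i + prev n i + 1"
  using assms by (cases "i = 0"; cases "i \<le> r") (auto simp: prev_def wrap_def)

text \<open>Both multiplications move entries up by one diagonal, away from the lowest diagonal of the band.
The only entry that could leave the band is the one above the diagonal entry \<open>(i, i)\<close>, and the
values of \<open>a\<close> and \<open>b\<close> make it cancel.\<close>

lemma xhat_conjugate:
  assumes M: "banded n (n - k) M" and k: "0 < k" "k < n" and i: "i < n" and c: "c \<noteq> 0"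
    and nz: "loop_coeff M i (prev n i) \<noteq> 0"
    and a: "a = (c - 1) / (loop_coeff M i (prev n i) / loop_coeff M (prev n i) (prev n i))"
    and b: "b = (1 / c - 1) / (loop_coeff M i (prev n i) / loop_coeff M i i)"
  shows "\<exists>M'. banded n (n - k) M' \<and>
    (\<forall>l. l \<noteq> 0 \<longrightarrow> ev M' l = xhat n i a l * ev M l * xhat n i b l)"
proof -
  let ?p = "prev n i"
  have n: "1 < n" using k by simp
  have nk: "n - k < n" using k by simp
  note p = prev_less[OF i] and pi = prev_neq[OF n i]
  define m where "m r j = loop_coeff M r j
    + (if r = ?p \<and> j \<noteq> i then a * loop_coeff M i j else 0)
    + (if j = i \<and> r \<noteq> ?p then b * loop_coeff M r ?p else 0)" for r j
  define M' where "M' = mat n n (\<lambda>(r, j). monom (m r j) (wrap r j))"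
  have M'c: "M' \<in> carrier_mat n n" by (simp add: M'_def)
  have apply_a: "a * loop_coeff M i ?p = (c - 1) * loop_coeff M ?p ?p"
    and apply_b: "b * loop_coeff M i ?p = (1 / c - 1) * loop_coeff M i i"
    using nz unfolding a b by simp_all
  \<comment> \<open>the entry in position \<open>(prev n i, i)\<close>, which would leave the band\<close>
  have cancel: "a * loop_coeff M i i + b * loop_coeff M ?p ?p + a * b * loop_coeff M i ?p = 0"
  proof -
    have "a * b * loop_coeff M i ?p = b * ((c - 1) * loop_coeff M ?p ?p)"
      using apply_a by (metis mult.assoc mult.commute)
    then show ?thesis using nz c unfolding a b by (simp add: field_simps)
  qed
  have banded: "banded n (n - k) M'"
  proof (rule bandedI[where c = m])
    fix r j assume r: "r < n" and j: "j < n"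
    show "M' $$ (r, j) = monom (m r j) (wrap r j)" using r j by (simp add: M'_def)
    have row: "r + n * wrap r j < j + (n - k)" if "r = ?p" "j \<noteq> i" "loop_coeff M i j \<noteq> 0"
      using loop_coeff_band(1)[OF M i j that(3)] shift_row[OF n i j that(2)] that(1) by simp
    have col: "r + n * wrap r j < j + (n - k)" if "j = i" "r \<noteq> ?p" "loop_coeff M r ?p \<noteq> 0"
      using loop_coeff_band(1)[OF M r p that(3)] shift_col[OF n i r that(2)] that(1) by simp
    {
      assume "m r j \<noteq> 0"
      then consider "loop_coeff M r j \<noteq> 0" | "r = ?p" "j \<noteq> i" "loop_coeff M i j \<noteq> 0"
        | "j = i" "r \<noteq> ?p" "loop_coeff M r ?p \<noteq> 0"
        unfolding m_def by (cases "loop_coeff M r j = 0"; cases "r = ?p"; cases "j = i") auto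
      then show "r + n * wrap r j \<le> j + (n - k)"
      proof cases
        case 1
        then show ?thesis by (rule loop_coeff_band(1)[OF M r j])
      qed (use row col in auto)
    next
      assume e: "r + n * wrap r j = j + (n - k)"
      then have "m r j = loop_coeff M r j" using row col unfolding m_def by auto
      then show "m r j = 1" using loop_coeff_band(2)[OF M r j e] by simp
    }
  next
    fix j assume j: "j < n"
    have "m j j = (if j = ?p then c else if j = i then 1 / c else 1) * loop_coeff M j j"
      using apply_a apply_b pi by (auto simp: m_def algebra_simps)
    then show "m j j \<noteq> 0" using loop_coeff_band(3)[OF M j j] c by auto
  qed (use M'c k in auto)
  moreover have "ev M' l = xhat n i a l * ev M l * xhat n i b l" if l: "l \<noteq> 0" for l
  proof (rule eq_matI)
    fix r j assume "r < dim_row (xhat n i a l * ev M l * xhat n i b l)"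
      "j < dim_col (xhat n i a l * ev M l * xhat n i b l)"
    then have r: "r < n" and j: "j < n" by (auto simp: xhat_def x_mat_def)
    have eM: "ev M l \<in> carrier_mat n n" using bandedD(1)[OF M] by simp
    define e where "e f = (if i = 0 then f / l else f)" for f :: complex
    have xe: "xhat n i f l = x_mat n i (e f)" for f by (simp add: xhat_def e_def)
    have xM: "x_mat n i (e a) * ev M l \<in> carrier_mat n n" by (rule mult_carrier_mat[OF x_mat_carrier eM])
    have lhs: "ev M' l $$ (r, j) = m r j * l ^ wrap r j"
      using r j M'c by (simp add: M'_def poly_monom)
    have rhs: "(xhat n i a l * ev M l * xhat n i b l) $$ (r, j) =
        loop_coeff M r j * l ^ wrap r j
        + (if r = ?p then e a * (loop_coeff M i j * l ^ wrap i j) else 0)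
        + (if j = i then e b * (loop_coeff M r ?p * l ^ wrap r ?p
            + (if r = ?p then e a * (loop_coeff M i ?p * l ^ wrap i ?p) else 0)) else 0)"
      unfolding xe x_mat_mult_right[OF i r j xM] x_mat_mult_left[OF i r j eM]
        x_mat_mult_left[OF i r p eM] banded_ev[OF M nk r j] banded_ev[OF M nk i j]
        banded_ev[OF M nk r p] banded_ev[OF M nk i p] by simp
    have er: "e f * l ^ wrap i j = f * l ^ wrap ?p j" if "j \<noteq> i" for f
      using that l i j n by (auto simp: e_def wrap_def prev_def)
    have ec: "e f * l ^ wrap r ?p = f * l ^ wrap r i" if "r \<noteq> ?p" for f
      using that l i r n by (auto simp: e_def wrap_def prev_def)
    show "ev M' l $$ (r, j) = (xhat n i a l * ev M l * xhat n i b l) $$ (r, j)"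
    proof (cases "r = ?p")
      case rp: True
      show ?thesis
      proof (cases "j = i")
        case True
        have "e a * (loop_coeff M i i * l ^ wrap i i) + e b * (loop_coeff M ?p ?p * l ^ wrap ?p ?p)
            + e b * (e a * (loop_coeff M i ?p * l ^ wrap i ?p)) =
            e (a * loop_coeff M i i + b * loop_coeff M ?p ?p + a * b * loop_coeff M i ?p)"
          using l i n by (auto simp: e_def wrap_def prev_def field_simps)
        also have "\<dots> = 0" unfolding cancel by (simp add: e_def)
        finally show ?thesis unfolding lhs rhs using rp True by (simp add: m_def algebra_simps)
      next
        case False
        have "e a * (loop_coeff M i j * l ^ wrap i j) = loop_coeff M i j * (e a * l ^ wrap i j)"
          by simp
        also have "\<dots> = a * loop_coeff M i j * l ^ wrap ?p j"
          unfolding er[OF False] by simp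
        finally have E: "e a * (loop_coeff M i j * l ^ wrap i j) = a * loop_coeff M i j * l ^ wrap ?p j" .
        show ?thesis unfolding lhs rhs using rp False by (simp add: m_def distrib_right E)
      qed
    next
      case rp: False
      have "e b * (loop_coeff M r ?p * l ^ wrap r ?p) = loop_coeff M r ?p * (e b * l ^ wrap r ?p)"
        by simp
      also have "\<dots> = b * loop_coeff M r ?p * l ^ wrap r i"
        unfolding ec[OF rp] by simp
      finally have E: "e b * (loop_coeff M r ?p * l ^ wrap r ?p) = b * loop_coeff M r ?p * l ^ wrap r i" .
      show ?thesis unfolding lhs rhs using rp by (simp add: m_def distrib_right E)
    qed
  qed (use M'c in \<open>auto simp: xhat_def x_mat_def\<close>)
  ultimately show ?thesis by blast
qed

lemma col_space_left_mult:
  assumes F: "F \<in> carrier_mat n k" and X: "X \<in> carrier_mat n n"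
  shows "(\<lambda>w. X *\<^sub>v w) ` vec_space.col_space n F = vec_space.col_space n (X * F :: complex mat)"
proof -
  interpret vec_space "TYPE(complex)" n .
  have XF: "X * F \<in> carrier_mat n k" using F X by simp
  show ?thesis
    unfolding col_space_eq[OF F] col_space_eq[OF XF] using F X assoc_mult_mat_vec[OF X F]
    by (auto simp: image_iff)
qed

text \<open>The matrix obtained from \<open>xhat_conjugate\<close> is banded, and its image at the spectral value \<open>z\<close> is that
of \<open>g(x)\<close> moved by the left factor. There \<open>\<lambda>\<^bsup>-1\<^esup>\<close> becomes \<open>(-1)\<^bsup>k-1\<^esup>/t\<close>, which is the
coefficient in the definition of \<open>e\<^sub>0\<close>.\<close>

lemma g_e_map:
  assumes x: "g_value n k x M" and k: "0 < k" "k < n" and i: "i < n" and c: "c \<noteq> 0"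
    and ph: "phi_map n k i x = Some ph" "ph \<noteq> 0" and ep: "eps_map n k i x = Some ep"
  shows "\<exists>x' M'. e_map n k i c x = Some x' \<and> g_value n k x' M' \<and>
    (\<forall>l. l \<noteq> 0 \<longrightarrow> ev M' l = xhat n i ((c - 1) / ph) l * ev M l * xhat n i ((1 / c - 1) / ep) l)"
proof -
  obtain N t F where xN: "x = (N, t)" and t: "t \<noteq> 0" and F: "frame n k F N"
    and Fc: "F \<in> carrier_mat n k" and cF: "consec n k F" and M: "M = gmat n k F t"
    using x by (rule g_valueE)
  let ?z = "(- 1) ^ (k - 1) * t"
  have z: "?z \<noteq> 0" using t by simp
  have L: "banded n (n - k) M" unfolding M by (rule gmat_banded[OF k Fc cF t])
  have Mc: "ev M l \<in> carrier_mat n n" for l using bandedD(1)[OF L] by simp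
  have phl: "ph = loop_coeff M i (prev n i) / loop_coeff M (prev n i) (prev n i)"
    and epl: "ep = loop_coeff M i (prev n i) / loop_coeff M i i"
    using phi_eps_g_value[OF x k i] ph ep by auto
  have nz: "loop_coeff M i (prev n i) \<noteq> 0" using ph(2) phl by auto
  obtain M' where L': "banded n (n - k) M'" and
    M': "\<And>l. l \<noteq> 0 \<Longrightarrow> ev M' l = xhat n i ((c - 1) / ph) l * ev M l * xhat n i ((1 / c - 1) / ep) l"
    using xhat_conjugate[OF L k i c nz] phl epl by metis
  obtain X where X: "X \<in> carrier_mat k n" and eq: "ev M ?z = F * X"
    using gmat_factor[OF k Fc] M by blast
  let ?x = "xhat n i ((c - 1) / ph) ?z" and ?y = "xhat n i ((1 / c - 1) / ep) ?z"
  have xF: "?x * F \<in> carrier_mat n k" and Xy: "X * ?y \<in> carrier_mat k n"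
    by (rule mult_carrier_mat[OF xhat_carrier Fc], rule mult_carrier_mat[OF X xhat_carrier])
  have "ev M' ?z = ?x * (F * X) * ?y" using M'[OF z] eq by simp
  also have "\<dots> = ?x * F * X * ?y" unfolding assoc_mult_mat[OF xhat_carrier Fc X] ..
  also have "\<dots> = (?x * F) * (X * ?y)" by (rule assoc_mult_mat[OF xF X xhat_carrier])
  finally have eq': "ev M' ?z = (?x * F) * (X * ?y)" .
  have cons: "consec n k (?x * F)" by (rule consec_of_band_factor[OF L' k xF Xy eq'])
  have G: "M' = gmat n k (?x * F) t" by (rule band_eq_gmat[OF L' k xF Xy eq' t])
  obtain r where r: "row_det k (?x * F) r \<noteq> 0" "\<And>a. a < k \<Longrightarrow> r a < n"
    using consec_row_det[OF cons k xF] by metis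
  have N: "vec_space.col_space n F = N" using F by (simp add: frame_def)
  define N' where "N' = (\<lambda>w. ?x *\<^sub>v w) ` N"
  have ch: "g_value n k (N', t) M'"
    unfolding g_value_def N'_def N[symmetric] col_space_left_mult[OF Fc xhat_carrier]
    using frame_of_row_det[OF xF r] cons G t by auto
  have xm: "?x = x_mat n i ((if i = 0 then (- 1) ^ (k - 1) / t else 1) * ((c - 1) / ph))"
  proof -
    have "(c - 1) / ph / ?z = (- 1) ^ (k - 1) / t * ((c - 1) / ph)"
      by (cases "even (k - 1)") (simp_all add: field_simps)
    then show ?thesis by (simp add: xhat_def)
  qed
  have "e_map n k i c x = Some (N', t)"
    using c ph t unfolding e_map_def xN N'_def xm by (auto simp: pdiv_def)
  then show ?thesis using ch M' by blast
qed

text \<open>The parameters \<open>c\<^sub>1\<close> and \<open>c\<^sub>2\<close> are such that the right factor coming from \<open>u\<close> and the left factor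
coming from \<open>v\<close> are inverse to each other.\<close>

lemma g_e_map2:
  assumes u: "g_value n k1 u A" and v: "g_value n k2 v B"
    and k1: "0 < k1" "k1 < n" and k2: "0 < k2" "k2 < n" and i: "i < n" and c: "c \<noteq> 0"
    and pu: "phi_map n k1 i u = Some pu" "pu \<noteq> 0" and eu: "eps_map n k1 i u = Some eu" "eu \<noteq> 0"
    and pv: "phi_map n k2 i v = Some pv" "pv \<noteq> 0" and ev: "eps_map n k2 i v = Some ev'" "ev' \<noteq> 0"
    and nz: "eu + pv \<noteq> 0" "c * eu + pv \<noteq> 0"
  shows "\<exists>u' v' A' B'. e_map2 n k1 k2 i c (u, v) = Some (u', v') \<and> g_value n k1 u' A' \<and> g_value n k2 v' B' \<and>
    (\<forall>l. l \<noteq> 0 \<longrightarrow> ev (A' * B') l =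
      xhat n i ((c - 1) * eu / ((eu + pv) * pu)) l * ev (A * B) l *
      xhat n i ((1 / c - 1) * pv / ((eu + pv) * ev')) l)"
proof -
  define c1 where "c1 = (c * eu + pv) / (eu + pv)"
  define c2 where "c2 = (eu + pv) / (eu + inverse c * pv)"
  have d: "eu + inverse c * pv \<noteq> 0"
  proof
    assume "eu + inverse c * pv = 0"
    then have "c * (eu + inverse c * pv) = 0" by simp
    then show False using nz(2) c by (simp add: distrib_left mult.assoc[symmetric])
  qed
  have c12: "c1 \<noteq> 0" "c2 \<noteq> 0" using nz d by (auto simp: c1_def c2_def)
  obtain u' A' where u': "e_map n k1 i c1 u = Some u'" "g_value n k1 u' A'" and
    A': "\<And>l. l \<noteq> 0 \<Longrightarrow> ev A' l = xhat n i ((c1 - 1) / pu) l * ev A l * xhat n i ((1 / c1 - 1) / eu) l"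
    using g_e_map[OF u k1 i c12(1) pu eu(1)] by blast
  obtain v' B' where v': "e_map n k2 i c2 v = Some v'" "g_value n k2 v' B'" and
    B': "\<And>l. l \<noteq> 0 \<Longrightarrow> ev B' l = xhat n i ((c2 - 1) / pv) l * ev B l * xhat n i ((1 / c2 - 1) / ev') l"
    using g_e_map[OF v k2 i c12(2) pv ev(1)] by blast
  have n: "1 < n" using k1 by simp
  have c1': "(c1 - 1) / pu = (c - 1) * eu / ((eu + pv) * pu)"
    using nz by (simp add: c1_def field_simps)
  have c2': "(1 / c2 - 1) / ev' = (1 / c - 1) * pv / ((eu + pv) * ev')"
  proof -
    define ic where "ic = inverse c"
    have "c2 = (eu + pv) / (eu + ic * pv)" by (simp only: c2_def ic_def)
    then have "1 / c2 - 1 = (ic - 1) * pv / (eu + pv)"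
      using nz(1) by (simp add: field_simps)
    then show ?thesis by (simp add: ic_def inverse_eq_divide)
  qed
  \<comment> \<open>the two inner factors are inverse to each other\<close>
  have mid: "(1 / c1 - 1) / eu + (c2 - 1) / pv = 0"
  proof -
    have "1 / c1 - 1 = (eu + pv) / (c * eu + pv) - (c * eu + pv) / (c * eu + pv)"
      using nz(2) by (simp add: c1_def)
    also have "\<dots> = (1 - c) * eu / (c * eu + pv)"
      unfolding diff_divide_distrib[symmetric] by (simp add: algebra_simps)
    finally have a: "(1 / c1 - 1) / eu = (1 - c) / (c * eu + pv)" using eu(2) by simp
    have "c2 = c * (eu + pv) / (c * eu + pv)"
      using nz d c by (simp add: c2_def field_simps)
    then have b: "(c2 - 1) / pv = (c - 1) / (c * eu + pv)"
      using nz pv(2) by (simp add: field_simps)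
    show ?thesis unfolding a b by (simp add: add_divide_distrib[symmetric])
  qed
  have carr: "A \<in> carrier_mat n n" "B \<in> carrier_mat n n" "A' \<in> carrier_mat n n" "B' \<in> carrier_mat n n"
    using u v u'(2) v'(2) by (auto elim!: g_valueE)
  have "ev (A' * B') l = xhat n i ((c1 - 1) / pu) l * ev (A * B) l * xhat n i ((1 / c2 - 1) / ev') l"
    if l: "l \<noteq> 0" for l
  proof -
    let ?X1 = "xhat n i ((c1 - 1) / pu) l" and ?X2 = "xhat n i ((1 / c1 - 1) / eu) l"
    let ?Y1 = "xhat n i ((c2 - 1) / pv) l" and ?Y2 = "xhat n i ((1 / c2 - 1) / ev') l"
    have cX: "?X1 \<in> carrier_mat n n" "?X2 \<in> carrier_mat n n" "?Y1 \<in> carrier_mat n n"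
      "?Y2 \<in> carrier_mat n n" by simp_all
    have cA: "ev A l \<in> carrier_mat n n" "ev B l \<in> carrier_mat n n" using carr by auto
    have XY: "?X2 * ?Y1 = 1\<^sub>m n"
      unfolding xhat_def
    proof (rule x_mat_inverse[OF n i])
      have "(1 / c1 - 1) / eu / l + (c2 - 1) / pv / l = 0"
        unfolding add_divide_distrib[symmetric] mid by simp
      then show "(if i = 0 then (1 / c1 - 1) / eu / l else (1 / c1 - 1) / eu) +
          (if i = 0 then (c2 - 1) / pv / l else (c2 - 1) / pv) = 0"
        using mid by (cases "i = 0") (simp_all only: if_True if_False simp_thms)
    qed
    note mc = mult_carrier_mat[of _ n n _ n]
    have "ev (A' * B') l = (?X1 * ev A l * ?X2) * (?Y1 * ev B l * ?Y2)"
      using ev_mult[OF carr(3,4)] A'[OF l] B'[OF l] by simp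
    also have "\<dots> = (?X1 * ev A l) * (?X2 * ?Y1) * (ev B l * ?Y2)"
      using cX cA by (simp add: assoc_mult_mat[of _ n n _ n _ n] mc)
    also have "\<dots> = ?X1 * ev (A * B) l * ?Y2"
      unfolding XY using cX cA ev_mult[OF carr(1,2)]
      by (simp add: assoc_mult_mat[of _ n n _ n _ n] mc)
    finally show ?thesis .
  qed
  moreover have "e_map2 n k1 k2 i c (u, v) = Some (u', v')"
    using eu(1) pv(1) nz d u'(1) v'(1) unfolding e_map2_def c1_def c2_def by (simp add: pdiv_def)
  ultimately show ?thesis using u'(2) v'(2) unfolding c1' c2' by blast
qed

text \<open>In the bottom left block the band of \<open>A B\<close> has not yet wrapped around, so the minor is a constant
polynomial and can be evaluated at any \<open>l\<close>.\<close>

lemma E_map_eq_minor: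
  assumes u: "g_value n k1 u A" and v: "g_value n k2 v B"
    and k1: "0 < k1" "k1 < n" and k2: "0 < k2" "k2 < n"
  shows "E_map n k1 k2 (u, v) =
    Some (row_det (min k1 k2) (ev (A * B) l) (\<lambda>a. n - min k1 k2 + a))"
proof -
  define k where "k = min k1 k2"
  have k: "0 < k" "k < n" "k \<le> k1" "k \<le> k2" "k \<le> n" using k1 k2 by (auto simp: k_def)
  let ?r = "\<lambda>a. n - k + a"
  have AB: "banded n ((n - k1) + (n - k2)) (A * B)"
    using banded_mult g_value_g_like[OF u k1] g_value_g_like[OF v k2] by (auto simp: g_like_def)
  note ABc = bandedD(1)[OF AB]
  have const: "(A * B) $$ (?r a, c) = [:coeff ((A * B) $$ (?r a, c)) 0:]" if ac: "a < k" "c < k" for a c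
  proof (rule poly_eqI)
    fix p
    have i: "?r a < n" "c < n" using ac k by auto
    have "p = 0" if "coeff ((A * B) $$ (?r a, c)) p \<noteq> 0"
    proof (rule ccontr)
      assume "p \<noteq> 0"
      then have "n * 1 \<le> n * p" by (intro mult_le_mono2) simp
      then show False using bandedD(2)[OF AB i that] ac k k1 k2 by linarith
    qed
    then show "coeff ((A * B) $$ (?r a, c)) p = coeff [:coeff ((A * B) $$ (?r a, c)) 0:] p"
      by (cases p) auto
  qed
  interpret hom: comm_ring_hom "\<lambda>x :: complex. [:x:]" by unfold_locales (auto simp: one_pCons)
  have "row_det k (A * B) ?r = det (map_mat (\<lambda>x. [:x:]) (mat k k (\<lambda>(a, c). ev (A * B) l $$ (?r a, c))))"
    unfolding row_det_def
  proof (rule arg_cong[of _ _ det], rule eq_matI)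
    fix a c assume "a < dim_row (map_mat (\<lambda>x. [:x:]) (mat k k (\<lambda>(a, c). ev (A * B) l $$ (?r a, c))))"
      "c < dim_col (map_mat (\<lambda>x. [:x:]) (mat k k (\<lambda>(a, c). ev (A * B) l $$ (?r a, c))))"
    then have ac: "a < k" "c < k" by auto
    have "poly ((A * B) $$ (?r a, c)) l = coeff ((A * B) $$ (?r a, c)) 0"
      by (subst const[OF ac]) simp
    moreover have "ev (A * B) l $$ (?r a, c) = poly ((A * B) $$ (?r a, c)) l"
      by (rule ev_index) (use ABc ac k in auto)
    ultimately show "mat k k (\<lambda>(a, c). (A * B) $$ (?r a, c)) $$ (a, c) =
        map_mat (\<lambda>x. [:x:]) (mat k k (\<lambda>(a, c). ev (A * B) l $$ (?r a, c))) $$ (a, c)"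
      using ac const[OF ac] by simp
  qed auto
  also have "\<dots> = [:row_det k (ev (A * B) l) ?r:]" by (simp add: row_det_def)
  finally have "row_det k (A * B) ?r = [:row_det k (ev (A * B) l) ?r:]" .
  moreover have "minor (A * B) {n - k + 1..n} {1..k} = row_det k (A * B) ?r"
  proof -
    have "Suc ` ?r ` {..<k} = {n - k + 1..n}"
    proof (intro equalityI subsetI)
      fix m assume "m \<in> {n - k + 1..n}"
      then show "m \<in> Suc ` ?r ` {..<k}"
        using k by (auto simp: image_image intro!: image_eqI[of _ _ "m - 1 - (n - k)"])
    qed (use k in auto)
    moreover have "minor (A * B) (Suc ` ?r ` {..<k}) {1..k} = row_det k (A * B) ?r"
      by (rule minor_eq_row_det[OF ABc k(5)]) (use k in \<open>auto simp: strict_mono_on_def\<close>)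
    ultimately show ?thesis by metis
  qed
  ultimately show ?thesis
    using g_value_g_map[OF u k1] g_value_g_map[OF v k2] by (simp add: E_map_def Let_def k_def)
qed

text \<open>Upper unitriangular matrices act on the bottom rows and on the first columns by operations within
the block.\<close>

lemma bottom_minor_x_mat:
  assumes G: "G \<in> carrier_mat n n" and k: "0 < k" "k < n" and i: "0 < i" "i < n"
  shows "row_det k (x_mat n i a * G * x_mat n i b) (\<lambda>a. n - k + a) = row_det k G (\<lambda>a. n - k + a)"
proof -
  let ?B = "\<lambda>H. mat k k (\<lambda>(s, c). H $$ (n - k + s, c))"
  have xG: "x_mat n i a * G \<in> carrier_mat n n" by (rule mult_carrier_mat[OF x_mat_carrier G])
  have p: "prev n i = i - 1" using i by (simp add: prev_def)
  have "det (?B (x_mat n i a * G)) = det (?B G)"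
  proof (cases "n - k < i")
    case True
    have "?B (x_mat n i a * G) = addrow a (i - 1 - (n - k)) (i - (n - k)) (?B G)"
    proof (rule eq_matI)
      fix s c assume "s < dim_row (addrow a (i - 1 - (n - k)) (i - (n - k)) (?B G))"
        "c < dim_col (addrow a (i - 1 - (n - k)) (i - (n - k)) (?B G))"
      then have sc: "s < k" "c < k" by auto
      then show "?B (x_mat n i a * G) $$ (s, c) = addrow a (i - 1 - (n - k)) (i - (n - k)) (?B G) $$ (s, c)"
        using x_mat_mult_left[OF i(2) _ _ G, of "n - k + s" c a] k i p True by (auto simp: add.commute)
    qed auto
    then show ?thesis using det_addrow[of "i - (n - k)" k "i - 1 - (n - k)" "?B G" a] i k True by auto
  next
    case False
    have "?B (x_mat n i a * G) = ?B G"
      by (rule eq_matI) (use x_mat_mult_left[OF i(2) _ _ G] k i p False in auto)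
    then show ?thesis by simp
  qed
  moreover have "det (?B (H * x_mat n i b)) = det (?B H)" if H: "H \<in> carrier_mat n n" for H
  proof (cases "i < k")
    case True
    have "?B (H * x_mat n i b) = addcol b i (i - 1) (?B H)"
      by (rule eq_matI) (use x_mat_mult_right[OF i(2) _ _ H] k i p True in auto)
    also have "det \<dots> = det (?B H)" by (rule det_addcol[of _ k]) (use i True in auto)
    finally show ?thesis .
  next
    case False
    have "?B (H * x_mat n i b) = ?B H"
      by (rule eq_matI) (use x_mat_mult_right[OF i(2) _ _ H] k i p False in auto)
    then show ?thesis by simp
  qed
  ultimately show ?thesis using xG by (simp add: row_det_def)
qed

text \<open>As \<open>C\<close> factors through both spaces of dimension \<open>k\<close>, it is \<open>V D Q\<close> where \<open>V\<close> consists of the first columns of \<open>Gx\<close>, \<open>D\<close>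
is square of size \<open>k\<close>, and \<open>Q\<close> starts with the identity and is obtained from \<open>Gy\<close>. The two
multiplications affect the minor of \<open>V\<close> in the bottom rows and that of \<open>Q\<close> in the first columns. Once
such a block is the identity, the left factor changes its last row and the right factor its first
column. The block stays triangular, and its new diagonal entry is read off from the corner entry
\<open>(0, n - 1)\<close> of \<open>Gx\<close>, or of \<open>Gy\<close>.\<close>

lemma bottom_minor_xhat0:
  assumes Gx: "banded n (n - k) Gx" and Gy: "banded n (n - k) Gy" and k: "0 < k" "k < n" and z: "z \<noteq> 0"
    and F1: "F1 \<in> carrier_mat n k" and X1: "X1 \<in> carrier_mat k n" and e1: "ev Gx z = F1 * X1"
    and F2: "F2 \<in> carrier_mat n k" and X2: "X2 \<in> carrier_mat k n" and e2: "ev Gy z = F2 * X2"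
    and Y: "Y \<in> carrier_mat n n" and X: "X \<in> carrier_mat n n"
    and C1: "C = ev Gx z * Y" and C2: "C = X * ev Gy z"
  shows "row_det k (xhat n 0 a z * C * xhat n 0 b z) (\<lambda>a. n - k + a) =
    (1 + a * (loop_coeff Gx 0 (n - 1) / loop_coeff Gx (n - 1) (n - 1))) *
    (1 + b * (loop_coeff Gy 0 (n - 1) / loop_coeff Gy 0 0)) * row_det k C (\<lambda>a. n - k + a)"
proof -
  let ?r = "\<lambda>a. n - k + a"
  have kn: "k \<le> n" and nk: "n - k < n" and n: "0 < n" "n - 1 < n" "1 < n" using k by auto
  have Gxc: "ev Gx z \<in> carrier_mat n n" and Gyc: "ev Gy z \<in> carrier_mat n n"
    using bandedD(1)[OF Gx] bandedD(1)[OF Gy] by auto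
  obtain P where P: "P \<in> carrier_mat k n" and Gx_VP: "ev Gx z = first_cols k (ev Gx z) * P"
    using column_reduced_factor[OF F1 X1 kn banded_factor_minors(2)[OF Gx k F1 X1 e1]] e1 by auto
  obtain Q where Q: "Q \<in> carrier_mat k n" and Gy_VQ: "ev Gy z = first_cols k (ev Gy z) * Q"
    and Q1: "first_cols k Q = 1\<^sub>m k"
    using column_reduced_factor[OF F2 X2 kn banded_factor_minors(2)[OF Gy k F2 X2 e2]] e2 by auto
  define V where "V = first_cols k (ev Gx z)"
  define V' where "V' = first_cols k (ev Gy z)"
  have V: "V \<in> carrier_mat n k" and V': "V' \<in> carrier_mat n k" using Gxc Gyc by (auto simp: V_def V'_def)
  define D where "D = first_cols k (P * Y)"
  have PY: "P * Y \<in> carrier_mat k n" using P Y by simp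
  have D: "D \<in> carrier_mat k k" unfolding D_def by (rule first_cols_carrier[OF PY])
  have CVPY: "C = V * (P * Y)"
    unfolding C1 using Gx_VP assoc_mult_mat[OF V P Y] by (simp add: V_def)
  have "first_cols k C = V * D" unfolding CVPY D_def by (rule first_cols_mult[OF V PY kn])
  moreover have XV': "X * V' \<in> carrier_mat n k" using X V' by simp
  have CQ: "C = X * V' * Q"
    unfolding C2 using Gy_VQ assoc_mult_mat[OF X V' Q] by (simp add: V'_def)
  have "first_cols k C = X * V'"
    unfolding CQ first_cols_mult[OF XV' Q kn] Q1 by (rule right_mult_one_mat[OF XV'])
  ultimately have CVDQ: "C = V * D * Q" using CQ by simp
  let ?x = "xhat n 0 a z" and ?y = "xhat n 0 b z"
  have xV: "?x * V \<in> carrier_mat n k" by (rule mult_carrier_mat[OF xhat_carrier V])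
  have Qy: "Q * ?y \<in> carrier_mat k n" by (rule mult_carrier_mat[OF Q xhat_carrier])
  have DQ: "D * Q \<in> carrier_mat k n" and DQy: "D * (Q * ?y) \<in> carrier_mat k n" using D Q Qy by auto
  have VD: "V * D \<in> carrier_mat n k" using V D by simp
  have VDQ: "V * D * Q \<in> carrier_mat n n" using VD Q by simp
  have "?x * C * ?y = ?x * V * (D * (Q * ?y))"
    unfolding CVDQ
    using assoc_mult_mat[OF xhat_carrier VD Q, of 0 a z] assoc_mult_mat[OF xhat_carrier V D, of 0 a z]
      assoc_mult_mat[OF mult_carrier_mat[OF xV D] Q xhat_carrier, of 0 b z] assoc_mult_mat[OF xV D Qy] by simp
  then have "row_det k (?x * C * ?y) ?r = row_det k (?x * V) ?r * (row_det k D (\<lambda>a. a) * row_det k (Q * ?y) (\<lambda>a. a))"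
    using row_det_mult[OF xV DQy kn, of ?r] row_det_mult[OF D Qy kn, of "\<lambda>a. a"] k by simp
  moreover have "row_det k C ?r = row_det k V ?r * (row_det k D (\<lambda>a. a) * row_det k Q (\<lambda>a. a))"
    using row_det_mult[OF V DQ kn, of ?r] row_det_mult[OF D Q kn, of "\<lambda>a. a"] k CVDQ assoc_mult_mat[OF V D Q] by simp
  moreover have "row_det k Q (\<lambda>a. a) = 1" unfolding row_det_id[OF Q] Q1 by simp
  moreover have "row_det k V ?r = 1"
    using banded_bottom_minor[OF Gx k, of z] row_det_first_cols[of k ?r "ev Gx z"] Gxc k
    by (simp add: V_def)
  moreover have "row_det k (Q * ?y) (\<lambda>a. a) = 1 + b * (loop_coeff Gy 0 (n - 1) / loop_coeff Gy 0 0)"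
  proof -
    let ?T = "mat k k (\<lambda>(s, c). (Q * ?y) $$ (s, c))"
    have Qe: "Q $$ (s, c) = (if s = c then 1 else 0)" if "s < k" "c < k" for s c
      using arg_cong[OF Q1, of "\<lambda>A. A $$ (s, c)"] that Q by simp
    have ent: "(Q * ?y) $$ (s, c) = (if s = c then 1 else 0) + (if c = 0 then b / z * Q $$ (s, n - 1) else 0)"
      if "s < k" "c < k" for s c
      using x_mat_mult_right[OF n(1) that(1) _ Q, of c "b / z"] that k Qe[OF that]
      by (simp add: xhat_def prev_def)
    have "det ?T = prod_list (diag_mat ?T)"
      by (rule det_lower_triangular[of k]) (auto simp: ent)
    also have "diag_mat ?T = (1 + b / z * Q $$ (0, n - 1)) # replicate (k - 1) 1"
      by (rule nth_equalityI) (use k in \<open>auto simp: diag_mat_def ent nth_Cons split: nat.split\<close>)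
    finally have "row_det k (Q * ?y) (\<lambda>a. a) = 1 + b / z * Q $$ (0, n - 1)" by (simp add: row_det_def)
    moreover have "ev Gy z $$ (0, n - 1) = ev Gy z $$ (0, 0) * Q $$ (0, n - 1)"
    proof -
      have "ev Gy z $$ (0, n - 1) = (V' * Q) $$ (0, n - 1)" using Gy_VQ by (simp add: V'_def)
      also have "\<dots> = (\<Sum>c\<in>{0..<k}. V' $$ (0, c) * Q $$ (c, n - 1))"
        using V' Q n by (simp add: scalar_prod_def)
      also have "\<dots> = V' $$ (0, 0) * Q $$ (0, n - 1)"
        by (rule sum_eq_single)
          (use k banded_first_col_entry[OF Gy k n(1)] Gyc in \<open>auto simp: V'_def split: if_splits\<close>)
      finally show ?thesis using Gyc k by (simp add: V'_def)
    qed
    moreover from this have "Q $$ (0, n - 1) = z * loop_coeff Gy 0 (n - 1) / loop_coeff Gy 0 0"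
      using banded_ev[OF Gy nk n(1) n(2), of z] banded_ev[OF Gy nk n(1) n(1), of z]
        loop_coeff_band(3)[OF Gy n(1) n(1)] n(3)
      by (simp add: wrap_def field_simps)
    ultimately show ?thesis using z by simp
  qed
  moreover have "row_det k (?x * V) ?r = 1 + a * (loop_coeff Gx 0 (n - 1) / loop_coeff Gx (n - 1) (n - 1))"
  proof -
    define U where "U = mat k k (\<lambda>(s, c). V $$ (?r s, c))"
    have U: "U \<in> carrier_mat k k" and dU: "det U = 1"
      using \<open>row_det k V ?r = 1\<close> by (simp_all add: row_det_def U_def)
    then obtain Ui where Ui: "Ui \<in> carrier_mat k k" "U * Ui = 1\<^sub>m k" "Ui * U = 1\<^sub>m k"
      using inverse_of_det[OF U] by auto
    \<comment> \<open>the basis of the column space that restricts to the identity on the bottom rows\<close>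
    define H where "H = V * Ui"
    have H: "H \<in> carrier_mat n k" unfolding H_def by (rule mult_carrier_mat[OF V Ui(1)])
    have VHU: "V = H * U" unfolding H_def assoc_mult_mat[OF V Ui(1) U] Ui(3) using V by simp
    have bottom: "H $$ (?r s, c) = (if s = c then 1 else 0)" if "s < k" "c < k" for s c
    proof -
      have "H $$ (?r s, c) = (U * Ui) $$ (s, c)"
        using that V U Ui(1) k by (auto simp: H_def U_def scalar_prod_def)
      then show ?thesis using that by (simp add: Ui(2))
    qed
    let ?T = "mat k k (\<lambda>(s, c). (?x * H) $$ (?r s, c))"
    have ent: "(?x * H) $$ (?r s, c) = (if s = c then 1 else 0) + (if s = k - 1 then a / z * H $$ (0, c) else 0)"
      if "s < k" "c < k" for s c
    proof -
      have "?r s = n - 1 \<longleftrightarrow> s = k - 1" using that k by auto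
      then show ?thesis
        using x_mat_mult_left[OF n(1) _ that(2) H, of "?r s" "a / z"] bottom[OF that] that k
        by (simp add: xhat_def prev_def)
    qed
    have "row_det k (?x * V) ?r = row_det k (?x * H) ?r * row_det k U (\<lambda>a. a)"
      unfolding VHU assoc_mult_mat[OF xhat_carrier H U, symmetric]
      by (rule row_det_mult[OF mult_carrier_mat[OF xhat_carrier H] U]) (use k in auto)
    also have "row_det k U (\<lambda>a. a) = det U"
      unfolding row_det_def by (rule arg_cong[of _ _ det], rule eq_matI) (use U in auto)
    also have "row_det k (?x * H) ?r = prod_list (diag_mat ?T)"
      unfolding row_det_def by (rule det_lower_triangular[of k]) (auto simp: ent)
    also have "diag_mat ?T = map (\<lambda>s. 1 + (if s = k - 1 then a / z * H $$ (0, k - 1) else 0)) [0..<k]"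
      by (rule nth_equalityI) (auto simp: diag_mat_def ent)
    also have "\<dots> = replicate (k - 1) 1 @ [1 + a / z * H $$ (0, k - 1)]"
      by (rule nth_equalityI) (use k in \<open>auto simp: nth_append\<close>)
    finally have res: "row_det k (?x * V) ?r = 1 + a / z * H $$ (0, k - 1)" by (simp add: dU)
    define g where "g = loop_coeff Gx (n - 1) (n - 1)"
    have g: "g \<noteq> 0" unfolding g_def by (rule loop_coeff_band(3)[OF Gx n(2) n(2) refl])
    have cP: "col P (n - 1) \<in> carrier_vec k" using P n by (auto intro: col_carrier_vec)
    have VPe: "ev Gx z $$ (s, n - 1) = (V *\<^sub>v col P (n - 1)) $ s" if "s < n" for s
    proof -
      have "ev Gx z $$ (s, n - 1) = (V * P) $$ (s, n - 1)" using Gx_VP by (simp add: V_def)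
      then show ?thesis using V P that n by simp
    qed
    have "U *\<^sub>v col P (n - 1) = g \<cdot>\<^sub>v unit_vec k (k - 1)"
    proof (rule eq_vecI)
      fix s assume "s < dim_vec (g \<cdot>\<^sub>v unit_vec k (k - 1))"
      then have s: "s < k" by simp
      then have rs: "?r s < n" using k by simp
      have "(U *\<^sub>v col P (n - 1)) $ s = (V *\<^sub>v col P (n - 1)) $ ?r s"
        using s rs V P by (auto simp: U_def scalar_prod_def)
      also have "\<dots> = loop_coeff Gx (?r s) (n - 1) * z ^ wrap (?r s) (n - 1)"
        unfolding VPe[OF rs, symmetric] by (rule banded_ev[OF Gx nk rs n(2)])
      also have "\<dots> = (g \<cdot>\<^sub>v unit_vec k (k - 1)) $ s"
      proof (cases "s = k - 1")
        case True
        then have "?r s = n - 1" using k by simp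
        then show ?thesis using s True by (simp add: g_def wrap_def)
      next
        case False
        have "loop_coeff Gx (?r s) (n - 1) = 0"
          by (rule ccontr) (use loop_coeff_band(1)[OF Gx rs n(2)] False s k in \<open>auto simp: wrap_def split: if_splits\<close>)
        then show ?thesis using s False by simp
      qed
      finally show "(U *\<^sub>v col P (n - 1)) $ s = (g \<cdot>\<^sub>v unit_vec k (k - 1)) $ s" .
    qed (simp add: U_def)
    then have "V *\<^sub>v col P (n - 1) = g \<cdot>\<^sub>v col H (k - 1)"
      using assoc_mult_mat_vec[OF H U cP] mult_mat_vec[OF H, of "unit_vec k (k - 1)" g]
        mat_mult_unit_vec[OF H, of "k - 1"] k VHU by simp
    then have "ev Gx z $$ (0, n - 1) = g * H $$ (0, k - 1)"
      using VPe[OF n(1)] H k by simp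
    then have "H $$ (0, k - 1) = loop_coeff Gx 0 (n - 1) * z / g"
      using banded_ev[OF Gx nk n(1) n(2), of z] g n by (simp add: wrap_def field_simps)
    then show ?thesis unfolding res using z g by (simp add: g_def)
  qed
  ultimately show ?thesis by simp
qed

section \<open>Generic conditions and localization\<close>

type_synonym pair_fun = "complex mat \<Rightarrow> complex \<Rightarrow> complex mat \<Rightarrow> complex \<Rightarrow> complex"

lemma poly_fun_sum:
  "finite I \<Longrightarrow> (\<And>i. i \<in> I \<Longrightarrow> poly_fun n k1 k2 (f i)) \<Longrightarrow>
    poly_fun n k1 k2 (\<lambda>A s B t. \<Sum>i\<in>I. f i A s B t)"
  by (induction I rule: finite_induct) (auto intro: poly_fun.intros)

lemma poly_fun_prod:
  "finite I \<Longrightarrow> (\<And>i. i \<in> I \<Longrightarrow> poly_fun n k1 k2 (f i)) \<Longrightarrow>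
    poly_fun n k1 k2 (\<lambda>A s B t. \<Prod>i\<in>I. f i A s B t)"
  by (induction I rule: finite_induct) (auto intro: poly_fun.intros)

lemma poly_fun_power:
  "poly_fun n k1 k2 f \<Longrightarrow> poly_fun n k1 k2 (\<lambda>A s B t. f A s B t ^ m)"
  by (induction m) (auto intro: poly_fun.intros)

lemma det_mat_expand:
  "det (mat k k (\<lambda>(a, c). f a c)) =
    (\<Sum>p\<in>{p. p permutes {0..<k}}. signof p * (\<Prod>a\<in>{0..<k}. f a (p a)))"
proof -
  have "(\<Prod>a = 0..<k. mat k k (\<lambda>(a, c). f a c) $$ (a, p a)) = (\<Prod>a\<in>{0..<k}. f a (p a))"
    if "p permutes {0..<k}" for p
    using permutes_in_image[OF that] by (intro prod.cong) auto
  then show ?thesis unfolding det_def by simp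
qed

lemma poly_fun_det:
  assumes "\<And>a c. a < k \<Longrightarrow> c < k \<Longrightarrow> poly_fun n k1 k2 (f a c)"
  shows "poly_fun n k1 k2 (\<lambda>A s B t. det (mat k k (\<lambda>(a, c). f a c A s B t)))"
  unfolding det_mat_expand
  by (intro poly_fun_sum poly_fun.mult poly_fun.const poly_fun_prod finite_permutations assms)
    (auto dest: permutes_in_image)

text \<open>Along a line in the space of all parameters a polynomial function is a polynomial in one variable.
This makes the ring of polynomial functions an integral domain.\<close>

lemma poly_fun_line:
  assumes "poly_fun n k1 k2 f"
  shows "\<exists>p. \<forall>x. poly p x = f (mat n k1 (\<lambda>ij. A0 $$ ij + x * (A1 $$ ij - A0 $$ ij))) (s0 + x * (s1 - s0))
    (mat n k2 (\<lambda>ij. B0 $$ ij + x * (B1 $$ ij - B0 $$ ij))) (t0 + x * (t1 - t0))"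
  using assms
proof induction
  case (const a)
  then show ?case by (intro exI[of _ "[:a:]"]) simp
next
  case (coord_A i j)
  then show ?case by (intro exI[of _ "[:A0 $$ (i, j), A1 $$ (i, j) - A0 $$ (i, j):]"]) simp
next
  case coord_s
  then show ?case by (intro exI[of _ "[:s0, s1 - s0:]"]) simp
next
  case (coord_B i j)
  then show ?case by (intro exI[of _ "[:B0 $$ (i, j), B1 $$ (i, j) - B0 $$ (i, j):]"]) simp
next
  case coord_t
  then show ?case by (intro exI[of _ "[:t0, t1 - t0:]"]) simp
next
  case (add f g)
  then show ?case by (metis poly_add)
next
  case (mult f g)
  then show ?case by (metis poly_mult)
qed

lemma nonzero_poly_fun_mult:
  assumes f: "nonzero_poly_fun n k1 k2 f" and g: "nonzero_poly_fun n k1 k2 g"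
  shows "nonzero_poly_fun n k1 k2 (\<lambda>A s B t. f A s B t * g A s B t)"
proof -
  obtain A0 B0 s0 t0 where 0: "A0 \<in> carrier_mat n k1" "B0 \<in> carrier_mat n k2" "f A0 s0 B0 t0 \<noteq> 0"
    using f unfolding nonzero_poly_fun_def by blast
  obtain A1 B1 s1 t1 where 1: "A1 \<in> carrier_mat n k1" "B1 \<in> carrier_mat n k2" "g A1 s1 B1 t1 \<noteq> 0"
    using g unfolding nonzero_poly_fun_def by blast
  \<comment> \<open>The line through the two witnesses contains a common one, since a product of nonzero polynomials in one variable is nonzero.\<close>
  define A where "A x = mat n k1 (\<lambda>ij. A0 $$ ij + x * (A1 $$ ij - A0 $$ ij))" for x
  define B where "B x = mat n k2 (\<lambda>ij. B0 $$ ij + x * (B1 $$ ij - B0 $$ ij))" for x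
  define s where "s x = s0 + x * (s1 - s0)" for x
  define t where "t x = t0 + x * (t1 - t0)" for x
  have ends: "A 0 = A0" "A 1 = A1" "B 0 = B0" "B 1 = B1" "s 0 = s0" "s 1 = s1" "t 0 = t0" "t 1 = t1"
    using 0 1 by (auto simp: A_def B_def s_def t_def intro!: eq_matI)
  obtain p where p: "\<And>x. poly p x = f (A x) (s x) (B x) (t x)"
    using poly_fun_line[of n k1 k2 f A0 A1 s0 s1 B0 B1 t0 t1] f
    unfolding nonzero_poly_fun_def A_def B_def s_def t_def by blast
  obtain q where q: "\<And>x. poly q x = g (A x) (s x) (B x) (t x)"
    using poly_fun_line[of n k1 k2 g A0 A1 s0 s1 B0 B1 t0 t1] g
    unfolding nonzero_poly_fun_def A_def B_def s_def t_def by blast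
  have "p \<noteq> 0" "q \<noteq> 0" using p[of 0] q[of 1] 0 1 ends by auto
  then have "p * q \<noteq> 0" by simp
  then obtain x where "poly (p * q) x \<noteq> 0" using poly_all_0_iff_0 by blast
  then have "f (A x) (s x) (B x) (t x) * g (A x) (s x) (B x) (t x) \<noteq> 0" using p q by simp
  moreover have "A x \<in> carrier_mat n k1" "B x \<in> carrier_mat n k2" by (simp_all add: A_def B_def)
  ultimately show ?thesis
    using f g poly_fun.mult unfolding nonzero_poly_fun_def by blast
qed

definition generic :: "nat \<Rightarrow> nat \<Rightarrow> nat \<Rightarrow>
    (complex mat \<Rightarrow> complex \<Rightarrow> complex mat \<Rightarrow> complex \<Rightarrow> bool) \<Rightarrow> bool" where
  "generic n k1 k2 P \<longleftrightarrow> (\<exists>q. nonzero_poly_fun n k1 k2 q \<and>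
     (\<forall>A\<in>carrier_mat n k1. \<forall>B\<in>carrier_mat n k2. \<forall>s t. q A s B t \<noteq> 0 \<longrightarrow> P A s B t))"

lemma generic_conj:
  assumes "generic n k1 k2 P" "generic n k1 k2 Q"
  shows "generic n k1 k2 (\<lambda>A s B t. P A s B t \<and> Q A s B t)"
proof -
  obtain p q where "nonzero_poly_fun n k1 k2 p" "nonzero_poly_fun n k1 k2 q"
    "\<forall>A\<in>carrier_mat n k1. \<forall>B\<in>carrier_mat n k2. \<forall>s t. p A s B t \<noteq> 0 \<longrightarrow> P A s B t"
    "\<forall>A\<in>carrier_mat n k1. \<forall>B\<in>carrier_mat n k2. \<forall>s t. q A s B t \<noteq> 0 \<longrightarrow> Q A s B t"
    using assms unfolding generic_def by blast
  then show ?thesis unfolding generic_def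
    by (intro exI[of _ "\<lambda>A s B t. p A s B t * q A s B t"] conjI nonzero_poly_fun_mult) auto
qed

lemma generic_mono:
  assumes "generic n k1 k2 P"
    and "\<And>A s B t. A \<in> carrier_mat n k1 \<Longrightarrow> B \<in> carrier_mat n k2 \<Longrightarrow> P A s B t \<Longrightarrow> Q A s B t"
  shows "generic n k1 k2 Q"
  using assms unfolding generic_def by blast

lemma generic_nonzero:
  assumes "poly_fun n k1 k2 q" "A \<in> carrier_mat n k1" "B \<in> carrier_mat n k2" "q A s B t \<noteq> 0"
  shows "generic n k1 k2 (\<lambda>A s B t. q A s B t \<noteq> 0)"
  using assms unfolding generic_def nonzero_poly_fun_def by blast

lemma generic_witness:
  assumes "generic n k1 k2 P"
  obtains A s B t where "A \<in> carrier_mat n k1" "B \<in> carrier_mat n k2" "P A s B t"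
  using assms unfolding generic_def nonzero_poly_fun_def by blast

lemma generic_all:
  assumes "finite I" "\<And>i. i \<in> I \<Longrightarrow> generic n k1 k2 (P i)"
  shows "generic n k1 k2 (\<lambda>A s B t. \<forall>i\<in>I. P i A s B t)"
  using assms
proof (induction I rule: finite_induct)
  case empty
  show ?case
    by (rule generic_mono[OF generic_nonzero[of n k1 k2 "\<lambda>A s B t. 1" "0\<^sub>m n k1" "0\<^sub>m n k2"]])
      (auto intro: poly_fun.intros)
next
  case (insert i I)
  then have "generic n k1 k2 (\<lambda>A s B t. P i A s B t \<and> (\<forall>i\<in>I. P i A s B t))"
    by (intro generic_conj) auto
  then show ?case by (rule generic_mono) auto
qed

text \<open>The function lies in the ring of polynomial functions localized at \<open>D\<close>, at least on matrices of
the right format.\<close>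

definition localized :: "nat \<Rightarrow> nat \<Rightarrow> nat \<Rightarrow> pair_fun \<Rightarrow> pair_fun \<Rightarrow> bool" where
  "localized n k1 k2 D f \<longleftrightarrow> (\<exists>p m. poly_fun n k1 k2 p \<and>
     (\<forall>A\<in>carrier_mat n k1. \<forall>B\<in>carrier_mat n k2. \<forall>s t. D A s B t \<noteq> 0 \<longrightarrow>
        f A s B t * D A s B t ^ m = p A s B t))"

lemma localized_cong:
  assumes "localized n k1 k2 D f"
    and "\<And>A s B t. A \<in> carrier_mat n k1 \<Longrightarrow> B \<in> carrier_mat n k2 \<Longrightarrow> D A s B t \<noteq> 0 \<Longrightarrow> g A s B t = f A s B t"
  shows "localized n k1 k2 D g"
  using assms unfolding localized_def by (metis (no_types, lifting))

lemma localized_poly: "poly_fun n k1 k2 f \<Longrightarrow> localized n k1 k2 D f"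
  unfolding localized_def by (intro exI[of _ f] exI[of _ 0]) auto

lemma localizedE:
  assumes "localized n k1 k2 D f"
  obtains p m where "poly_fun n k1 k2 p" "\<And>A s B t. A \<in> carrier_mat n k1 \<Longrightarrow> B \<in> carrier_mat n k2 \<Longrightarrow>
      D A s B t \<noteq> 0 \<Longrightarrow> p A s B t = f A s B t * D A s B t ^ m"
  using assms unfolding localized_def by metis

lemma localized_add:
  assumes D: "poly_fun n k1 k2 D" and f: "localized n k1 k2 D f" and g: "localized n k1 k2 D g"
  shows "localized n k1 k2 D (\<lambda>A s B t. f A s B t + g A s B t)"
  using f
proof (rule localizedE)
  fix p m assume p: "poly_fun n k1 k2 p" "\<And>A s B t. A \<in> carrier_mat n k1 \<Longrightarrow> B \<in> carrier_mat n k2 \<Longrightarrow>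
      D A s B t \<noteq> 0 \<Longrightarrow> p A s B t = f A s B t * D A s B t ^ m"
  from g show ?thesis
  proof (rule localizedE)
    fix q l assume q: "poly_fun n k1 k2 q" "\<And>A s B t. A \<in> carrier_mat n k1 \<Longrightarrow> B \<in> carrier_mat n k2 \<Longrightarrow>
      D A s B t \<noteq> 0 \<Longrightarrow> q A s B t = g A s B t * D A s B t ^ l"
    show ?thesis unfolding localized_def
      by (intro exI[of _ "\<lambda>A s B t. p A s B t * D A s B t ^ l + q A s B t * D A s B t ^ m"]
          exI[of _ "m + l"] conjI poly_fun.intros poly_fun_power p(1) q(1) D)
        (auto simp: p(2) q(2) power_add algebra_simps)
  qed
qed

lemma localized_mult:
  assumes f: "localized n k1 k2 D f" and g: "localized n k1 k2 D g"
  shows "localized n k1 k2 D (\<lambda>A s B t. f A s B t * g A s B t)"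
  using f
proof (rule localizedE)
  fix p m assume p: "poly_fun n k1 k2 p" "\<And>A s B t. A \<in> carrier_mat n k1 \<Longrightarrow> B \<in> carrier_mat n k2 \<Longrightarrow>
      D A s B t \<noteq> 0 \<Longrightarrow> p A s B t = f A s B t * D A s B t ^ m"
  from g show ?thesis
  proof (rule localizedE)
    fix q l assume q: "poly_fun n k1 k2 q" "\<And>A s B t. A \<in> carrier_mat n k1 \<Longrightarrow> B \<in> carrier_mat n k2 \<Longrightarrow>
      D A s B t \<noteq> 0 \<Longrightarrow> q A s B t = g A s B t * D A s B t ^ l"
    show ?thesis unfolding localized_def
      by (intro exI[of _ "\<lambda>A s B t. p A s B t * q A s B t"] exI[of _ "m + l"] conjI poly_fun.mult p(1) q(1))
        (auto simp: p(2) q(2) power_add algebra_simps)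
  qed
qed

lemma localized_divide:
  assumes f: "poly_fun n k1 k2 f" and e: "poly_fun n k1 k2 e"
    and D: "\<And>A s B t. A \<in> carrier_mat n k1 \<Longrightarrow> B \<in> carrier_mat n k2 \<Longrightarrow> D A s B t = d A s B t * e A s B t"
  shows "localized n k1 k2 D (\<lambda>A s B t. f A s B t / d A s B t)"
  unfolding localized_def
  by (intro exI[of _ "\<lambda>A s B t. f A s B t * e A s B t"] exI[of _ 1] conjI poly_fun.mult f e)
    (auto simp: D)

lemma localized_sum:
  assumes "poly_fun n k1 k2 D"
  shows "finite I \<Longrightarrow> (\<And>i. i \<in> I \<Longrightarrow> localized n k1 k2 D (f i)) \<Longrightarrow> localized n k1 k2 D (\<lambda>A s B t. \<Sum>i\<in>I. f i A s B t)"
  by (induction I rule: finite_induct) (auto intro: localized_add[OF assms] localized_poly poly_fun.intros)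

lemma localized_prod:
  "finite I \<Longrightarrow> (\<And>i. i \<in> I \<Longrightarrow> localized n k1 k2 D (f i)) \<Longrightarrow> localized n k1 k2 D (\<lambda>A s B t. \<Prod>i\<in>I. f i A s B t)"
  by (induction I rule: finite_induct) (auto intro: localized_mult localized_poly poly_fun.intros)

lemma localized_det:
  assumes "poly_fun n k1 k2 D" "\<And>a c. a < k \<Longrightarrow> c < k \<Longrightarrow> localized n k1 k2 D (f a c)"
  shows "localized n k1 k2 D (\<lambda>A s B t. det (mat k k (\<lambda>(a, c). f a c A s B t)))"
  unfolding det_mat_expand
  by (intro localized_sum[OF assms(1)] localized_mult localized_poly[OF poly_fun.const] localized_prod finite_permutations assms(2))
    (auto dest: permutes_in_image)

text \<open>For elements of the localization a single nonzero value implies that the function is generically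
nonzero.\<close>

lemma generic_localized:
  assumes D: "poly_fun n k1 k2 D" and f: "localized n k1 k2 D f"
    and w: "A \<in> carrier_mat n k1" "B \<in> carrier_mat n k2" "D A s B t \<noteq> 0" "f A s B t \<noteq> 0"
  shows "generic n k1 k2 (\<lambda>A s B t. f A s B t \<noteq> 0)"
proof -
  obtain p m where p: "poly_fun n k1 k2 p" "\<And>A s B t. A \<in> carrier_mat n k1 \<Longrightarrow> B \<in> carrier_mat n k2 \<Longrightarrow>
      D A s B t \<noteq> 0 \<Longrightarrow> p A s B t = f A s B t * D A s B t ^ m"
    using localizedE[OF f] by blast
  have "p A s B t \<noteq> 0" using p(2)[OF w(1-3)] w(3,4) by auto
  then have "generic n k1 k2 (\<lambda>A s B t. p A s B t * D A s B t \<noteq> 0)"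
    by (intro generic_nonzero[where A = A and B = B and s = s and t = t] poly_fun.mult p(1) D w)
      (use w(3) in simp)
  then show ?thesis by (rule generic_mono) (use p(2) in force)
qed

text \<open>Frames of coordinate subspaces; their minors are \<open>0\<close> or \<open>\<plusminus>1\<close>, which makes these frames
convenient witnesses.\<close>

definition select_rows :: "nat \<Rightarrow> nat \<Rightarrow> (nat \<Rightarrow> nat) \<Rightarrow> complex mat" where
  "select_rows n k r = mat n k (\<lambda>(i, c). if i = r c then 1 else 0)"

lemma select_rows_carrier [simp]: "select_rows n k r \<in> carrier_mat n k"
  by (simp add: select_rows_def)

lemma row_det_select_rows:
  assumes "inj_on r {..<k}" "\<And>a. a < k \<Longrightarrow> r a < n"
  shows "row_det k (select_rows n k r) r = 1"
proof -
  have "mat k k (\<lambda>(a, c). select_rows n k r $$ (r a, c)) = 1\<^sub>m k"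
    by (rule eq_matI) (use assms in \<open>auto simp: select_rows_def inj_on_def\<close>)
  then show ?thesis by (simp add: row_det_def)
qed

lemma row_det_select_rows_zero:
  assumes "b < k" "r' b < n" "r' b \<notin> r ` {..<k}"
  shows "row_det k (select_rows n k r) r' = 0"
proof -
  have "det (mat k k (\<lambda>(a, c). select_rows n k r $$ (r' a, c))) =
      (\<Sum>c<k. mat k k (\<lambda>(a, c). select_rows n k r $$ (r' a, c)) $$ (b, c) *
        cofactor (mat k k (\<lambda>(a, c). select_rows n k r $$ (r' a, c))) b c)"
    by (rule laplace_expansion_row) (use assms in auto)
  also have "\<dots> = 0" by (rule sum.neutral) (use assms in \<open>auto simp: select_rows_def\<close>)
  finally show ?thesis by (simp add: row_det_def)
qed

definition bracket :: "nat \<Rightarrow> nat \<Rightarrow> complex mat \<Rightarrow> nat \<Rightarrow> nat \<Rightarrow> complex" where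
  "bracket n k F i j = row_det k F (insert_row n k j (insert_pos k i j) i)"

lemma bracket_rows:
  assumes "0 < k" "k < n" "j < n" "i < n" "i + n * wrap i j \<le> j + (n - k)"
  shows "inj_on (insert_row n k j (insert_pos k i j) i) {..<k}"
    and "\<And>a. a < k \<Longrightarrow> insert_row n k j (insert_pos k i j) i a < n"
    and "insert_row n k j (insert_pos k i j) i ` {..<k} = insert i {m. m < n \<and> \<not> m + n * wrap m j \<le> j + (n - k)}"
  using strict_mono_on_imp_inj_on[OF insert_row_strict_mono[OF assms]]
    insert_row_less[OF assms(1-4) insert_pos_less[OF assms(1)]] insert_row_image[OF insert_pos_less[OF assms(1)]]
    inner_row_image[OF assms(1-3)] by auto

lemma end_row_in_band:
  assumes "0 < k" "k < n" "j < n"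
  shows "end_row n k j + n * wrap (end_row n k j) j \<le> j + (n - k)"
  using end_row_top[OF assms end_row_less[OF assms]] by simp

lemma consec_bracket:
  assumes k: "0 < k" "k < n" and F: "F \<in> carrier_mat n k"
  shows "consec n k F \<longleftrightarrow> (\<forall>j<n. bracket n k F (end_row n k j) j \<noteq> 0)"
  unfolding consec_def bracket_def using plk_consec_row_det[OF k _ F] by metis

lemma ratio_bracket:
  assumes k: "0 < k" "k < n" and j: "j < n" and i: "i < n" and F: "F \<in> carrier_mat n k"
  shows "ratio n k F i j = (if i + n * wrap i j \<le> j + (n - k)
    then bracket n k F i j / bracket n k F (end_row n k j) j else 0)"
  unfolding ratio_def plk_insert[OF k j i F] plk_consec_row_det[OF k j F] bracket_def by simp

definition consec_prod :: "nat \<Rightarrow> nat \<Rightarrow> complex mat \<Rightarrow> complex" where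
  "consec_prod n k F = (\<Prod>j<n. bracket n k F (end_row n k j) j)"

lemma consec_prod_nonzero:
  assumes "0 < k" "k < n" "F \<in> carrier_mat n k"
  shows "consec_prod n k F \<noteq> 0 \<longleftrightarrow> consec n k F"
  unfolding consec_prod_def consec_bracket[OF assms] by auto

text \<open>Abstracts from which of the two frames is meant, so that both factors can be treated together.\<close>

definition frame_map :: "nat \<Rightarrow> nat \<Rightarrow> nat \<Rightarrow> nat \<Rightarrow>
    (complex mat \<Rightarrow> complex \<Rightarrow> complex mat \<Rightarrow> complex \<Rightarrow> complex mat) \<Rightarrow> bool" where
  "frame_map n k1 k2 k H \<longleftrightarrow> 0 < k \<and> k < n \<and>
     (\<forall>A\<in>carrier_mat n k1. \<forall>B\<in>carrier_mat n k2. \<forall>s t. H A s B t \<in> carrier_mat n k) \<and>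
     (\<forall>F\<in>carrier_mat n k. \<exists>A\<in>carrier_mat n k1. \<exists>B\<in>carrier_mat n k2. \<forall>s t. H A s B t = F) \<and>
     (\<forall>i<n. \<forall>c<k. poly_fun n k1 k2 (\<lambda>A s B t. H A s B t $$ (i, c)))"

lemma frame_map_first:
  "0 < k1 \<Longrightarrow> k1 < n \<Longrightarrow> frame_map n k1 k2 k1 (\<lambda>A s B t. A)"
  unfolding frame_map_def by (auto intro: poly_fun.intros intro!: bexI[of _ "0\<^sub>m _ _"])

lemma frame_map_second:
  "0 < k2 \<Longrightarrow> k2 < n \<Longrightarrow> frame_map n k1 k2 k2 (\<lambda>A s B t. B)"
  unfolding frame_map_def by (auto intro: poly_fun.intros intro!: bexI[of _ "0\<^sub>m _ _"])

lemma frame_map_bracket_poly: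
  assumes H: "frame_map n k1 k2 k H" and j: "j < n" and i: "i < n"
  shows "poly_fun n k1 k2 (\<lambda>A s B t. bracket n k (H A s B t) i j)"
proof -
  have k: "0 < k" "k < n" using H by (auto simp: frame_map_def)
  show ?thesis unfolding bracket_def row_det_def
    by (rule poly_fun_det) (use H insert_row_less[OF k j i insert_pos_less[OF k(1)]] in \<open>auto simp: frame_map_def\<close>)
qed

lemma frame_map_consec_prod_poly:
  assumes H: "frame_map n k1 k2 k H"
  shows "poly_fun n k1 k2 (\<lambda>A s B t. consec_prod n k (H A s B t))"
  unfolding consec_prod_def
  by (intro poly_fun_prod frame_map_bracket_poly[OF H]) (use H in \<open>auto simp: frame_map_def end_row_less\<close>)

lemma generic_bracket:
  assumes H: "frame_map n k1 k2 k H" and j: "j < n" and i: "i < n" and out: "i + n * wrap i j \<le> j + (n - k)"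
  shows "generic n k1 k2 (\<lambda>A s B t. bracket n k (H A s B t) i j \<noteq> 0)"
proof -
  have k: "0 < k" "k < n" using H by (auto simp: frame_map_def)
  let ?F = "select_rows n k (insert_row n k j (insert_pos k i j) i)"
  obtain A' B' where AB: "A' \<in> carrier_mat n k1" "B' \<in> carrier_mat n k2" "\<And>s t. H A' s B' t = ?F"
    using H unfolding frame_map_def by (metis select_rows_carrier)
  have "bracket n k ?F i j = 1"
    unfolding bracket_def by (rule row_det_select_rows) (use bracket_rows[OF k j i out] in auto)
  then show ?thesis
    by (intro generic_nonzero[OF frame_map_bracket_poly[OF H j i] AB(1,2)]) (use AB(3) in auto)
qed

lemma generic_consec:
  assumes H: "frame_map n k1 k2 k H"
  shows "generic n k1 k2 (\<lambda>A s B t. consec n k (H A s B t))"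
proof -
  have k: "0 < k" "k < n" using H by (auto simp: frame_map_def)
  have "generic n k1 k2 (\<lambda>A s B t. \<forall>j\<in>{..<n}. bracket n k (H A s B t) (end_row n k j) j \<noteq> 0)"
    by (intro generic_all generic_bracket[OF H]) (use end_row_in_band[OF k] end_row_less[OF k] in auto)
  then show ?thesis
    by (rule generic_mono) (use consec_bracket[OF k] H in \<open>auto simp: frame_map_def\<close>)
qed

text \<open>The denominators in \<open>g\<close> are consecutive minors of the frame.\<close>

lemma localized_gmat:
  assumes H: "frame_map n k1 k2 k H" and t': "poly_fun n k1 k2 t'" and z: "poly_fun n k1 k2 z"
    and e: "poly_fun n k1 k2 e" and D: "\<And>A s B t. D A s B t = consec_prod n k (H A s B t) * e A s B t"
    and i: "i < n" and j: "j < n"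
  shows "localized n k1 k2 D (\<lambda>A s B t. ev (gmat n k (H A s B t) (t' A s B t)) (z A s B t) $$ (i, j))"
proof -
  have k: "0 < k" "k < n" using H by (auto simp: frame_map_def)
  define ee where "ee = (\<lambda>A s B t. (\<Prod>l\<in>{..<n} - {j}. bracket n k (H A s B t) (end_row n k l) l) * e A s B t)"
  have ee: "poly_fun n k1 k2 ee" unfolding ee_def
    by (intro poly_fun.mult poly_fun_prod frame_map_bracket_poly[OF H] e) (use end_row_less[OF k] in auto)
  have De: "D A s B t = bracket n k (H A s B t) (end_row n k j) j * ee A s B t" for A s B t
  proof -
    have "consec_prod n k (H A s B t) = bracket n k (H A s B t) (end_row n k j) j *
        (\<Prod>l\<in>{..<n} - {j}. bracket n k (H A s B t) (end_row n k l) l)"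
      unfolding consec_prod_def by (rule prod.remove) (use j in auto)
    then show ?thesis by (simp add: D ee_def)
  qed
  have r: "localized n k1 k2 D (\<lambda>A s B t. (if i + n * wrap i j \<le> j + (n - k) then bracket n k (H A s B t) i j else 0)
      / bracket n k (H A s B t) (end_row n k j) j)"
  proof (rule localized_divide[OF _ ee De])
    show "poly_fun n k1 k2 (\<lambda>A s B t. if i + n * wrap i j \<le> j + (n - k) then bracket n k (H A s B t) i j else 0)"
      using frame_map_bracket_poly[OF H j i] poly_fun.const[of n k1 k2 0]
      by (cases "i + n * wrap i j \<le> j + (n - k)") simp_all
  qed
  have "localized n k1 k2 D (\<lambda>A s B t. (if i + n * wrap i j \<le> j + (n - k) then bracket n k (H A s B t) i j else 0)
      / bracket n k (H A s B t) (end_row n k j) j *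
      ((if k \<le> j \<and> j \<le> i then t' A s B t else 1) * z A s B t ^ wrap i j))"
  proof (intro localized_mult[OF r] localized_poly poly_fun.mult poly_fun_power z)
    show "poly_fun n k1 k2 (\<lambda>A s B t. if k \<le> j \<and> j \<le> i then t' A s B t else 1)"
    proof (cases "k \<le> j \<and> j \<le> i")
      case True
      then show ?thesis using t' by simp
    next
      case False
      show ?thesis unfolding if_not_P[OF False] by (rule poly_fun.const)
    qed
  qed
  then show ?thesis
  proof (rule localized_cong)
    fix A B :: "complex mat" and s t :: complex
    assume "A \<in> carrier_mat n k1" "B \<in> carrier_mat n k2"
    then have F: "H A s B t \<in> carrier_mat n k" using H by (auto simp: frame_map_def)
    show "ev (gmat n k (H A s B t) (t' A s B t)) (z A s B t) $$ (i, j) =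
      (if i + n * wrap i j \<le> j + (n - k) then bracket n k (H A s B t) i j else 0)
      / bracket n k (H A s B t) (end_row n k j) j *
      ((if k \<le> j \<and> j \<le> i then t' A s B t else 1) * z A s B t ^ wrap i j)"
      using gmat_entry[OF k j i F] ratio_bracket[OF k j i F] i j
        carrier_matD[OF gmat_carrier[of n k "H A s B t" "t' A s B t"]]
      by (simp add: poly_monom g_entry_def)
  qed
qed

section \<open>Genericity of the non-degeneracy conditions\<close>

definition g_numerator :: "nat \<Rightarrow> nat \<Rightarrow> complex mat \<Rightarrow> complex \<Rightarrow> nat \<Rightarrow> nat \<Rightarrow> complex" where
  "g_numerator n k F t i j = bracket n k F i j * (if k \<le> j \<and> j \<le> i then t else 1)"

lemma loop_coeff_g_numerator:
  assumes k: "0 < k" "k < n" and j: "j < n" and i: "i < n" and F: "F \<in> carrier_mat n k"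
    and out: "i + n * wrap i j \<le> j + (n - k)"
  shows "loop_coeff (gmat n k F t) i j = g_numerator n k F t i j / bracket n k F (end_row n k j) j"
  unfolding loop_coeff_gmat[OF k j i F] g_entry_def ratio_bracket[OF k j i F] g_numerator_def using out by simp

lemma g_numerator_poly:
  assumes H: "frame_map n k1 k2 k H" and t: "poly_fun n k1 k2 t'" and j: "j < n" and i: "i < n"
  shows "poly_fun n k1 k2 (\<lambda>A s B t. g_numerator n k (H A s B t) (t' A s B t) i j)"
proof (cases "k \<le> j \<and> j \<le> i")
  case True
  then show ?thesis unfolding g_numerator_def if_P[OF True]
    by (intro poly_fun.mult frame_map_bracket_poly[OF H j i] t)
next
  case False
  show ?thesis unfolding g_numerator_def if_not_P[OF False]
    by (intro poly_fun.mult frame_map_bracket_poly[OF H j i] poly_fun.const)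
qed

lemma below_diag_in_band:
  assumes "0 < k" "k < n" "i < n"
  shows "i + n * wrap i (prev n i) \<le> prev n i + (n - k)"
  using assms by (cases "i = 0") (auto simp: prev_def wrap_def)

lemma diag_in_band: "j + n * wrap j j \<le> j + (n - k)"
  by (simp add: wrap_def)

text \<open>After clearing denominators the condition concerns a polynomial in the minors of both frames. At a
coordinate subspace \<open>B\<close> the minor in \<open>\<phi>\<^sub>i\<close> vanishes while the other minor of \<open>B\<close> that occurs is \<open>1\<close>,
so that only the term from \<open>\<epsilon>\<^sub>i\<close> remains. Such a \<open>B\<close> may lie outside of the domain of \<open>g\<close>; for the
polynomial this does not matter.\<close>

lemma generic_eps_plus_phi:
  assumes k1: "0 < k1" "k1 < n" and k2: "0 < k2" "k2 < n" and i: "i < n"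
  shows "generic n k1 k2 (\<lambda>A s B t. s \<noteq> 0 \<longrightarrow> t \<noteq> 0 \<longrightarrow> consec n k1 A \<longrightarrow> consec n k2 B \<longrightarrow>
    loop_coeff (gmat n k1 A s) i (prev n i) / loop_coeff (gmat n k1 A s) i i +
    a * (loop_coeff (gmat n k2 B t) i (prev n i) / loop_coeff (gmat n k2 B t) (prev n i) (prev n i)) \<noteq> 0)"
proof -
  let ?p = "prev n i"
  note p = prev_less[OF i]
  note H1 = frame_map_first[OF k1, of k2] and H2 = frame_map_second[OF k2, of k1]
  define f where "f = (\<lambda>A s B t.
    g_numerator n k1 A s i ?p * bracket n k1 A (end_row n k1 i) i * g_numerator n k2 B t ?p ?p +
    a * (g_numerator n k2 B t i ?p * bracket n k1 A (end_row n k1 ?p) ?p * g_numerator n k1 A s i i))"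
  have poly: "poly_fun n k1 k2 f" unfolding f_def
    by (intro poly_fun.add poly_fun.mult poly_fun.const g_numerator_poly[OF H1] g_numerator_poly[OF H2]
        frame_map_bracket_poly[OF H1] poly_fun.coord_s poly_fun.coord_t i p end_row_less[OF k1])
  obtain A :: "complex mat" where A: "A \<in> carrier_mat n k1" "bracket n k1 A i ?p \<noteq> 0" "bracket n k1 A (end_row n k1 i) i \<noteq> 0"
    by (rule generic_witness[OF generic_conj[OF
          generic_bracket[OF H1 p i below_diag_in_band[OF k1 i]]
          generic_bracket[OF H1 i end_row_less[OF k1 i] end_row_in_band[OF k1 i]]]]) blast
  define r where "r = insert_row n k2 ?p (insert_pos k2 ?p ?p) ?p"
  define B where "B = select_rows n k2 r"
  note br = bracket_rows[OF k2 p p diag_in_band]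
  have B1: "bracket n k2 B ?p ?p = 1"
    unfolding bracket_def B_def r_def by (rule row_det_select_rows) (use br in auto)
  have B0: "bracket n k2 B i ?p = 0"
    unfolding bracket_def B_def
  proof (rule row_det_select_rows_zero[where b = "insert_pos k2 i ?p"])
    have "i \<noteq> ?p" using prev_neq[of n i] k1 i by simp
    then show "insert_row n k2 ?p (insert_pos k2 i ?p) i (insert_pos k2 i ?p) \<notin> r ` {..<k2}"
      unfolding r_def br(3) using below_diag_in_band[OF k2 i] by (simp add: insert_row_def)
  qed (use insert_pos_less[OF k2(1)] i in \<open>auto simp: insert_row_def\<close>)
  have "f A 1 B 1 \<noteq> 0" using A B0 B1 by (simp add: f_def g_numerator_def)
  then have "generic n k1 k2 (\<lambda>A s B t. f A s B t \<noteq> 0)"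
    by (intro generic_nonzero[OF poly A(1), of B]) (auto simp: B_def)
  then show ?thesis
  proof (rule generic_mono, intro impI)
    fix A B :: "complex mat" and s t :: complex
    assume A: "A \<in> carrier_mat n k1" and B: "B \<in> carrier_mat n k2" and f: "f A s B t \<noteq> 0"
      and s: "s \<noteq> 0" and t: "t \<noteq> 0" and cA: "consec n k1 A" and cB: "consec n k2 B"
    define x where "x = bracket n k1 A (end_row n k1 ?p) ?p"
    define y where "y = bracket n k1 A (end_row n k1 i) i"
    define w where "w = bracket n k2 B (end_row n k2 ?p) ?p"
    have nz: "x \<noteq> 0" "y \<noteq> 0" "w \<noteq> 0"
      using cA cB i p unfolding x_def y_def w_def consec_bracket[OF k1 A] consec_bracket[OF k2 B] by blast+
    note lA = loop_coeff_g_numerator[OF k1 _ _ A, of _ _ s] and lB = loop_coeff_g_numerator[OF k2 _ _ B, of _ _ t]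
    have 1: "loop_coeff (gmat n k1 A s) i ?p = g_numerator n k1 A s i ?p / x"
      unfolding x_def by (rule lA[OF p i below_diag_in_band[OF k1 i]])
    have 2: "loop_coeff (gmat n k1 A s) i i = g_numerator n k1 A s i i / y"
      unfolding y_def by (rule lA[OF i i diag_in_band])
    have 3: "loop_coeff (gmat n k2 B t) i ?p = g_numerator n k2 B t i ?p / w"
      unfolding w_def by (rule lB[OF p i below_diag_in_band[OF k2 i]])
    have 4: "loop_coeff (gmat n k2 B t) ?p ?p = g_numerator n k2 B t ?p ?p / w"
      unfolding w_def by (rule lB[OF p p diag_in_band])
    have "loop_coeff (gmat n k1 A s) i i \<noteq> 0"
      by (rule loop_coeff_band(3)[OF gmat_banded[OF k1 A cA s] i i refl])
    then have d1: "g_numerator n k1 A s i i \<noteq> 0" using 2 by auto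
    have "loop_coeff (gmat n k2 B t) ?p ?p \<noteq> 0"
      by (rule loop_coeff_band(3)[OF gmat_banded[OF k2 B cB t] p p refl])
    then have d2: "g_numerator n k2 B t ?p ?p \<noteq> 0" using 4 by auto
    have "(g_numerator n k1 A s i ?p / x / (g_numerator n k1 A s i i / y) +
        a * (g_numerator n k2 B t i ?p / w / (g_numerator n k2 B t ?p ?p / w))) *
        (x * g_numerator n k1 A s i i * g_numerator n k2 B t ?p ?p) = f A s B t"
      unfolding f_def x_def[symmetric] y_def[symmetric] using nz d1 d2 by (simp add: field_simps)
    then show "loop_coeff (gmat n k1 A s) i ?p / loop_coeff (gmat n k1 A s) i i +
        a * (loop_coeff (gmat n k2 B t) i ?p / loop_coeff (gmat n k2 B t) ?p ?p) \<noteq> 0"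
      unfolding 1 2 3 4 using f by auto
  qed
qed

lemma spectral_poly:
  "poly_fun n k1 k2 (\<lambda>A s B t. (- 1) ^ (k - 1) * t)" "poly_fun n k1 k2 (\<lambda>A s B t. (- 1) ^ (k - 1) * s)"
  by (intro poly_fun.mult poly_fun.const poly_fun.coord_s poly_fun.coord_t)+

text \<open>The frame of \<open>v'\<close> is \<open>g(u)\<close> at the spectral value of \<open>v\<close>, applied to the frame \<open>B\<close>. For
\<open>t = 0\<close> and \<open>s = 1\<close> this is an invertible triangular matrix, so \<open>B\<close> can be chosen such that the
result is any prescribed coordinate frame.\<close>

lemma generic_image_consec:
  assumes k1: "0 < k1" "k1 < n" and k2: "0 < k2" "k2 < n"
  shows "generic n k1 k2 (\<lambda>A s B t. consec n k2 (ev (gmat n k1 A s) ((- 1) ^ (k2 - 1) * t) * B))"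
proof -
  note H1 = frame_map_first[OF k1, of k2]
  let ?T = "\<lambda>A s B t. ev (gmat n k1 A s) ((- 1) ^ (k2 - 1) * t) * B"
  let ?D = "\<lambda>(A :: complex mat) (s :: complex) (B :: complex mat) (t :: complex). consec_prod n k1 A"
  obtain A0 :: "complex mat" where A0: "A0 \<in> carrier_mat n k1" "consec n k1 A0"
    by (rule generic_witness[OF generic_consec[OF H1]]) blast
  have E0: "ev (gmat n k1 A0 1) 0 \<in> carrier_mat n n" by simp
  obtain Li where Li: "Li \<in> carrier_mat n n" "ev (gmat n k1 A0 1) 0 * Li = 1\<^sub>m n"
    using inverse_of_det[OF E0 banded_det_ev0[OF gmat_banded[OF k1 A0 one_neq_zero]]] k1 by auto
  have "generic n k1 k2 (\<lambda>A s B t. \<forall>j\<in>{..<n}. bracket n k2 (?T A s B t) (end_row n k2 j) j \<noteq> 0)"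
  proof (rule generic_all)
    fix j assume "j \<in> {..<n}"
    then have j: "j < n" by simp
    let ?r = "insert_row n k2 j (insert_pos k2 (end_row n k2 j) j) (end_row n k2 j)"
    note br = bracket_rows[OF k2 j end_row_less[OF k2 j] end_row_in_band[OF k2 j]]
    have "localized n k1 k2 ?D (\<lambda>A s B t. det (mat k2 k2 (\<lambda>(a, c).
        \<Sum>m\<in>{0..<n}. ev (gmat n k1 A s) ((- 1) ^ (k2 - 1) * t) $$ (?r a, m) * B $$ (m, c))))"
      by (intro localized_det localized_sum localized_mult frame_map_consec_prod_poly[OF H1] localized_poly[OF poly_fun.coord_B]
          localized_gmat[OF H1 poly_fun.coord_s spectral_poly(1) poly_fun.const[of n k1 k2 1]])
        (use br in auto)
    then have "localized n k1 k2 ?D (\<lambda>A s B t. bracket n k2 (?T A s B t) (end_row n k2 j) j)"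
    proof (rule localized_cong)
      fix A B :: "complex mat" and s t :: complex
    assume A: "A \<in> carrier_mat n k1" and B: "B \<in> carrier_mat n k2"
      have "(?T A s B t) $$ (?r a, c) =
          (\<Sum>m\<in>{0..<n}. ev (gmat n k1 A s) ((- 1) ^ (k2 - 1) * t) $$ (?r a, m) * B $$ (m, c))"
        if "a < k2" "c < k2" for a c
        using B br(2)[OF that(1)] that(2) by (simp add: scalar_prod_def gmat_def)
      then show "bracket n k2 (?T A s B t) (end_row n k2 j) j = det (mat k2 k2 (\<lambda>(a, c).
        \<Sum>m\<in>{0..<n}. ev (gmat n k1 A s) ((- 1) ^ (k2 - 1) * t) $$ (?r a, m) * B $$ (m, c)))"
        unfolding bracket_def row_det_def by (intro arg_cong[of _ _ det] eq_matI) auto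
    qed
    moreover have "?T A0 1 (Li * select_rows n k2 ?r) 0 = select_rows n k2 ?r"
      using assoc_mult_mat[OF E0 Li(1) select_rows_carrier[of n k2 ?r]] Li(2)
        left_mult_one_mat[OF select_rows_carrier[of n k2 ?r]] by simp
    moreover have "bracket n k2 (select_rows n k2 ?r) (end_row n k2 j) j \<noteq> 0"
      unfolding bracket_def using row_det_select_rows[OF br(1,2)] by simp
    ultimately show "generic n k1 k2 (\<lambda>A s B t. bracket n k2 (?T A s B t) (end_row n k2 j) j \<noteq> 0)"
      by (intro generic_localized[OF frame_map_consec_prod_poly[OF H1], of _ A0 "Li * select_rows n k2 ?r" 1 0])
        (use A0 consec_prod_nonzero[OF k1 A0(1)] Li in auto)
  qed simp
  then show ?thesis
  proof (rule generic_mono)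
    fix A B :: "complex mat" and s t :: complex
    assume "B \<in> carrier_mat n k2"
      "\<forall>j\<in>{..<n}. bracket n k2 (?T A s B t) (end_row n k2 j) j \<noteq> 0"
    moreover from this(1) have "?T A s B t \<in> carrier_mat n k2"
      by (intro mult_carrier_mat[of _ n n]) simp_all
    ultimately show "consec n k2 (?T A s B t)" using consec_bracket[OF k2] by blast
  qed
qed

lemma localized_bottom_minor:
  assumes k1: "0 < k1" "k1 < n" and k2: "0 < k2" "k2 < n" and k: "k \<le> n" and z: "poly_fun n k1 k2 z"
  shows "localized n k1 k2 (\<lambda>A s B t. consec_prod n k1 A * consec_prod n k2 B)
    (\<lambda>A s B t. row_det k (ev (gmat n k1 A s * gmat n k2 B t) (z A s B t)) (\<lambda>a. n - k + a))"
proof -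
  note H1 = frame_map_first[OF k1, of k2] and H2 = frame_map_second[OF k2, of k1]
  have D: "poly_fun n k1 k2 (\<lambda>A s B t. consec_prod n k1 A * consec_prod n k2 B)"
    by (rule poly_fun.mult[OF frame_map_consec_prod_poly[OF H1] frame_map_consec_prod_poly[OF H2]])
  have "localized n k1 k2 (\<lambda>A s B t. consec_prod n k1 A * consec_prod n k2 B) (\<lambda>A s B t. det (mat k k (\<lambda>(a, c).
      \<Sum>m\<in>{0..<n}. ev (gmat n k1 A s) (z A s B t) $$ (n - k + a, m) *
        ev (gmat n k2 B t) (z A s B t) $$ (m, c))))"
    by (intro localized_det localized_sum localized_mult D
        localized_gmat[OF H1 poly_fun.coord_s z frame_map_consec_prod_poly[OF H2]]
        localized_gmat[OF H2 poly_fun.coord_t z frame_map_consec_prod_poly[OF H1]])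
      (use k in auto)
  then show ?thesis
  proof (rule localized_cong)
    fix A B :: "complex mat" and s t :: complex
    have "ev (gmat n k1 A s * gmat n k2 B t) (z A s B t) $$ (n - k + a, c) =
        (\<Sum>m\<in>{0..<n}. ev (gmat n k1 A s) (z A s B t) $$ (n - k + a, m) *
          ev (gmat n k2 B t) (z A s B t) $$ (m, c))" if "a < k" "c < k" for a c
      unfolding ev_mult[OF gmat_carrier gmat_carrier]
      using that k by (simp add: scalar_prod_def gmat_def)
    then show "row_det k (ev (gmat n k1 A s * gmat n k2 B t) (z A s B t)) (\<lambda>a. n - k + a) =
        det (mat k k (\<lambda>(a, c). \<Sum>m\<in>{0..<n}. ev (gmat n k1 A s) (z A s B t) $$ (n - k + a, m) *
          ev (gmat n k2 B t) (z A s B t) $$ (m, c)))"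
      unfolding row_det_def by (intro arg_cong[of _ _ det] eq_matI) auto
  qed
qed

text \<open>For \<open>s = 0\<close> and \<open>t = 1\<close> everything is evaluated at \<open>\<lambda> = 0\<close>. The factor \<open>g(v)\<close> becomes
invertible lower triangular. In the last \<open>k1\<close> rows of \<open>g(u)\<close> only the first \<open>k1\<close> columns survive,
where the block is upper unitriangular. The minor is then a product of diagonal entries.\<close>

lemma generic_bottom_minor:
  assumes k1: "0 < k1" "k1 < n" and k2: "0 < k2" "k2 < n"
  shows "generic n k1 k2 (\<lambda>A s B t.
    row_det k1 (ev (gmat n k1 A s * gmat n k2 B t) ((- 1) ^ (k1 - 1) * s)) (\<lambda>a. n - k1 + a) \<noteq> 0)"
proof -
  note H1 = frame_map_first[OF k1, of k2] and H2 = frame_map_second[OF k2, of k1]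
  have kn: "k1 \<le> n" and nk: "n - k1 < n" "n - k2 < n" using k1 k2 by auto
  obtain A :: "complex mat" where A: "A \<in> carrier_mat n k1" "consec n k1 A"
    by (rule generic_witness[OF generic_consec[OF H1]]) blast
  obtain B :: "complex mat" where B: "B \<in> carrier_mat n k2" "consec n k2 B"
    by (rule generic_witness[OF generic_consec[OF H2]]) blast
  let ?G = "gmat n k1 A 0" and ?K = "gmat n k2 B 1"
  have one: "(1 :: complex) \<noteq> 0" by simp
  note G1 = gmat_banded[OF k1 A one] and K1 = gmat_banded[OF k2 B one]
  define U where "U = mat k1 k1 (\<lambda>(a, c). ev (gmat n k1 A 1) 0 $$ (n - k1 + a, c))"
  define V where "V = mat k1 k1 (\<lambda>(a, c). ev ?K 0 $$ (a, c))"
  have low: "ev ?G 0 $$ (n - k1 + a, m) = (if m < k1 then ev (gmat n k1 A 1) 0 $$ (n - k1 + a, m) else 0)"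
    if "a < k1" "m < n" for a m
    using gmat_entry[OF k1 that(2) _ A(1), of "n - k1 + a"] that k1
    by (auto simp: poly_monom g_entry_def wrap_def gmat_def[of n k1 A, THEN arg_cong[of _ _ dim_row]]
        gmat_def[of n k1 A, THEN arg_cong[of _ _ dim_col]])
  have "mat k1 k1 (\<lambda>(a, c). ev (?G * ?K) 0 $$ (n - k1 + a, c)) = U * V"
  proof (rule eq_matI)
    fix a c assume "a < dim_row (U * V)" "c < dim_col (U * V)"
    then have ac: "a < k1" "c < k1" by (auto simp: U_def V_def)
    have "ev (?G * ?K) 0 $$ (n - k1 + a, c) = (\<Sum>m\<in>{0..<n}. ev ?G 0 $$ (n - k1 + a, m) * ev ?K 0 $$ (m, c))"
      unfolding ev_mult[OF gmat_carrier gmat_carrier]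
      using ac k1 by (simp add: scalar_prod_def gmat_def)
    also have "\<dots> = (\<Sum>m\<in>{0..<k1}. ev ?G 0 $$ (n - k1 + a, m) * ev ?K 0 $$ (m, c))"
      by (rule sum.mono_neutral_right) (use k1 low[OF ac(1)] in auto)
    also have "\<dots> = (U * V) $$ (a, c)"
      using ac low[OF ac(1)] k1 by (auto simp: scalar_prod_def U_def V_def intro!: sum.cong)
    finally show "mat k1 k1 (\<lambda>(a, c). ev (?G * ?K) 0 $$ (n - k1 + a, c)) $$ (a, c) = (U * V) $$ (a, c)"
      using ac by simp
  qed (auto simp: U_def V_def)
  then have "row_det k1 (ev (?G * ?K) 0) (\<lambda>a. n - k1 + a) = det U * det V"
    unfolding row_det_def using det_mult[of U k1 V] by (simp add: U_def V_def)
  also have "det U = 1" using banded_bottom_minor[OF G1 k1, of 0] by (simp add: row_det_def U_def)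
  also have "det V = prod_list (diag_mat V)"
    by (rule det_lower_triangular[of k1])
      (use banded_ev[OF K1 nk(2), of _ _ 0] k1 in \<open>auto simp: V_def wrap_def\<close>)
  finally have "row_det k1 (ev (?G * ?K) 0) (\<lambda>a. n - k1 + a) = prod_list (diag_mat V)" by simp
  moreover have "prod_list (diag_mat V) \<noteq> 0"
  proof -
    have "ev ?K 0 $$ (j, j) \<noteq> 0" if "j < k1" for j
      using banded_ev[OF K1 nk(2), of j j 0] loop_coeff_band(3)[OF K1, of j j] that k1 by (simp add: wrap_def)
    then show ?thesis by (auto simp: diag_mat_def prod_list_zero_iff V_def)
  qed
  ultimately have "row_det k1 (ev (gmat n k1 A 0 * gmat n k2 B 1) ((- 1) ^ (k1 - 1) * 0)) (\<lambda>a. n - k1 + a) \<noteq> 0"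
    by simp
  then show ?thesis
    by (intro generic_localized[OF _ localized_bottom_minor[OF k1 k2 kn spectral_poly(2)] A(1) B(1), where s = 0 and t = 1]
        poly_fun.mult[OF frame_map_consec_prod_poly[OF H1] frame_map_consec_prod_poly[OF H2]])
      (use consec_prod_nonzero[OF k1 A(1)] consec_prod_nonzero[OF k2 B(1)] A B in auto)
qed

lemma generic_spectral:
  "generic n k1 k2 (\<lambda>A s B t. s \<noteq> 0)" "generic n k1 k2 (\<lambda>A s B t. t \<noteq> 0)"
  "generic n k1 k2 (\<lambda>A s B t. (- 1) ^ (k1 - 1) * s \<noteq> (- 1) ^ (k2 - 1) * t)"
proof -
  show "generic n k1 k2 (\<lambda>A s B t. s \<noteq> 0)" "generic n k1 k2 (\<lambda>A s B t. t \<noteq> 0)"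
    by (rule generic_nonzero[of _ _ _ _ "0\<^sub>m n k1" "0\<^sub>m n k2" 1 1]; simp add: poly_fun.intros)+
  have "generic n k1 k2 (\<lambda>A s B t. (- 1) ^ (k1 - 1) * s + (- 1) * ((- 1) ^ (k2 - 1) * t) \<noteq> 0)"
    by (rule generic_nonzero[of _ _ _ _ "0\<^sub>m n k1" "0\<^sub>m n k2" 1 0],
        intro poly_fun.add poly_fun.mult poly_fun.const poly_fun.coord_s poly_fun.coord_t) auto
  then show "generic n k1 k2 (\<lambda>A s B t. (- 1) ^ (k1 - 1) * s \<noteq> (- 1) ^ (k2 - 1) * t)"
    by (rule generic_mono) auto
qed

lemma rational_eqI:
  assumes "generic n k1 k2 P"
    and "\<And>M s N t A B. frame n k1 A M \<Longrightarrow> frame n k2 B N \<Longrightarrow> s \<noteq> 0 \<Longrightarrow> t \<noteq> 0 \<Longrightarrow> P A s B t \<Longrightarrow>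
      \<exists>h. F ((M, s), (N, t)) = Some h \<and> G ((M, s), (N, t)) = Some h"
  shows "rational_eq n k1 k2 F G"
  using assms unfolding rational_eq_def generic_def X_space_def frame_def
  by (auto; blast)

section \<open>The coenergy property\<close>

lemma g_value_of_frame:
  assumes "frame n k F N" "consec n k F" "t \<noteq> 0"
  shows "g_value n k (N, t) (gmat n k F t)"
  using assms by (auto simp: g_value_def)

text \<open>Two factorizations of the same matrix share these three numbers, which relate the values of
\<open>\<epsilon>\<^sub>0\<close> and \<open>\<phi>\<^sub>0\<close> on their factors.\<close>

lemma band_product_corner:
  assumes L: "banded n d1 L" and M: "banded n d2 M" and d: "d1 < n" "d2 < n" and n: "1 < n"
  shows "coeff ((L * M) $$ (0, 0)) 0 = loop_coeff L 0 0 * loop_coeff M 0 0"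
    and "coeff ((L * M) $$ (n - 1, n - 1)) 0 =
      loop_coeff L (n - 1) (n - 1) * loop_coeff M (n - 1) (n - 1)"
    and "coeff ((L * M) $$ (0, n - 1)) 1 =
      loop_coeff L 0 0 * loop_coeff M 0 (n - 1) + loop_coeff L 0 (n - 1) * loop_coeff M (n - 1) (n - 1)"
proof -
  note Lc = bandedD(1)[OF L] and Mc = bandedD(1)[OF M]
  have n0: "0 < n" "n - 1 < n" using n by auto
  have diag: "coeff ((L * M) $$ (j, j)) 0 = loop_coeff L j j * loop_coeff M j j" if "j < n" for j
    using banded_mult_bottom_coeff[OF L Mc that, of j 0] bandedD(2)[OF M _ that] that
    by (simp add: loop_coeff_def wrap_def)
  show "coeff ((L * M) $$ (0, 0)) 0 = loop_coeff L 0 0 * loop_coeff M 0 0"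
    "coeff ((L * M) $$ (n - 1, n - 1)) 0 = loop_coeff L (n - 1) (n - 1) * loop_coeff M (n - 1) (n - 1)"
    using diag n0 by blast+
  have "coeff ((L * M) $$ (0, n - 1)) 1 =
      (\<Sum>(m, q)\<in>{(0, 0), (n - 1, 1)}. coeff (L $$ (0, m)) q * coeff (M $$ (m, n - 1)) (1 - q))"
    unfolding coeff_mat_mult[OF Lc Mc n0]
  proof (rule sum.mono_neutral_right)
    show "\<forall>x\<in>{..<n} \<times> {..1} - {(0, 0), (n - 1, 1)}.
        (case x of (m, q) \<Rightarrow> coeff (L $$ (0, m)) q * coeff (M $$ (m, n - 1)) (1 - q)) = 0"
    proof (rule ballI, rule ccontr)
      fix x assume x: "x \<in> {..<n} \<times> {..1} - {(0, 0), (n - 1, 1)}"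
        and nz: "(case x of (m, q) \<Rightarrow> coeff (L $$ (0, m)) q * coeff (M $$ (m, n - 1)) (1 - q)) \<noteq> 0"
      obtain m q where [simp]: "x = (m, q)" by force
      have m: "m < n" and q: "q = 0 \<or> q = 1" using x by auto
      have "m \<le> n * q" "n - 1 \<le> m + n * (1 - q)"
        using bandedD(2)[OF L n0(1) m, of q] bandedD(2)[OF M m n0(2), of "1 - q"] nz by auto
      then show False using q x m by auto
    qed
  qed (use n in auto)
  also have "\<dots> = loop_coeff L 0 0 * loop_coeff M 0 (n - 1) + loop_coeff L 0 (n - 1) * loop_coeff M (n - 1) (n - 1)"
    using n by (simp add: loop_coeff_def wrap_def)
  finally show "coeff ((L * M) $$ (0, n - 1)) 1 =
      loop_coeff L 0 0 * loop_coeff M 0 (n - 1) + loop_coeff L 0 (n - 1) * loop_coeff M (n - 1) (n - 1)" .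
qed

lemma E_map_rational:
  assumes k1: "0 < k1" "k1 < n" and k2: "0 < k2" "k2 < n"
  shows "rational_function n k1 k2 (E_map n k1 k2)"
proof -
  note H1 = frame_map_first[OF k1, of k2] and H2 = frame_map_second[OF k2, of k1]
  define k where "k = min k1 k2"
  have kn: "k \<le> n" using k1 by (simp add: k_def)
  let ?D = "\<lambda>(A :: complex mat) (s :: complex) (B :: complex mat) (t :: complex). consec_prod n k1 A * consec_prod n k2 B"
  have D: "poly_fun n k1 k2 ?D"
    by (rule poly_fun.mult[OF frame_map_consec_prod_poly[OF H1] frame_map_consec_prod_poly[OF H2]])
  obtain p m where p: "poly_fun n k1 k2 p" and
    pe: "\<And>A s B t. A \<in> carrier_mat n k1 \<Longrightarrow> B \<in> carrier_mat n k2 \<Longrightarrow> ?D A s B t \<noteq> 0 \<Longrightarrow>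
      row_det k (ev (gmat n k1 A s * gmat n k2 B t) 0) (\<lambda>a. n - k + a) * ?D A s B t ^ m = p A s B t"
    using localized_bottom_minor[OF k1 k2 kn poly_fun.const[of n k1 k2 0]] unfolding localized_def by blast
  obtain A :: "complex mat" where A: "A \<in> carrier_mat n k1" "consec n k1 A"
    by (rule generic_witness[OF generic_consec[OF H1]]) blast
  obtain B :: "complex mat" where B: "B \<in> carrier_mat n k2" "consec n k2 B"
    by (rule generic_witness[OF generic_consec[OF H2]]) blast
  have "consec_prod n k1 A \<noteq> 0" "consec_prod n k2 B \<noteq> 0"
    using A B consec_prod_nonzero[OF k1 A(1)] consec_prod_nonzero[OF k2 B(1)] by auto
  then have nz: "nonzero_poly_fun n k1 k2 (\<lambda>A s B t. ?D A s B t ^ Suc m)"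
    unfolding nonzero_poly_fun_def using poly_fun_power[OF D, of "Suc m"] A(1) B(1) by auto
  show ?thesis unfolding rational_function_def
  proof (intro exI[of _ "\<lambda>A s B t. p A s B t * ?D A s B t"] exI[of _ "\<lambda>A s B t. ?D A s B t ^ Suc m"]
      conjI poly_fun.mult p D nz, clarify)
    fix M s N t A B
    assume ST: "(M, s) \<in> X_space n k1" "(N, t) \<in> X_space n k2"
      and fr: "frame n k1 A M" "frame n k2 B N" and q: "?D A s B t ^ Suc m \<noteq> 0"
    have c: "A \<in> carrier_mat n k1" "B \<in> carrier_mat n k2" using fr by (auto simp: frame_def)
    have d: "?D A s B t \<noteq> 0" using q by auto
    have ch: "g_value n k1 (M, s) (gmat n k1 A s)" "g_value n k2 (N, t) (gmat n k2 B t)"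
      using ST fr d consec_prod_nonzero[OF k1 c(1)] consec_prod_nonzero[OF k2 c(2)]
      by (auto intro!: g_value_of_frame simp: X_space_def)
    show "E_map n k1 k2 ((M, s), (N, t)) = Some (p A s B t * ?D A s B t / ?D A s B t ^ Suc m)"
      unfolding E_map_eq_minor[OF ch k1 k2, of 0] k_def[symmetric] pe[OF c d, symmetric] using d by simp
  qed
qed

text \<open>The conditions under which \<open>e\<^sub>i\<^sup>c\<close> is defined on the pair. The values \<open>1\<close> and \<open>inverse c\<close> of
\<open>a\<close> correspond to the denominators of \<open>c\<^sub>1\<close> and \<open>c\<^sub>2\<close>.\<close>

definition crystal_regular :: "nat \<Rightarrow> nat \<Rightarrow> nat \<Rightarrow> nat \<Rightarrow> complex \<Rightarrow>
    complex mat \<Rightarrow> complex \<Rightarrow> complex mat \<Rightarrow> complex \<Rightarrow> bool" where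
  "crystal_regular n k1 k2 i c A s B t \<longleftrightarrow> consec n k1 A \<and> consec n k2 B \<and>
     bracket n k1 A i (prev n i) \<noteq> 0 \<and> bracket n k2 B i (prev n i) \<noteq> 0 \<and>
     (\<forall>a\<in>{1, inverse c}. s \<noteq> 0 \<longrightarrow> t \<noteq> 0 \<longrightarrow> consec n k1 A \<longrightarrow> consec n k2 B \<longrightarrow>
       loop_coeff (gmat n k1 A s) i (prev n i) / loop_coeff (gmat n k1 A s) i i +
       a * (loop_coeff (gmat n k2 B t) i (prev n i) / loop_coeff (gmat n k2 B t) (prev n i) (prev n i)) \<noteq> 0)"

lemma generic_crystal_regular:
  assumes k1: "0 < k1" "k1 < n" and k2: "0 < k2" "k2 < n" and i: "i < n"
  shows "generic n k1 k2 (crystal_regular n k1 k2 i c)"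
  unfolding crystal_regular_def
  by (intro generic_conj generic_all generic_consec[OF frame_map_first[OF k1]]
      generic_consec[OF frame_map_second[OF k2]]
      generic_bracket[OF frame_map_first[OF k1] prev_less[OF i] i below_diag_in_band[OF k1 i]]
      generic_bracket[OF frame_map_second[OF k2] prev_less[OF i] i below_diag_in_band[OF k2 i]]
      generic_eps_plus_phi[OF k1 k2 i]) auto

lemma loop_coeff_below_nonzero:
  assumes k: "0 < k" "k < n" and i: "i < n" and F: "F \<in> carrier_mat n k" and c: "consec n k F"
    and t: "t \<noteq> 0" and b: "bracket n k F i (prev n i) \<noteq> 0"
  shows "loop_coeff (gmat n k F t) i (prev n i) \<noteq> 0"
  using loop_coeff_g_numerator[OF k prev_less[OF i] i F below_diag_in_band[OF k i], of t] b t
    c[unfolded consec_bracket[OF k F]] prev_less[OF i] by (auto simp: g_numerator_def)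

lemma g_e_map2_regular:
  assumes k1: "0 < k1" "k1 < n" and k2: "0 < k2" "k2 < n" and i: "i < n" and c: "c \<noteq> 0"
    and fr: "frame n k1 F1 M" "frame n k2 F2 N" and st: "s \<noteq> 0" "t \<noteq> 0"
    and reg: "crystal_regular n k1 k2 i c F1 s F2 t"
    and A_def: "A = gmat n k1 F1 s" and B_def: "B = gmat n k2 F2 t" and p_def: "p = prev n i"
    and eu_def: "eu = loop_coeff A i p / loop_coeff A i i"
    and pv_def: "pv = loop_coeff B i p / loop_coeff B p p"
  shows "eu + pv \<noteq> 0"
    and "\<exists>u' v' A' B'. e_map2 n k1 k2 i c ((M, s), (N, t)) = Some (u', v') \<and>
      g_value n k1 u' A' \<and> g_value n k2 v' B' \<and> (\<forall>l. l \<noteq> 0 \<longrightarrow> ev (A' * B') l =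
        xhat n i ((c - 1) * eu / ((eu + pv) * (loop_coeff A i p / loop_coeff A p p))) l * ev (A * B) l *
        xhat n i ((1 / c - 1) * pv / ((eu + pv) * (loop_coeff B i p / loop_coeff B i i))) l)"
proof -
  have cons: "consec n k1 F1" "consec n k2 F2" and F: "F1 \<in> carrier_mat n k1" "F2 \<in> carrier_mat n k2"
    using reg fr by (auto simp: crystal_regular_def frame_def)
  have u: "g_value n k1 (M, s) A" and v: "g_value n k2 (N, t) B"
    unfolding A_def B_def by (rule g_value_of_frame[OF fr(1) cons(1) st(1)], rule g_value_of_frame[OF fr(2) cons(2) st(2)])
  have A: "banded n (n - k1) A" and B: "banded n (n - k2) B"
    using g_value_g_like[OF u k1] g_value_g_like[OF v k2] by (auto simp: g_like_def)
  have p: "p < n" unfolding p_def by (rule prev_less[OF i])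
  have Aip: "loop_coeff A i p \<noteq> 0" and Bip: "loop_coeff B i p \<noteq> 0"
    using loop_coeff_below_nonzero[OF k1 i F(1) cons(1) st(1)] loop_coeff_below_nonzero[OF k2 i F(2) cons(2) st(2)] reg
    by (auto simp: crystal_regular_def A_def B_def p_def)
  note d = loop_coeff_band(3)[OF A i i refl] loop_coeff_band(3)[OF A p p refl]
    loop_coeff_band(3)[OF B i i refl] loop_coeff_band(3)[OF B p p refl]
  have nz: "eu + a * pv \<noteq> 0" if "a \<in> {1, inverse c}" for a
    using reg st cons that unfolding crystal_regular_def eu_def pv_def A_def B_def p_def by blast
  show nz1: "eu + pv \<noteq> 0" using nz[of 1] by simp
  have nz2: "c * eu + pv \<noteq> 0"
  proof -
    have "c * (eu + inverse c * pv) = c * eu + pv" using c by (simp add: distrib_left mult.assoc[symmetric])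
    then show ?thesis using nz[of "inverse c"] c by (metis insertCI mult_eq_0_iff)
  qed
  note pe = phi_eps_g_value[OF u k1 i] phi_eps_g_value[OF v k2 i]
  show "\<exists>u' v' A' B'. e_map2 n k1 k2 i c ((M, s), (N, t)) = Some (u', v') \<and>
      g_value n k1 u' A' \<and> g_value n k2 v' B' \<and> (\<forall>l. l \<noteq> 0 \<longrightarrow> ev (A' * B') l =
        xhat n i ((c - 1) * eu / ((eu + pv) * (loop_coeff A i p / loop_coeff A p p))) l * ev (A * B) l *
        xhat n i ((1 / c - 1) * pv / ((eu + pv) * (loop_coeff B i p / loop_coeff B i i))) l)"
    by (rule g_e_map2[OF u v k1 k2 i c _ _ _ _ _ _ _ _ nz1 nz2])
      (use pe Aip Bip d in \<open>auto simp: eu_def pv_def p_def\<close>)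
qed

lemma E_map_e_invariant:
  assumes k1: "0 < k1" "k1 < n" and k2: "0 < k2" "k2 < n" and i: "0 < i" "i < n" and c: "c \<noteq> 0"
  shows "rational_eq n k1 k2 (\<lambda>x. do { y \<leftarrow> e_map2 n k1 k2 i c x; E_map n k1 k2 y }) (E_map n k1 k2)"
proof (rule rational_eqI[OF generic_crystal_regular[OF k1 k2 i(2), of c]])
  fix M s N t F1 F2
  assume fr: "frame n k1 F1 M" "frame n k2 F2 N" and st: "s \<noteq> 0" "t \<noteq> 0"
    and reg: "crystal_regular n k1 k2 i c F1 s F2 t"
  let ?k = "min k1 k2"
  have k: "0 < ?k" "?k < n" using k1 k2 by auto
  define A where "A = gmat n k1 F1 s"
  define B where "B = gmat n k2 F2 t"
  have u: "g_value n k1 (M, s) A" and v: "g_value n k2 (N, t) B"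
    using reg fr st by (auto simp: crystal_regular_def A_def B_def intro!: g_value_of_frame)
  obtain u' v' A' B' a b where e: "e_map2 n k1 k2 i c ((M, s), (N, t)) = Some (u', v')"
    and u': "g_value n k1 u' A'" and v': "g_value n k2 v' B'"
    and eq: "\<And>l. l \<noteq> 0 \<Longrightarrow> ev (A' * B') l = xhat n i a l * ev (A * B) l * xhat n i b l"
    using g_e_map2_regular(2)[OF k1 k2 i(2) c fr st reg A_def B_def refl refl refl] by blast
  have AB: "ev (A * B) 1 \<in> carrier_mat n n"
    unfolding A_def B_def ev_carrier by (rule mult_carrier_mat[OF gmat_carrier gmat_carrier])
  have "E_map n k1 k2 (u', v') = E_map n k1 k2 ((M, s), (N, t))"
    unfolding E_map_eq_minor[OF u' v' k1 k2, of 1] E_map_eq_minor[OF u v k1 k2, of 1]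
    using eq[of 1] bottom_minor_x_mat[OF AB k i] i by (simp add: xhat_def)
  then show "\<exists>h. (do { y \<leftarrow> e_map2 n k1 k2 i c ((M, s), (N, t)); E_map n k1 k2 y }) = Some h \<and>
      E_map n k1 k2 ((M, s), (N, t)) = Some h"
    using e E_map_eq_minor[OF u v k1 k2, of 1] by simp
qed

text \<open>Here \<open>a0, ap, an\<close> are the coefficients of \<open>g(u)\<close> in the positions \<open>(0, 0)\<close>, \<open>(0, n - 1)\<close> and
\<open>(n - 1, n - 1)\<close>, and \<open>b0, bp, bn\<close> those of \<open>g(v)\<close>; the primes denote \<open>g(v')\<close> and \<open>g(u')\<close>. The
common denominator of all terms is \<open>a0 bp + ap bn\<close>, the corner coefficient of the product,
which is the same for both factorizations. The first two identities serve the case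
\<open>k\<^sub>2 \<le> k\<^sub>1\<close>, the last two the case \<open>k\<^sub>1 < k\<^sub>2\<close>.\<close>

lemma coenergy_ratios:
  fixes a0 an b0 bn ap bp :: complex
  assumes nz: "a0 \<noteq> 0" "an \<noteq> 0" "b0 \<noteq> 0" "bn \<noteq> 0" "ap \<noteq> 0" "bp \<noteq> 0"
    and nz': "a0' \<noteq> 0" "an' \<noteq> 0" "b0' \<noteq> 0" "bn' \<noteq> 0"
    and e0: "a0' * b0' = a0 * b0" and en: "an' * bn' = an * bn"
    and e1: "a0' * bp' + ap' * bn' = a0 * bp + ap * bn"
    and sum: "ap / a0 + bp / bn \<noteq> 0" and c: "c \<noteq> 0"
  shows "1 + (1 / c - 1) * (bp / bn) / ((ap / a0 + bp / bn) * (bp / b0)) * (bp / b0) =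
      (ap / a0 + inverse c * (bp / bn)) / (ap / a0 + bp / bn)"
    and "1 + (c - 1) * (ap / a0) / ((ap / a0 + bp / bn) * (ap / an)) * (ap' / an') =
      (c * (ap' / a0') + bp' / bn') / (ap' / a0' + bp' / bn')"
    and "1 + (c - 1) * (ap / a0) / ((ap / a0 + bp / bn) * (ap / an)) * (ap / an) =
      c * ((ap / a0 + inverse c * (bp / bn)) / (ap / a0 + bp / bn))"
    and "1 + (1 / c - 1) * (bp / bn) / ((ap / a0 + bp / bn) * (bp / b0)) * (bp' / b0') =
      (c * (ap' / a0') + bp' / bn') / (ap' / a0' + bp' / bn') / c"
proof -
  define th where "th = a0 * bp + ap * bn"
  have s: "ap / a0 + bp / bn = th / (a0 * bn)" using nz by (simp add: th_def field_simps)
  have s': "ap' / a0' + bp' / bn' = th / (a0' * bn')"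
    unfolding th_def e1[symmetric] using nz' by (simp add: field_simps)
  have th: "th \<noteq> 0" using sum s by auto
  have l: "(c - 1) * (ap / a0) / ((ap / a0 + bp / bn) * (ap / an)) = (c - 1) * (an * bn) / th"
    unfolding s using nz th by (simp add: field_simps)
  have r: "(1 / c - 1) * (bp / bn) / ((ap / a0 + bp / bn) * (bp / b0)) = (1 / c - 1) * (a0 * b0) / th"
    unfolding s using nz th by (simp add: field_simps)
  have a: "(ap / a0 + inverse c * (bp / bn)) / (ap / a0 + bp / bn) = (ap * bn + a0 * bp / c) / th"
    unfolding s using nz th c by (simp add: field_simps)
  have b: "(c * (ap' / a0') + bp' / bn') / (ap' / a0' + bp' / bn') = (c * (ap' * bn') + a0' * bp') / th"
    unfolding s' using nz' th by (simp add: field_simps)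
  have e1': "th = a0' * bp' + ap' * bn'" using e1 by (simp add: th_def)
  have "1 + (1 / c - 1) * (a0 * b0) / th * (bp / b0) = (th + (1 / c - 1) * (a0 * bp)) / th"
    using nz th by (simp add: add_divide_distrib)
  also have "th + (1 / c - 1) * (a0 * bp) = ap * bn + a0 * bp / c" by (simp add: th_def algebra_simps)
  finally show "1 + (1 / c - 1) * (bp / bn) / ((ap / a0 + bp / bn) * (bp / b0)) * (bp / b0) =
      (ap / a0 + inverse c * (bp / bn)) / (ap / a0 + bp / bn)" unfolding r a .
  have "1 + (c - 1) * (an * bn) / th * (ap' / an') = (th + (c - 1) * (ap' * bn')) / th"
    unfolding en[symmetric] using nz' th by (simp add: add_divide_distrib mult_ac)
  also have "th + (c - 1) * (ap' * bn') = c * (ap' * bn') + a0' * bp'" by (simp add: e1' algebra_simps)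
  finally show "1 + (c - 1) * (ap / a0) / ((ap / a0 + bp / bn) * (ap / an)) * (ap' / an') =
      (c * (ap' / a0') + bp' / bn') / (ap' / a0' + bp' / bn')" unfolding l b .
  have "1 + (c - 1) * (an * bn) / th * (ap / an) = (th + (c - 1) * (ap * bn)) / th"
    using nz th by (simp add: add_divide_distrib mult_ac)
  also have "th + (c - 1) * (ap * bn) = c * (ap * bn + a0 * bp / c)" using c by (simp add: th_def algebra_simps)
  finally show "1 + (c - 1) * (ap / a0) / ((ap / a0 + bp / bn) * (ap / an)) * (ap / an) =
      c * ((ap / a0 + inverse c * (bp / bn)) / (ap / a0 + bp / bn))" unfolding l a by simp
  have "1 + (1 / c - 1) * (a0 * b0) / th * (bp' / b0') = (th + (1 / c - 1) * (a0' * bp')) / th"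
    unfolding e0[symmetric] using nz' th by (simp add: add_divide_distrib mult_ac)
  also have "th + (1 / c - 1) * (a0' * bp') = (c * (ap' * bn') + a0' * bp') / c"
    using c by (simp add: e1' algebra_simps add_divide_distrib)
  finally show "1 + (1 / c - 1) * (bp / bn) / ((ap / a0 + bp / bn) * (bp / b0)) * (bp' / b0') =
      (c * (ap' / a0') + bp' / bn') / (ap' / a0' + bp' / bn') / c" unfolding r b by simp
qed

text \<open>The minor is evaluated at the spectral value of the factor of smaller type. If \<open>k\<^sub>2 \<le> k\<^sub>1\<close>,
this factor is \<open>v\<close>, and \<open>A'\<close> and \<open>B\<close> both have rank \<open>k\<^sub>2\<close> there; otherwise it is \<open>u\<close>, and
\<open>A\<close> and \<open>B'\<close> have rank \<open>k\<^sub>1\<close>.\<close>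

lemma E_map_e0:
  assumes k1: "0 < k1" "k1 < n" and k2: "0 < k2" "k2 < n" and c: "c \<noteq> 0"
  shows "rational_eq n k1 k2
          (\<lambda>x. do { y \<leftarrow> e_map2 n k1 k2 0 c x; E_map n k1 k2 y })
          (\<lambda>(u, v). do {
             h \<leftarrow> E_map n k1 k2 (u, v);
             (v', u') \<leftarrow> R_map n k1 k2 (u, v);
             eu \<leftarrow> eps_map n k1 0 u;
             pv \<leftarrow> phi_map n k2 0 v;
             ev \<leftarrow> eps_map n k2 0 v';
             pu \<leftarrow> phi_map n k1 0 u';
             a \<leftarrow> pdiv (eu + inverse c * pv) (eu + pv);
             b \<leftarrow> pdiv (c * ev + pu) (ev + pu);
             Some (h * a * b) })" (is "rational_eq n k1 k2 ?F ?G")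
proof -
  have n: "1 < n" "0 < n" "n - 1 < n" using k1 by auto
  define P where "P = (\<lambda>A s B t. crystal_regular n k1 k2 0 c A s B t \<and>
    (- 1) ^ (k1 - 1) * s \<noteq> (- 1) ^ (k2 - 1) * t \<and>
    consec n k2 (ev (gmat n k1 A s) ((- 1) ^ (k2 - 1) * t) * B) \<and>
    row_det k1 (ev (gmat n k1 A s * gmat n k2 B t) ((- 1) ^ (k1 - 1) * s)) (\<lambda>a. n - k1 + a) \<noteq> 0)"
  have P: "generic n k1 k2 P" unfolding P_def
    by (intro generic_conj generic_crystal_regular[OF k1 k2 n(2)] generic_spectral generic_image_consec[OF k1 k2]
        generic_bottom_minor[OF k1 k2])
  show ?thesis
  proof (rule rational_eqI[OF P])
    fix M s N t F1 F2
    assume fr: "frame n k1 F1 M" "frame n k2 F2 N" and st: "s \<noteq> 0" "t \<noteq> 0" and PP: "P F1 s F2 t"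
    have reg: "crystal_regular n k1 k2 0 c F1 s F2 t" using PP by (simp add: P_def)
    define A where "A = gmat n k1 F1 s"
    define B where "B = gmat n k2 F2 t"
    have u: "g_value n k1 (M, s) A" and v: "g_value n k2 (N, t) B"
      using reg fr st by (auto simp: crystal_regular_def A_def B_def intro!: g_value_of_frame)
    obtain v' u' A' B' where R: "R_map n k1 k2 ((M, s), (N, t)) = Some (v', u')"
      and sv: "snd v' = t" "snd u' = s"
      and v': "g_value n k2 v' A'" and u': "g_value n k1 u' B'" and AB: "A * B = A' * B'"
      using R_map_factorization[OF u v k1 k2, of F2] fr(2) B_def PP by (auto simp: P_def A_def)
    have p: "prev n 0 = n - 1" by (simp add: prev_def)
    define eu where "eu = loop_coeff A 0 (n - 1) / loop_coeff A 0 0"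
    define pv where "pv = loop_coeff B 0 (n - 1) / loop_coeff B (n - 1) (n - 1)"
    define ev' where "ev' = loop_coeff A' 0 (n - 1) / loop_coeff A' 0 0"
    define pu' where "pu' = loop_coeff B' 0 (n - 1) / loop_coeff B' (n - 1) (n - 1)"
    define pu where "pu = loop_coeff A 0 (n - 1) / loop_coeff A (n - 1) (n - 1)"
    define epv where "epv = loop_coeff B 0 (n - 1) / loop_coeff B 0 0"
    note em = g_e_map2_regular[OF k1 k2 n(2) c fr st reg A_def B_def p[symmetric] eu_def pv_def]
    have nz: "eu + pv \<noteq> 0" by (rule em(1))
    obtain u'' v'' A'' B'' where e: "e_map2 n k1 k2 0 c ((M, s), (N, t)) = Some (u'', v'')"
      and u'': "g_value n k1 u'' A''" and v'': "g_value n k2 v'' B''"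
      and eq: "\<And>l. l \<noteq> 0 \<Longrightarrow> ev (A'' * B'') l = xhat n 0 ((c - 1) * eu / ((eu + pv) * pu)) l *
        ev (A * B) l * xhat n 0 ((1 / c - 1) * pv / ((eu + pv) * epv)) l"
      using em(2) unfolding pu_def epv_def by blast
    note gd = g_value_g_like[OF u k1] g_value_g_like[OF v k2] g_value_g_like[OF v' k2] g_value_g_like[OF u' k1]
    have bands: "banded n (n - k1) A" "banded n (n - k2) B" "banded n (n - k2) A'" "banded n (n - k1) B'"
      using gd by (auto simp: g_like_def)
    note diag = loop_coeff_band(3)[OF bands(1) n(2) n(2) refl] loop_coeff_band(3)[OF bands(1) n(3) n(3) refl]
      loop_coeff_band(3)[OF bands(2) n(2) n(2) refl] loop_coeff_band(3)[OF bands(2) n(3) n(3) refl]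
      loop_coeff_band(3)[OF bands(3) n(2) n(2) refl] loop_coeff_band(3)[OF bands(3) n(3) n(3) refl]
      loop_coeff_band(3)[OF bands(4) n(2) n(2) refl] loop_coeff_band(3)[OF bands(4) n(3) n(3) refl]
    have nk: "n - k1 < n" "n - k2 < n" using k1 k2 by auto
    note corner = band_product_corner[OF bands(1,2) nk n(1)] band_product_corner[OF bands(3,4) nk(2,1) n(1), folded AB]
    define th where "th = coeff ((A * B) $$ (0, n - 1)) 1"
    have th: "th = (eu + pv) * (loop_coeff A 0 0 * loop_coeff B (n - 1) (n - 1))"
      unfolding th_def corner(3) eu_def pv_def using diag by (simp add: field_simps)
    have th': "th = (ev' + pu') * (loop_coeff A' 0 0 * loop_coeff B' (n - 1) (n - 1))"
      unfolding th_def corner(6) ev'_def pu'_def using diag by (simp add: field_simps)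
    have nz': "ev' + pu' \<noteq> 0" using th th' nz diag by auto
    have below: "loop_coeff A 0 (n - 1) \<noteq> 0" "loop_coeff B 0 (n - 1) \<noteq> 0"
      using loop_coeff_below_nonzero[OF k1 n(2), of F1 s] loop_coeff_below_nonzero[OF k2 n(2), of F2 t]
        reg fr st by (auto simp: crystal_regular_def frame_def A_def B_def p)
    \<comment> \<open>The two factorizations share the corner coefficients.\<close>
    note ratios = coenergy_ratios[OF diag(1-4) below diag(5-8) corner(4)[symmetric, unfolded corner(1)]
        corner(5)[symmetric, unfolded corner(2)] corner(6)[symmetric, unfolded corner(3)]
        nz[unfolded eu_def pv_def] c, folded eu_def pv_def ev'_def pu'_def pu_def epv_def]
    let ?k = "min k1 k2"
    let ?r = "\<lambda>a. n - ?k + a"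
    let ?a = "(eu + inverse c * pv) / (eu + pv)" and ?b = "(c * ev' + pu') / (ev' + pu')"
    have carr: "A \<in> carrier_mat n n" "B \<in> carrier_mat n n" "A' \<in> carrier_mat n n" "B' \<in> carrier_mat n n"
      using bands by (auto dest: bandedD(1))
    have main: "\<exists>l. row_det ?k (ev (A'' * B'') l) ?r = row_det ?k (ev (A * B) l) ?r * ?a * ?b"
    proof (cases "k2 \<le> k1")
      case True
      then have k: "?k = k2" by simp
      define z where "z = (- 1) ^ (k2 - 1) * t"
      have z: "z \<noteq> 0" using st by (simp add: z_def)
      obtain G1 X1 where 1: "G1 \<in> carrier_mat n k2" "X1 \<in> carrier_mat k2 n" "ev A' z = G1 * X1"
        using gd(3) sv unfolding g_like_def z_def by auto
      obtain G2 X2 where 2: "G2 \<in> carrier_mat n k2" "X2 \<in> carrier_mat k2 n" "ev B z = G2 * X2"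
        using gd(2) unfolding g_like_def z_def by auto
      have "row_det k2 (ev (A'' * B'') z) (\<lambda>a. n - k2 + a) =
          (1 + (c - 1) * eu / ((eu + pv) * pu) * (loop_coeff A' 0 (n - 1) / loop_coeff A' (n - 1) (n - 1))) *
          (1 + (1 / c - 1) * pv / ((eu + pv) * epv) * epv) * row_det k2 (ev (A * B) z) (\<lambda>a. n - k2 + a)"
        unfolding eq[OF z] epv_def
        by (rule bottom_minor_xhat0[OF bands(3,2) k2 z 1 2, where Y = "ev B' z" and X = "ev A z"])
          (use carr ev_mult[OF carr(1,2)] ev_mult[OF carr(3,4)] AB in auto)
      moreover have "1 + (1 / c - 1) * pv / ((eu + pv) * epv) * epv = ?a"
        by (rule ratios(1))
      moreover have "1 + (c - 1) * eu / ((eu + pv) * pu) * (loop_coeff A' 0 (n - 1) / loop_coeff A' (n - 1) (n - 1)) = ?b"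
        by (rule ratios(2))
      ultimately show ?thesis unfolding k by (intro exI[of _ z]) (simp add: mult_ac)
    next
      case False
      then have k: "?k = k1" by simp
      define z where "z = (- 1) ^ (k1 - 1) * s"
      have z: "z \<noteq> 0" using st by (simp add: z_def)
      obtain G1 X1 where 1: "G1 \<in> carrier_mat n k1" "X1 \<in> carrier_mat k1 n" "ev A z = G1 * X1"
        using gd(1) unfolding g_like_def z_def by auto
      obtain G2 X2 where 2: "G2 \<in> carrier_mat n k1" "X2 \<in> carrier_mat k1 n" "ev B' z = G2 * X2"
        using gd(4) sv unfolding g_like_def z_def by auto
      have "row_det k1 (ev (A'' * B'') z) (\<lambda>a. n - k1 + a) =
          (1 + (c - 1) * eu / ((eu + pv) * pu) * pu) *
          (1 + (1 / c - 1) * pv / ((eu + pv) * epv) * (loop_coeff B' 0 (n - 1) / loop_coeff B' 0 0)) *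
          row_det k1 (ev (A * B) z) (\<lambda>a. n - k1 + a)"
        unfolding eq[OF z] pu_def
        by (rule bottom_minor_xhat0[OF bands(1,4) k1 z 1 2, where Y = "ev B z" and X = "ev A' z"])
          (use carr ev_mult[OF carr(1,2)] ev_mult[OF carr(3,4)] AB in auto)
      moreover have "1 + (c - 1) * eu / ((eu + pv) * pu) * pu = c * ?a"
        by (rule ratios(3))
      moreover have "1 + (1 / c - 1) * pv / ((eu + pv) * epv) * (loop_coeff B' 0 (n - 1) / loop_coeff B' 0 0) = ?b / c"
        by (rule ratios(4))
      ultimately show ?thesis unfolding k using c by (intro exI[of _ z]) (simp add: mult_ac)
    qed
    then obtain l where l: "row_det ?k (ev (A'' * B'') l) ?r = row_det ?k (ev (A * B) l) ?r * ?a * ?b" by blast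
    note pe = phi_eps_g_value[OF u k1 n(2)] phi_eps_g_value[OF v k2 n(2)] phi_eps_g_value[OF v' k2 n(2)]
      phi_eps_g_value[OF u' k1 n(2)]
    note crystal = pe[unfolded p, folded eu_def pv_def ev'_def pu'_def]
    show "\<exists>h. ?F ((M, s), (N, t)) = Some h \<and> ?G ((M, s), (N, t)) = Some h"
      using e R crystal nz nz' l E_map_eq_minor[OF u v k1 k2, of l] E_map_eq_minor[OF u'' v'' k1 k2, of l]
      by (simp add: pdiv_def)
  qed
qed

theorem proposition6p5:
  fixes n k1 k2 :: nat
  assumes "n \<ge> 2" and "k1 \<in> {1..n - 1}" and "k2 \<in> {1..n - 1}"
  shows "geometric_coenergy n k1 k2 (E_map n k1 k2)"
proof -
  have k1: "0 < k1" "k1 < n" and k2: "0 < k2" "k2 < n" using assms by auto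
  show ?thesis
    unfolding geometric_coenergy_def
    using E_map_rational[OF k1 k2] E_map_e_invariant[OF k1 k2] E_map_e0[OF k1 k2] by auto
qed

end
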